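(* Assume (A1), (A2), (A3) and $\lambda\in(0,\lambda_0)$. Then for every $k\in\mathbb{N}$ and every $t\in[k\lambda,(k+1)\lambda]$, $$\frac{d}{dt}H_\pi(\hat\pi_t)\le-\frac34 I_\pi(\hat\pi_t)+\mathbb{E}\big|h(\theta_t)-h_\lambda(\theta_{k\lambda})\big|^2.$$
   Context: $u:\mathbb{R}^d\to\mathbb{R}$ of class $C^4$ with $\int e^{-u}<\infty$, $\pi\propto e^{-u}$, $h=\nabla u$. (A1): $|h(x)-h(y)|\le L'(1+|x|+|y|)^{l'}|x-y|$; (A2): $\langle h(x),x\rangle\ge A|x|^a-b$ with $a\in[1,2]$, $A,b>0$; (A3): $\max\{|h(x)|,\|J^{(i)}h(x)\|\}\le L(1+|x|^{2l})$, $i=1,2,3$. $R(x)=x/(1+|x|^2)^{1-a/2}$, $h_\lambda(x)=AR(x)+(h(x)-AR(x))/(1+\sqrt\lambda|x|^{2l})$. wd-TULA: $\theta_0\sim\rho_0$ nondegenerate Gaussian, $(\xi_n)$ i.i.d. $N(0,I_d)$, $\theta_{n+1}=\theta_n-\lambda h_\lambda(\theta_n)+\sqrt{2\lambda}\xi_{n+1}$. Interpolation: $\theta_t=\theta_{k\lambda}-(t-k\lambda)h_\lambda(\theta_{k\lambda})+\sqrt2(B_t-B_{k\lambda})$ on $[k\lambda,(k+1)\lambda]$, $(B_t)$ Brownian motion independent of $\theta_0$; $\hat\pi_t=\mathrm{Law}(\theta_t)$. $H_\pi(\nu)=\int\log\frac{d\nu}{d\pi}d\nu$, $I_\pi(\nu)=\int|\nabla\log\frac{d\nu}{d\pi}|^2d\nu$.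 $\lambda_0=\min\{1,A/4,2/\mu^2,1/(4(2AC^*+2L+1)^2)\}$, $M=(2(2d+4A^2+2L^2+A))^{1/a}$, $\mu=\frac{AaM^a}{16(1+M^2)^{1-a/2}}$, $C^*=\sup\|DR\|$. *)

theory Defs
  imports "HOL-Probability.Probability"
begin

definition rpow :: "real \<Rightarrow> real \<Rightarrow> real" where
  "rpow r p = (if p = 0 then 1 else r powr p)"

definition pos_def_matrix :: "real^'n^'n \<Rightarrow> bool" where
  "pos_def_matrix S \<longleftrightarrow> transpose S = S \<and> (\<forall>x. x \<noteq> 0 \<longrightarrow> x \<bullet> (S *v x) > 0)"

definition gaussian_measure :: "real^'n \<Rightarrow> real^'n^'n \<Rightarrow> (real^'n) measure" where
  "gaussian_measure m S = density lborel (\<lambda>x. ennreal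
      (exp (- (1/2) * ((x - m) \<bullet> (matrix_inv S *v (x - m))))
        / sqrt ((2 * pi) ^ CARD('n) * det S)))"

definition nondeg_gaussian :: "(real^'n) measure \<Rightarrow> bool" where
  "nondeg_gaussian \<rho> \<longleftrightarrow> (\<exists>m S. pos_def_matrix S \<and> \<rho> = gaussian_measure m S)"

definition brownian_indep ::
  "'w measure \<Rightarrow> ('w \<Rightarrow> real^'n) \<Rightarrow> (real \<Rightarrow> 'w \<Rightarrow> real^'n) \<Rightarrow> bool" where
  "brownian_indep M X0 B \<longleftrightarrow>
     (\<forall>t\<ge>0. B t \<in> borel_measurable M) \<and>
     (\<forall>\<omega>\<in>space M. B 0 \<omega> = 0) \<and>
     (\<forall>\<omega>\<in>space M. continuous_on {0..} (\<lambda>t. B t \<omega>)) \<and>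
     (\<forall>s t. 0 \<le> s \<and> s < t \<longrightarrow>
        distr M borel (\<lambda>\<omega>. B t \<omega> - B s \<omega>) = gaussian_measure 0 ((t - s) *\<^sub>R mat 1)) \<and>
     (\<forall>(ts :: nat \<Rightarrow> real) n. 0 \<le> ts 0 \<and> (\<forall>i<n. ts i < ts (Suc i)) \<longrightarrow>
        prob_space.indep_vars M (\<lambda>_. borel)
          (\<lambda>i \<omega>. if i = 0 then X0 \<omega> else B (ts i) \<omega> - B (ts (i - 1)) \<omega>) {0..n})"

definition R_fun :: "real \<Rightarrow> real^'n \<Rightarrow> real^'n" where
  "R_fun a x = (1 / (1 + (norm x)\<^sup>2) powr (1 - a / 2)) *\<^sub>R x"

definition h_tamed ::
  "real \<Rightarrow> real \<Rightarrow> real \<Rightarrow> real \<Rightarrow> (real^'n \<Rightarrow> real^'n) \<Rightarrow> real^'n \<Rightarrow> real^'n" where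
  "h_tamed A a l lam h = (\<lambda>x. A *\<^sub>R R_fun a x +
      (1 / (1 + sqrt lam * rpow (norm x) (2 * l))) *\<^sub>R (h x - A *\<^sub>R R_fun a x))"

text \<open>Discrete chain driven by the Brownian increments: xi_{n+1} = (B_{(n+1)lambda} - B_{n lambda})/sqrt lambda.\<close>
primrec theta_disc ::
  "(real^'n \<Rightarrow> real^'n) \<Rightarrow> real \<Rightarrow> ('w \<Rightarrow> real^'n) \<Rightarrow> (real \<Rightarrow> 'w \<Rightarrow> real^'n) \<Rightarrow> nat \<Rightarrow> 'w \<Rightarrow> real^'n"
where
  "theta_disc H lam X0 B 0 \<omega> = X0 \<omega>"
| "theta_disc H lam X0 B (Suc n) \<omega> =
     theta_disc H lam X0 B n \<omega> - lam *\<^sub>R H (theta_disc H lam X0 B n \<omega>)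
     + sqrt 2 *\<^sub>R (B (real (Suc n) * lam) \<omega> - B (real n * lam) \<omega>)"

definition theta_interp ::
  "(real^'n \<Rightarrow> real^'n) \<Rightarrow> real \<Rightarrow> ('w \<Rightarrow> real^'n) \<Rightarrow> (real \<Rightarrow> 'w \<Rightarrow> real^'n) \<Rightarrow> real \<Rightarrow> 'w \<Rightarrow> real^'n"
where
  "theta_interp H lam X0 B t \<omega> =
     (let k = nat \<lfloor>t / lam\<rfloor>; y = theta_disc H lam X0 B k \<omega> in
       y - (t - real k * lam) *\<^sub>R H y + sqrt 2 *\<^sub>R (B t \<omega> - B (real k * lam) \<omega>))"

definition gibbs :: "(real^'n \<Rightarrow> real) \<Rightarrow> (real^'n) measure" where
  "gibbs u = density lborel (\<lambda>x. ennreal (exp (- u x) / (\<integral>y. exp (- u y) \<partial>lborel)))"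

definition rel_entropy :: "'a measure \<Rightarrow> 'a measure \<Rightarrow> real" where
  "rel_entropy \<pi> \<nu> = KL_divergence (exp 1) \<pi> \<nu>"

definition grad :: "(real^'n \<Rightarrow> real) \<Rightarrow> real^'n \<Rightarrow> real^'n" where
  "grad f x = (SOME v. (f has_derivative (\<lambda>y. v \<bullet> y)) (at x))"

text \<open>I_pi(nu) = int |grad log (dnu/dpi)|^2 dnu, where dnu/dpi is taken to be the (unique)
  everywhere positive differentiable version of the density; +infinity if none exists.\<close>
definition smooth_density :: "(real^'n) measure \<Rightarrow> (real^'n) measure \<Rightarrow> (real^'n \<Rightarrow> real) \<Rightarrow> bool" where
  "smooth_density \<pi> \<nu> g \<longleftrightarrow> (\<forall>x. 0 < g x) \<and> (\<forall>x. g differentiable (at x)) \<and> \<nu> = density \<pi> g"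

definition fisher_info :: "(real^'n) measure \<Rightarrow> (real^'n) measure \<Rightarrow> ereal" where
  "fisher_info \<pi> \<nu> =
     (if \<exists>g. smooth_density \<pi> \<nu> g
      then (let g = SOME g. smooth_density \<pi> \<nu> g in
            enn2ereal (\<integral>\<^sup>+x. ennreal ((norm (grad (\<lambda>y. ln (g y)) x))\<^sup>2) \<partial>\<nu>))
      else \<infinity>)"

definition Cstar :: "real \<Rightarrow> 'n::finite itself \<Rightarrow> real" where
  "Cstar a (_ :: 'n::finite itself) = (SUP x :: real^'n. onorm (frechet_derivative (R_fun a) (at x)))"

definition M_const :: "nat \<Rightarrow> real \<Rightarrow> real \<Rightarrow> real \<Rightarrow> real" where
  "M_const d A L a = (2 * (2 * real d + 4 * A\<^sup>2 + 2 * L\<^sup>2 + A)) powr (1 / a)"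

definition mu_const :: "nat \<Rightarrow> real \<Rightarrow> real \<Rightarrow> real \<Rightarrow> real" where
  "mu_const d A L a = A * a * (M_const d A L a) powr a
      / (16 * (1 + (M_const d A L a)\<^sup>2) powr (1 - a / 2))"

definition lambda0 :: "'n::finite itself \<Rightarrow> real \<Rightarrow> real \<Rightarrow> real \<Rightarrow> real" where
  "lambda0 T A L a = Min {1, A / 4, 2 / (mu_const CARD('n) A L a)\<^sup>2,
      1 / (4 * (2 * A * Cstar a T + 2 * L + 1)\<^sup>2)}"

end

theory Submission
  imports Defs
begin

text \<open>
  Write \<open>\<theta> s = y - s H y + sqrt (2 s) z\<close> for the Euler step from \<open>Y\<close> with Gaussian noise \<open>z\<close>, \<open>p s\<close>
  for its density, and \<open>f = ln (p t) + u\<close> for the log-density relative to the Gibbs measure at a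
  fixed time \<open>t\<close>. Then the entropy at time \<open>s\<close> is, up to a constant, \<open>E f (\<theta> s) + KL (p s | p t)\<close>. The
  second term is nonnegative and \<open>o(s - t)\<close>, and differentiating the first under the expectation gives
  \<open>- E (\<nabla>f (\<theta> t) \<bullet> (\<nabla>ln (p t) (\<theta> t) + H Y)) = - E |\<nabla>f|\<^sup>2 + E (\<nabla>f \<bullet> (h (\<theta> t) - H Y))\<close>, so that Young's
  inequality concludes. No second derivative of a density is ever taken. This matters at \<open>t = 0\<close>: the
  tamed drift need not be Lipschitz (take \<open>0 < 2 l < 1\<close>), and there one only uses that \<open>H\<close> is
  continuous with linear growth and that \<open>ln (p 0)\<close> is differentiable with a gradient of linear growth,
  a property that every Euler step restores.
\<close>

section \<open>The standard Gaussian measure\<close>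

text \<open>The two divergence estimates beat first order for different reasons. At
  \<open>t > 0\<close> the joint laws of old and new position are compared: given the old position
  they are Gaussians whose mean and variance move smoothly with \<open>s\<close>, so the bound
  vanishes to second order at \<open>s = t\<close>. This bound divides by \<open>t\<close>. At
  \<open>t = 0\<close> a chi-square distance is used instead: \<open>dens s / p - 1\<close> is
  expanded in \<open>sqrt s\<close>, the leading coefficient is linear in \<open>z\<close> and
  averages to zero, what remains is \<open>o(sqrt s)\<close>, and squaring gives
  \<open>o(s)\<close>. The score enters at \<open>t > 0\<close> as a conditional mean of the noise
  given the new position, and at \<open>t = 0\<close> through the covariance
  \<open>E (a \<bullet> z) (b \<bullet> z) = a \<bullet> b\<close>. These two identities stand in
  for integration by parts. The class \<open>regular_density\<close> also carries a Gaussian moment.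
  A score of linear growth bounds \<open>ln p (x - \<eta> z) - ln p x\<close> only by
  \<open>\<eta>\<close> times a quadratic, so density ratios are dominated by Gaussian weights for
  small \<open>\<eta>\<close>, and the moment makes these weights integrable.\<close>

definition gauss :: "'a::euclidean_space \<Rightarrow> real" where
  "gauss z = exp (- (norm z)\<^sup>2 / 2) / sqrt ((2 * pi) ^ DIM('a))"

definition std_gaussian :: "'a::euclidean_space measure" where
  "std_gaussian = density lborel gauss"

lemma gauss_pos: "0 < gauss z"
  by (simp add: gauss_def)

lemma gauss_nonneg [simp]: "0 \<le> gauss z"
  using gauss_pos[of z] by simp

lemma continuous_on_gauss: "continuous_on UNIV gauss"
  unfolding gauss_def by (intro continuous_intros) auto

lemma borel_measurable_gauss [measurable]: "gauss \<in> borel_measurable borel"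
  using continuous_on_gauss by (rule borel_measurable_continuous_onI)

lemma sets_std_gaussian [simp, measurable_cong]: "sets std_gaussian = sets borel"
  by (simp add: std_gaussian_def)

lemma space_std_gaussian [simp]: "space std_gaussian = UNIV"
  by (simp add: std_gaussian_def)

lemma norm_power2_eq_sum_Basis:
  fixes z :: "'a::euclidean_space"
  shows "(norm z)\<^sup>2 = (\<Sum>b\<in>Basis. (z \<bullet> b)\<^sup>2)"
  unfolding power2_norm_eq_inner by (subst euclidean_inner) (simp add: power2_eq_square)

text \<open>\<open>|z|^2\<close> is the sum of the squared coordinates, so the exponential
  factorises. Gaussian integrals on the whole space thereby become products of one-dimensional
  normal integrals.\<close>

lemma gauss_eq_prod:
  fixes z :: "'a::euclidean_space"
  shows "gauss z = (\<Prod>b\<in>Basis. std_normal_density (z \<bullet> b))"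
proof -
  define \<kappa> where "\<kappa> = 1 / sqrt (2*pi)"
  have "(\<Prod>b\<in>Basis. std_normal_density (z \<bullet> b))
     = (\<Prod>b\<in>Basis. \<kappa> * exp (- (z \<bullet> b)\<^sup>2 / 2))"
    by (simp add: std_normal_density_def \<kappa>_def)
  also have "\<dots> = \<kappa> ^ DIM('a) * exp (\<Sum>b\<in>Basis. - (z \<bullet> b)\<^sup>2 / 2)"
    by (subst exp_sum) (auto simp: prod.distrib)
  also have "(\<Sum>b\<in>Basis. - (z \<bullet> b)\<^sup>2 / 2) = - (norm z)\<^sup>2 / 2"
    by (simp add: norm_power2_eq_sum_Basis sum_negf sum_divide_distrib)
  finally show ?thesis
    unfolding gauss_def \<kappa>_def real_sqrt_power[symmetric] power_one_over by simp
qed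

lemma nn_integral_std_normal: "(\<integral>\<^sup>+x. ennreal (std_normal_density x) \<partial>lborel) = 1"
  using prob_space.emeasure_space_1[OF prob_space_normal_density[of 1 0]]
  by (simp add: emeasure_density)

lemma prob_space_std_gaussian: "prob_space (std_gaussian :: 'a::euclidean_space measure)"
proof
  have "(\<integral>\<^sup>+z. ennreal (gauss (z::'a)) \<partial>lborel)
    = (\<integral>\<^sup>+z. (\<Prod>b\<in>Basis. ennreal (std_normal_density (z \<bullet> b))) \<partial>(lborel::'a measure))"
    by (simp add: gauss_eq_prod prod_ennreal)
  also have "\<dots> = (\<Prod>b\<in>(Basis::'a set). \<integral>\<^sup>+x. ennreal (std_normal_density x) \<partial>lborel)"
    by (rule nn_integral_lborel_prod) auto
  finally show "emeasure (std_gaussian :: 'a measure) (space std_gaussian) = 1"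
    by (simp add: std_gaussian_def emeasure_density nn_integral_std_normal)
qed

lemma integrable_exp_neg_norm2:
  assumes "0 < \<beta>"
  shows "integrable lborel (\<lambda>z::'a::euclidean_space. exp (- \<beta> * (norm z)\<^sup>2))"
proof (rule integrableI_bounded)
  \<comment> \<open>The normal density of variance \<open>1 / (2 \<beta>)\<close> has exponent
    \<open>- \<beta> x^2\<close>, so each coordinate factor is a multiple of it.\<close>
  define \<sigma> where "\<sigma> = 1 / sqrt (2 * \<beta>)"
  have s: "\<sigma> > 0" "2 * \<sigma>\<^sup>2 = 1 / \<beta>" using assms by (auto simp: \<sigma>_def power_divide)
  have nd: "exp (- \<beta> * x\<^sup>2) = sqrt (2 * pi * \<sigma>\<^sup>2) * normal_density 0 \<sigma> x" for x
    using s(1) by (simp add: normal_density_def s(2))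
  have fin: "(\<integral>\<^sup>+x. ennreal (exp (- \<beta> * x\<^sup>2)) \<partial>lborel) < \<infinity>"
  proof -
    have "integrable lborel (\<lambda>x. sqrt (2 * pi * \<sigma>\<^sup>2) * normal_density 0 \<sigma> x)" using s by simp
    then have "integrable lborel (\<lambda>x. exp (- \<beta> * x\<^sup>2))" unfolding nd[symmetric] .
    from integrableD(2)[OF this] show ?thesis by (simp add: top.not_eq_extremum)
  qed
  have "(\<integral>\<^sup>+z. ennreal (norm (exp (- \<beta> * (norm (z::'a))\<^sup>2))) \<partial>lborel)
    = (\<integral>\<^sup>+z. (\<Prod>b\<in>Basis. ennreal (exp (- \<beta> * (z \<bullet> b)\<^sup>2))) \<partial>(lborel::'a measure))"
    by (simp add: norm_power2_eq_sum_Basis prod_ennreal sum_distrib_left sum_negf[symmetric] exp_sum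
        prod_nonneg abs_of_nonneg)
  also have "\<dots> = (\<Prod>b\<in>(Basis::'a set). \<integral>\<^sup>+x. ennreal (exp (- \<beta> * x\<^sup>2)) \<partial>lborel)"
    by (rule nn_integral_lborel_prod) auto
  also have "\<dots> < \<infinity>" using fin by (simp add: power_less_top_ennreal)
  finally show "(\<integral>\<^sup>+z. ennreal (norm (exp (- \<beta> * (norm z)\<^sup>2))) \<partial>(lborel::'a measure)) < \<infinity>" .
qed simp

section \<open>Affine changes of variables, and polynomials under Gaussian weights\<close>

lemma nn_integral_lborel_affine:
  fixes t :: "'a::euclidean_space"
  assumes [measurable]: "f \<in> borel_measurable borel" and "c \<noteq> 0"
  shows "(\<integral>\<^sup>+x. f x \<partial>lborel) = ennreal (\<bar>c\<bar> ^ DIM('a)) * (\<integral>\<^sup>+x. f (t + c *\<^sub>R x) \<partial>lborel)"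
  by (subst lborel_affine[OF \<open>c \<noteq> 0\<close>, of t])
     (simp add: nn_integral_density nn_integral_distr nn_integral_cmult)

lemma integral_lborel_affine:
  fixes t :: "'a::euclidean_space" and f :: "'a \<Rightarrow> real"
  assumes [measurable]: "f \<in> borel_measurable borel" and "c \<noteq> 0"
  shows "(\<integral>x. f x \<partial>lborel) = \<bar>c\<bar> ^ DIM('a) * (\<integral>x. f (t + c *\<^sub>R x) \<partial>lborel)"
  by (subst lborel_affine[OF \<open>c \<noteq> 0\<close>, of t])
     (simp add: integral_density integral_distr)

lemma integrable_lborel_affine:
  fixes t :: "'a::euclidean_space" and f :: "'a \<Rightarrow> real"
  assumes [measurable]: "f \<in> borel_measurable borel" and "c \<noteq> 0"
  shows "integrable lborel (\<lambda>x. f (t + c *\<^sub>R x)) \<longleftrightarrow> integrable lborel f"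
  using \<open>c \<noteq> 0\<close>
  by (subst (2) lborel_affine[OF \<open>c \<noteq> 0\<close>, of t])
     (simp add: integrable_density integrable_distr_eq)

lemma power_le_exp_norm2:
  assumes "0 < (\<epsilon>::real)"
  shows "\<exists>C>0. \<forall>r\<ge>0. (1 + r) ^ m \<le> C * exp (\<epsilon> * r\<^sup>2)"
proof (cases "m = 0")
  case True then show ?thesis using assms by (intro exI[of _ 1]) auto
next
  case False
  \<comment> \<open>Chosen so that the \<open>m\<close>-th power of
    \<open>exp (\<delta> (2 + 2 r^2))\<close> is \<open>exp (\<epsilon> (1 + r^2))\<close>; the
    division by \<open>m\<close> is why \<open>m = 0\<close> is split off.\<close>
  define \<delta> where "\<delta> = \<epsilon> / (2 * real m)"
  have d: "\<delta> > 0" using assms False by (auto simp: \<delta>_def)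
  have "(1 + r) ^ m \<le> (1/\<delta>) ^ m * exp \<epsilon> * exp (\<epsilon> * r\<^sup>2)" if "r \<ge> 0" for r
  proof -
    have "1 + r \<le> (1 + r)\<^sup>2" using that by (simp add: power2_eq_square)
    also have "\<dots> \<le> 2 + 2 * r\<^sup>2" using sum_squares_bound[of 1 r] by (simp add: power2_eq_square algebra_simps)
    finally have "\<delta> * (1 + r) \<le> \<delta> * (2 + 2 * r\<^sup>2)" using d by simp
    also have "\<dots> \<le> exp (\<delta> * (2 + 2 * r\<^sup>2))"
      using exp_ge_add_one_self[of "\<delta> * (2 + 2 * r\<^sup>2)"] by linarith
    finally have "(\<delta> * (1 + r)) ^ m \<le> exp (\<delta> * (2 + 2 * r\<^sup>2)) ^ m"
      using d that by (intro power_mono) auto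
    also have "\<dots> = exp (\<epsilon> * (1 + r\<^sup>2))"
      using False by (simp add: exp_of_nat_mult[symmetric] \<delta>_def field_simps)
    finally have "\<delta> ^ m * (1 + r) ^ m \<le> exp \<epsilon> * exp (\<epsilon> * r\<^sup>2)"
      unfolding power_mult_distrib exp_add[symmetric] by (simp add: algebra_simps)
    then show ?thesis using d by (simp add: field_simps)
  qed
  then show ?thesis using d by (intro exI[of _ "(1/\<delta>) ^ m * exp \<epsilon>"]) auto
qed

section \<open>Integrability and second moments of the standard Gaussian\<close>

lemma integral_std_gaussian:
  fixes f :: "'a::euclidean_space \<Rightarrow> real"
  assumes "f \<in> borel_measurable borel"
  shows "(\<integral>z. f z \<partial>std_gaussian) = (\<integral>z. gauss z * f z \<partial>lborel)"
  unfolding std_gaussian_def using assms by (subst integral_density) auto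

lemma integrable_std_gaussian_iff:
  fixes f :: "'a::euclidean_space \<Rightarrow> real"
  assumes "f \<in> borel_measurable borel"
  shows "integrable std_gaussian f \<longleftrightarrow> integrable lborel (\<lambda>z. gauss z * f z)"
  unfolding std_gaussian_def using assms by (subst integrable_density) auto

text \<open>The rate \<open>1/4\<close> is below the rate \<open>1/2\<close> of
  \<open>gauss\<close>, so a weight \<open>exp (- |z|^2 / 4)\<close> remains. This exponential is
  the reference majorant in the noise variable from here on.\<close>

lemma integrable_std_gaussian_exp:
  "integrable std_gaussian (\<lambda>z::'a::euclidean_space. exp ((norm z)\<^sup>2 / 4))"
proof -
  have "(\<lambda>z::'a. gauss z * exp ((norm z)\<^sup>2 / 4))
      = (\<lambda>z. exp (- (1/4) * (norm z)\<^sup>2) / sqrt ((2 * pi) ^ DIM('a)))"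
    by (rule ext) (simp add: gauss_def exp_add[symmetric] field_simps)
  then show ?thesis
    using integrable_exp_neg_norm2[of "1/4", where 'a='a]
    by (subst integrable_std_gaussian_iff) auto
qed

lemma integrable_std_gaussian_poly:
  fixes f :: "'a::euclidean_space \<Rightarrow> real"
  assumes [measurable]: "f \<in> borel_measurable borel" and "\<And>z. \<bar>f z\<bar> \<le> C * (1 + norm z) ^ m"
  shows "integrable std_gaussian f"
proof -
  obtain C' where C': "C' > 0" "\<And>r::real. r\<ge>0 \<Longrightarrow> (1 + r) ^ m \<le> C' * exp (r\<^sup>2 / 4)"
    using power_le_exp_norm2[of "1/4" m] by auto
  have "C \<ge> 0" using assms(2)[of 0] by auto
  show ?thesis
  proof (rule Bochner_Integration.integrable_bound)
    show "integrable std_gaussian (\<lambda>z::'a. C * (C' * exp ((norm z)\<^sup>2 / 4)))"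
      using integrable_std_gaussian_exp by auto
    have "\<bar>f z\<bar> \<le> C * (C' * exp ((norm z)\<^sup>2 / 4))" for z
      using assms(2)[of z] mult_left_mono[OF C'(2)[of "norm z"] \<open>C \<ge> 0\<close>] by simp
    then show "AE z in std_gaussian. norm (f z) \<le> norm (C * (C' * exp ((norm z)\<^sup>2 / 4)))"
      using C' \<open>C \<ge> 0\<close> by auto
  qed simp
qed

lemma integrable_std_gaussian_bilinear:
  "integrable std_gaussian (\<lambda>z::'a::euclidean_space. (a \<bullet> z) * (b \<bullet> z))"
proof (rule integrable_std_gaussian_poly[where m=2 and C="norm a * norm b"])
  fix z :: 'a
  have "\<bar>(a \<bullet> z) * (b \<bullet> z)\<bar> \<le> (norm a * norm z) * (norm b * norm z)"
    unfolding abs_mult by (intro mult_mono Cauchy_Schwarz_ineq2) auto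
  also have "\<dots> = norm a * norm b * (norm z)^2" by (simp add: power2_eq_square)
  also have "\<dots> \<le> norm a * norm b * (1 + norm z)^2"
    by (intro mult_left_mono power_mono) auto
  finally show "\<bar>(a \<bullet> z) * (b \<bullet> z)\<bar> \<le> norm a * norm b * (1 + norm z)^2" .
qed simp

text \<open>The substitution \<open>z -> - z\<close> preserves \<open>gauss\<close> and flips the
  sign of the integrand.\<close>

lemma std_gaussian_mean: "(\<integral>z. a \<bullet> z \<partial>std_gaussian) = 0" for a :: "'a::euclidean_space"
proof -
  have "(\<integral>z. gauss z * (a \<bullet> z) \<partial>lborel) = (\<integral>z. gauss (- z) * (a \<bullet> (- z)) \<partial>lborel)"
    using integral_lborel_affine[of "\<lambda>z. gauss z * (a \<bullet> z)" "-1" 0] by simp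
  then show ?thesis
    by (simp add: integral_std_gaussian gauss_def)
qed

lemma std_gaussian_Basis_square:
  assumes i: "i \<in> (Basis :: 'a::euclidean_space set)"
  shows "(\<integral>z. (z \<bullet> i)\<^sup>2 \<partial>std_gaussian) = 1"
proof -
  \<comment> \<open>Coordinate \<open>i\<close> carries the extra factor \<open>x^2\<close>, the
    others only the normal density, so the integral is again a product: one second moment times
    total masses.\<close>
  let ?f = "\<lambda>b x. if b = i then x\<^sup>2 * std_normal_density x else std_normal_density x"
  have m2: "(\<integral>\<^sup>+x. ennreal (x\<^sup>2 * std_normal_density x) \<partial>lborel) = 1"
  proof -
    have "has_bochner_integral lborel (\<lambda>x. std_normal_density x * x ^ (2 * 1)) (fact (2 * 1) / (2^1 * fact 1))"
      by (rule std_normal_moment_even)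
    then have "has_bochner_integral lborel (\<lambda>x. x\<^sup>2 * std_normal_density x) 1"
      by (simp add: mult.commute fact_numeral)
    then show ?thesis
      by (subst nn_integral_eq_integral) (auto simp: has_bochner_integral_iff)
  qed
  have p: "gauss z * (z \<bullet> i)\<^sup>2 = (\<Prod>b\<in>Basis. ?f b (z \<bullet> b))" for z
  proof -
    have "(\<Prod>b\<in>Basis - {i}. ?f b (z \<bullet> b)) = (\<Prod>b\<in>Basis - {i}. std_normal_density (z \<bullet> b))"
      by (intro prod.cong) auto
    then show ?thesis
      unfolding gauss_eq_prod by (subst (1 2) prod.remove[OF finite_Basis i]) simp
  qed
  have "(\<integral>\<^sup>+z. ennreal (gauss z * (z \<bullet> i)\<^sup>2) \<partial>lborel)
      = (\<integral>\<^sup>+z. (\<Prod>b\<in>Basis. ennreal (?f b (z \<bullet> b))) \<partial>lborel)"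
    unfolding p by (intro nn_integral_cong) (simp add: prod_ennreal)
  also have "\<dots> = (\<Prod>b\<in>(Basis::'a set). \<integral>\<^sup>+x. ennreal (?f b x) \<partial>lborel)"
    by (rule nn_integral_lborel_prod) auto
  also have "\<dots> = (\<Prod>b\<in>(Basis::'a set). 1)"
    by (intro prod.cong refl, rename_tac b, case_tac "b = i") (simp_all add: m2 nn_integral_std_normal)
  finally have "(\<integral>\<^sup>+z. ennreal (gauss z * (z \<bullet> i)\<^sup>2) \<partial>lborel) = 1" by simp
  then have "(\<integral>z. gauss z * (z \<bullet> i)\<^sup>2 \<partial>lborel) = 1"
    by (subst integral_eq_nn_integral) auto
  then show ?thesis
    by (simp add: integral_std_gaussian)
qed

text \<open>Flipping the sign of coordinate \<open>i\<close> alone preserves Lebesgue measure and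
  \<open>gauss\<close> but negates the integrand.\<close>

lemma std_gaussian_Basis_orthogonal:
  assumes i: "i \<in> (Basis :: 'a::euclidean_space set)" and j: "j \<in> Basis" "i \<noteq> j"
  shows "(\<integral>z. (z \<bullet> i) * (z \<bullet> j) \<partial>std_gaussian) = 0"
proof -
  define c :: "'a \<Rightarrow> real" where "c k = (if k = i then -1 else 1)" for k
  define T :: "'a \<Rightarrow> 'a" where "T x = 0 + (\<Sum>k\<in>Basis. (c k * (x \<bullet> k)) *\<^sub>R k)" for x
  have [measurable]: "T \<in> borel_measurable borel" unfolding T_def by measurable
  have Tk: "T x \<bullet> k = c k * (x \<bullet> k)" if "k \<in> Basis" for x k
    using that by (simp add: T_def inner_sum_left inner_Basis if_distrib[of "\<lambda>z. _ * z"] sum.delta cong: if_cong)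
  have nT: "norm (T x) = norm x" for x
  proof -
    have "(norm (T x))\<^sup>2 = (norm x)\<^sup>2"
      unfolding norm_power2_eq_sum_Basis by (intro sum.cong) (auto simp: Tk c_def)
    then show ?thesis by simp
  qed
  have L: "(lborel :: 'a measure) = density (distr lborel borel T) (\<lambda>_. (\<Prod>j\<in>Basis. \<bar>c j\<bar>))"
    unfolding T_def by (rule lborel_affine_euclidean) (auto simp: c_def)
  also have "(\<Prod>j\<in>(Basis::'a set). \<bar>c j\<bar>) = 1" by (intro prod.neutral) (auto simp: c_def)
  finally have L: "(lborel :: 'a measure) = distr lborel borel T" by (simp add: density_1)
  have "(\<integral>z. gauss z * ((z \<bullet> i) * (z \<bullet> j)) \<partial>lborel) = (\<integral>z. gauss (T z) * ((T z \<bullet> i) * (T z \<bullet> j)) \<partial>lborel)"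
    by (subst L) (simp add: integral_distr)
  also have "\<dots> = (\<integral>z. - (gauss z * ((z \<bullet> i) * (z \<bullet> j))) \<partial>lborel)"
    using i j by (intro Bochner_Integration.integral_cong) (auto simp: Tk c_def gauss_def nT)
  finally show ?thesis by (simp add: integral_std_gaussian)
qed

lemma std_gaussian_covariance:
  "(\<integral>z. (a \<bullet> z) * (b \<bullet> z) \<partial>std_gaussian) = a \<bullet> b" for a :: "'a::euclidean_space"
proof -
  have ij: "(\<integral>z. (z \<bullet> i) * (z \<bullet> j) \<partial>std_gaussian) = (if i = j then 1 else 0)"
    if "i \<in> Basis" "j \<in> Basis" for i j :: 'a
    using std_gaussian_Basis_square[OF that(1)] std_gaussian_Basis_orthogonal[OF that]
    by (auto simp: power2_eq_square)
  have int: "integrable std_gaussian (\<lambda>z. (z \<bullet> i) * (z \<bullet> j))" for i j :: 'a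
    using integrable_std_gaussian_bilinear[of i j] by (simp add: inner_commute)
  have "(\<lambda>z. (a \<bullet> z) * (b \<bullet> z))
     = (\<lambda>z. \<Sum>i\<in>Basis. \<Sum>j\<in>Basis. ((a \<bullet> i) * (b \<bullet> j)) * ((z \<bullet> i) * (z \<bullet> j)))"
    by (subst euclidean_inner[of a], subst euclidean_inner[of b])
       (simp add: sum_product algebra_simps)
  then have "(\<integral>z. (a \<bullet> z) * (b \<bullet> z) \<partial>std_gaussian)
     = (\<Sum>i\<in>Basis. \<Sum>j\<in>Basis. ((a \<bullet> i) * (b \<bullet> j)) * (if i = j then 1 else 0))"
    by (simp add: int ij)
  also have "\<dots> = a \<bullet> b"
    by (subst euclidean_inner) (simp add: if_distrib[of "\<lambda>z. _ * z"] sum.delta cong: if_cong)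
  finally show ?thesis .
qed

lemma std_gaussian_norm2: "(\<integral>z. (norm (z::'a::euclidean_space))\<^sup>2 \<partial>std_gaussian) = DIM('a::euclidean_space)"
proof -
  have int: "integrable std_gaussian (\<lambda>z. (z \<bullet> i)\<^sup>2)" for i :: 'a
    using integrable_std_gaussian_bilinear[of i i] by (simp add: inner_commute power2_eq_square)
  show "(\<integral>z. (norm (z::'a))\<^sup>2 \<partial>std_gaussian) = DIM('a)"
    by (simp add: norm_power2_eq_sum_Basis int std_gaussian_Basis_square)
qed

section \<open>Dominated differentiation and the heat kernel\<close>

text \<open>Limits at a point of a metric space are decided by sequences, so dominated convergence
  for sequences suffices; passing to the tail from \<open>N\<close> on absorbs that measurability
  and the bound hold only eventually.\<close>

lemma tendsto_integral_dominated:
  fixes F :: "'a::metric_space \<Rightarrow> 'b \<Rightarrow> real"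
  assumes meas: "eventually (\<lambda>x'. F x' \<in> borel_measurable M) (at x within S)"
    and L: "L \<in> borel_measurable M"
    and bound: "eventually (\<lambda>x'. \<forall>y\<in>space M. \<bar>F x' y\<bar> \<le> g y) (at x within S)"
    and lim: "\<And>y. y \<in> space M \<Longrightarrow> ((\<lambda>x'. F x' y) \<longlongrightarrow> L y) (at x within S)"
    and g: "integrable M g"
  shows "((\<lambda>x'. \<integral>y. F x' y \<partial>M) \<longlongrightarrow> (\<integral>y. L y \<partial>M)) (at x within S)"
  unfolding tendsto_at_iff_sequentially
proof (intro allI impI)
  fix X :: "nat \<Rightarrow> 'a"
  assume X: "\<forall>i. X i \<in> S - {x}" and Xx: "X \<longlonglongrightarrow> x"
  have at: "filterlim X (at x within S) sequentially"
    using X Xx by (auto simp: filterlim_at)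
  have "eventually (\<lambda>i. F (X i) \<in> borel_measurable M \<and> (\<forall>y\<in>space M. \<bar>F (X i) y\<bar> \<le> g y)) sequentially"
    using filterlim_iff[THEN iffD1, OF at, rule_format, OF eventually_conj[OF meas bound]] .
  then obtain N where N: "\<And>i. i \<ge> N \<Longrightarrow> F (X i) \<in> borel_measurable M"
      "\<And>i y. i \<ge> N \<Longrightarrow> y \<in> space M \<Longrightarrow> \<bar>F (X i) y\<bar> \<le> g y"
    by (auto simp: eventually_sequentially)
  have "(\<lambda>i. \<integral>y. F (X (i + N)) y \<partial>M) \<longlonglongrightarrow> (\<integral>y. L y \<partial>M)"
  proof (rule integral_dominated_convergence[where w=g])
    show "AE y in M. (\<lambda>i. F (X (i + N)) y) \<longlonglongrightarrow> L y"
      using filterlim_compose[OF lim at] by (auto intro!: AE_I2 LIMSEQ_ignore_initial_segment)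
  qed (use N g L in auto)
  then show "((\<lambda>x'. \<integral>y. F x' y \<partial>M) \<circ> X) \<longlonglongrightarrow> (\<integral>y. L y \<partial>M)"
    unfolding comp_def by (rule LIMSEQ_offset)
qed

text \<open>Dominated convergence is applied to the Frechet remainder divided by
  \<open>|x' - x|\<close>. It tends to zero pointwise and is at most \<open>2 g\<close>, one
  \<open>g\<close> from the Lipschitz bound and one from the gradient.\<close>

lemma has_derivative_integral_dominated:
  fixes f :: "'a::euclidean_space \<Rightarrow> 'b \<Rightarrow> real" and f' :: "'b \<Rightarrow> 'a"
  assumes "0 < \<delta>"
    and int: "\<And>x'. x' \<in> ball x \<delta> \<Longrightarrow> integrable M (f x')"
    and f' [measurable]: "f' \<in> borel_measurable M"
    and der: "\<And>y. y \<in> space M \<Longrightarrow> ((\<lambda>x'. f x' y) has_derivative (\<lambda>v. f' y \<bullet> v)) (at x)"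
    and lip: "\<And>x' y. y \<in> space M \<Longrightarrow> x' \<in> ball x \<delta> \<Longrightarrow> \<bar>f x' y - f x y\<bar> \<le> g y * norm (x' - x)"
    and bound: "\<And>y. y \<in> space M \<Longrightarrow> norm (f' y) \<le> g y"
    and g: "integrable M g"
  shows "integrable M f'"
    and "((\<lambda>x'. \<integral>y. f x' y \<partial>M) has_derivative (\<lambda>v. (\<integral>y. f' y \<partial>M) \<bullet> v)) (at x)"
proof -
  show int': "integrable M f'"
    by (rule Bochner_Integration.integrable_bound[OF g]) (use bound in \<open>auto intro!: AE_I2 order_trans[OF bound abs_ge_self]\<close>)
  define F where "F x' y = norm ((f x' y - f x y) - f' y \<bullet> (x' - x)) / norm (x' - x)" for x' y
  have near: "eventually (\<lambda>x'. x' \<in> ball x \<delta>) (at x)"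
    using \<open>0 < \<delta>\<close> by (intro eventually_at_in_open') auto
  have fx: "integrable M (f x)" using int[of x] \<open>0 < \<delta>\<close> by simp
  have F_int: "integrable M (F x')" if "x' \<in> ball x \<delta>" for x'
    unfolding F_def using int[OF that] fx int' by simp
  have "((\<lambda>x'. \<integral>y. F x' y \<partial>M) \<longlongrightarrow> (\<integral>y. 0 \<partial>M)) (at x)"
  proof (rule tendsto_integral_dominated)
    show "eventually (\<lambda>x'. F x' \<in> borel_measurable M) (at x)"
      using near by eventually_elim (use F_int in auto)
    show "eventually (\<lambda>x'. \<forall>y\<in>space M. \<bar>F x' y\<bar> \<le> 2 * g y) (at x)"
      using near
    proof eventually_elim
      case (elim x')
      show ?case
      proof
        fix y assume y: "y \<in> space M"
        have "norm ((f x' y - f x y) - f' y \<bullet> (x' - x)) \<le> \<bar>f x' y - f x y\<bar> + \<bar>f' y \<bullet> (x' - x)\<bar>"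
          by simp
        also have "\<dots> \<le> g y * norm (x' - x) + norm (f' y) * norm (x' - x)"
          using lip[OF y elim] Cauchy_Schwarz_ineq2 by (intro add_mono) auto
        also have "\<dots> \<le> 2 * g y * norm (x' - x)"
          using mult_right_mono[OF bound[OF y], of "norm (x' - x)"] by simp
        finally show "\<bar>F x' y\<bar> \<le> 2 * g y"
          using order_trans[OF norm_ge_zero bound[OF y]]
          by (cases "x' = x") (auto simp: F_def field_simps)
      qed
    qed
    show "((\<lambda>x'. F x' y) \<longlongrightarrow> 0) (at x)" if "y \<in> space M" for y
      using der[OF that] unfolding has_derivative_iff_norm F_def by simp
  qed (use g in auto)
  then have lim: "((\<lambda>x'. \<integral>y. F x' y \<partial>M) \<longlongrightarrow> 0) (at x)" by simp
  have "((\<lambda>x'. norm (((\<integral>y. f x' y \<partial>M) - (\<integral>y. f x y \<partial>M)) - (\<integral>y. f' y \<partial>M) \<bullet> (x' - x)) / norm (x' - x))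
     \<longlongrightarrow> 0) (at x)"
  proof (rule Lim_null_comparison[OF _ lim])
    show "eventually (\<lambda>x'. norm (norm (((\<integral>y. f x' y \<partial>M) - (\<integral>y. f x y \<partial>M)) - (\<integral>y. f' y \<partial>M) \<bullet> (x' - x)) / norm (x' - x))
       \<le> (\<integral>y. F x' y \<partial>M)) (at x)"
      using near
    proof eventually_elim
      case (elim x')
      have "((\<integral>y. f x' y \<partial>M) - (\<integral>y. f x y \<partial>M)) - (\<integral>y. f' y \<partial>M) \<bullet> (x' - x)
          = (\<integral>y. (f x' y - f x y) - f' y \<bullet> (x' - x) \<partial>M)"
        using int[OF elim] fx int' by simp
      also have "norm \<dots> \<le> (\<integral>y. norm ((f x' y - f x y) - f' y \<bullet> (x' - x)) \<partial>M)"
        by (rule integral_norm_bound)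
      finally have "norm (((\<integral>y. f x' y \<partial>M) - (\<integral>y. f x y \<partial>M)) - (\<integral>y. f' y \<partial>M) \<bullet> (x' - x)) / norm (x' - x)
          \<le> (\<integral>y. norm ((f x' y - f x y) - f' y \<bullet> (x' - x)) \<partial>M) / norm (x' - x)"
        by (intro divide_right_mono) auto
      then show ?case by (simp add: F_def)
    qed
  qed
  then show "((\<lambda>x'. \<integral>y. f x' y \<partial>M) has_derivative (\<lambda>v. (\<integral>y. f' y \<partial>M) \<bullet> v)) (at x)"
    unfolding has_derivative_iff_norm by (auto intro: bounded_linear_inner_right)
qed

lemma gradient_bound_imp_lipschitz:
  fixes f :: "'a::real_inner \<Rightarrow> real"
  assumes "convex S" "\<And>x. x \<in> S \<Longrightarrow> (f has_derivative (\<lambda>v. d x \<bullet> v)) (at x within S)"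
    "\<And>x. x \<in> S \<Longrightarrow> norm (d x) \<le> B" "x \<in> S" "y \<in> S"
  shows "\<bar>f x - f y\<bar> \<le> B * norm (x - y)"
proof -
  have "onorm (\<lambda>v. d x \<bullet> v) \<le> B" if "x \<in> S" for x
    using order_trans[OF norm_ge_zero assms(3)[OF that]]
      order_trans[OF norm_cauchy_schwarz mult_right_mono[OF assms(3)[OF that] norm_ge_zero]]
      Cauchy_Schwarz_ineq2[of "d x"] mult_right_mono[OF assms(3)[OF that] norm_ge_zero]
    by (intro onorm_bound) (auto intro: order_trans)
  from differentiable_bound[OF assms(1,2) this assms(4,5)]
  show ?thesis by simp
qed

lemma borel_measurable_of_has_derivative:
  fixes f :: "'a::euclidean_space \<Rightarrow> real"
  assumes "\<And>x. (f has_derivative f' x) (at x)"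
  shows "f \<in> borel_measurable borel"
  using assms by (intro borel_measurable_continuous_onI)
    (meson has_derivative_continuous continuous_at_imp_continuous_on)

text \<open>Each component is a pointwise limit of difference quotients of a continuous function, so
  measurability follows from differentiability alone.\<close>

lemma borel_measurable_gradient:
  fixes f :: "'a::euclidean_space \<Rightarrow> real"
  assumes der: "\<And>x. (f has_derivative (\<lambda>v. d x \<bullet> v)) (at x)"
  shows "d \<in> borel_measurable borel"
proof (rule borel_measurable_euclidean_space[THEN iffD2], intro ballI)
  fix i :: 'a assume "i \<in> Basis"
  have [measurable]: "f \<in> borel_measurable borel" using der by (rule borel_measurable_of_has_derivative)
  define Q where "Q n x = (f (x + (1 / real (Suc n)) *\<^sub>R i) - f x) / (1 / real (Suc n))" for n x
  have Q [measurable]: "Q n \<in> borel_measurable borel" for n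
    unfolding Q_def by measurable
  have lim: "(\<lambda>n. Q n x) \<longlonglongrightarrow> d x \<bullet> i" for x
  proof -
    have "((\<lambda>t. f (x + t *\<^sub>R i)) has_derivative (\<lambda>t. d x \<bullet> (t *\<^sub>R i))) (at 0)"
      using der[of x] by (intro has_derivative_compose[of "\<lambda>t. x + t *\<^sub>R i" "\<lambda>t. t *\<^sub>R i" 0 UNIV f])
        (auto intro!: derivative_eq_intros)
    then have "((\<lambda>t. f (x + t *\<^sub>R i)) has_real_derivative d x \<bullet> i) (at 0)"
      by (simp add: has_field_derivative_def mult.commute[of _ "d x \<bullet> i"] mult_commute_abs)
    then have "((\<lambda>t. (f (x + t *\<^sub>R i) - f x) / t) \<longlongrightarrow> d x \<bullet> i) (at 0)"
      by (simp add: has_field_derivative_iff)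
    moreover have "filterlim (\<lambda>n. 1 / real (Suc n)) (at 0) sequentially"
      using LIMSEQ_inverse_real_of_nat by (auto simp: filterlim_at inverse_eq_divide)
    ultimately show ?thesis unfolding Q_def by (rule filterlim_compose)
  qed
  show "(\<lambda>x. d x \<bullet> i) \<in> borel_measurable borel"
    by (rule borel_measurable_LIMSEQ_real[OF lim]) (rule Q)
qed

text \<open>The density of \<open>sqrt (2 s) z\<close> for standard Gaussian \<open>z\<close>, that
  is, the heat kernel of the Laplacian at time \<open>s\<close>.\<close>

definition kern :: "real \<Rightarrow> 'a::euclidean_space \<Rightarrow> real" where
  "kern s w = gauss (w /\<^sub>R sqrt (2 * s)) / sqrt (2 * s) ^ DIM('a)"

lemma kern_eq:
  fixes w :: "'a::euclidean_space"
  assumes "0 < s"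
  shows "kern s w = kern s (0::'a) * exp (- (norm w)\<^sup>2 / (4 * s))"
  using assms by (simp add: kern_def gauss_def power_divide power_mult_distrib field_simps)

lemma kern_pos: "0 < s \<Longrightarrow> 0 < kern s w"
  by (simp add: kern_def gauss_pos)

lemma kern_le:
  fixes w :: "'a::euclidean_space"
  assumes "0 < s"
  shows "kern s w \<le> kern s (0::'a)"
  using kern_pos[OF assms, of "0::'a"] assms by (subst kern_eq[OF assms]) (auto simp: mult_le_cancel_left1)

lemma kern_has_derivative:
  fixes w :: "'a::euclidean_space"
  assumes "0 < s"
  shows "(kern s has_derivative (\<lambda>v. (- (kern s w / (2 * s)) *\<^sub>R w) \<bullet> v)) (at w)"
proof -
  have "((\<lambda>w. - (w \<bullet> w) / (4 * s)) has_derivative (\<lambda>v. - (1 / (2 * s)) * (w \<bullet> v))) (at w)"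
    using assms by (auto intro!: derivative_eq_intros simp: field_simps inner_commute)
  from bounded_linear.has_derivative[OF bounded_linear_mult_right has_derivative_exp[OF this], of "kern s (0::'a)"]
  have "((\<lambda>w. kern s (0::'a) * exp (- (w \<bullet> w) / (4 * s))) has_derivative
      (\<lambda>v. kern s (0::'a) * ((- (1 / (2 * s)) * (w \<bullet> v)) * exp (- (w \<bullet> w) / (4 * s))))) (at w)" .
  moreover have "(kern s :: 'a \<Rightarrow> real) = (\<lambda>w. kern s (0::'a) * exp (- (w \<bullet> w) / (4 * s)))"
    by (rule ext) (subst kern_eq[OF assms], simp add: power2_norm_eq_inner del: minus_divide_left)
  ultimately have "(kern s has_derivative
      (\<lambda>v. kern s (0::'a) * ((- (1 / (2 * s)) * (w \<bullet> v)) * exp (- (w \<bullet> w) / (4 * s))))) (at w)"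
    by simp
  then show ?thesis
    by (rule has_derivative_eq_rhs)
       (subst kern_eq[OF assms, of w], simp add: fun_eq_iff power2_norm_eq_inner)
qed

lemma borel_measurable_kern [measurable]: "kern s \<in> borel_measurable borel"
  unfolding kern_def by measurable

lemma nn_integral_std_gaussian_affine:
  fixes m :: "'a::euclidean_space"
  assumes [measurable]: "F \<in> borel_measurable borel" and "0 < s"
  shows "(\<integral>\<^sup>+z. F (m + sqrt (2 * s) *\<^sub>R z) \<partial>std_gaussian) = (\<integral>\<^sup>+x. ennreal (kern s (x - m)) * F x \<partial>lborel)"
proof -
  define c where "c = sqrt (2 * s)"
  have c: "c > 0" using assms by (simp add: c_def)
  have "(\<integral>\<^sup>+x. ennreal (kern s (x - m)) * F x \<partial>lborel)
     = ennreal (\<bar>c\<bar> ^ DIM('a)) * (\<integral>\<^sup>+z. ennreal (kern s ((m + c *\<^sub>R z) - m)) * F (m + c *\<^sub>R z) \<partial>lborel)"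
    using c by (intro nn_integral_lborel_affine) auto
  also have "\<dots> = (\<integral>\<^sup>+z. ennreal (\<bar>c\<bar> ^ DIM('a)) * (ennreal (kern s ((m + c *\<^sub>R z) - m)) * F (m + c *\<^sub>R z)) \<partial>lborel)"
    by (rule nn_integral_cmult[symmetric]) measurable
  also have "\<dots> = (\<integral>\<^sup>+z. ennreal (gauss z) * F (m + c *\<^sub>R z) \<partial>lborel)"
    using c by (intro nn_integral_cong)
      (simp add: kern_def c_def[symmetric] mult.assoc[symmetric] ennreal_mult'[symmetric])
  also have "\<dots> = (\<integral>\<^sup>+z. F (m + c *\<^sub>R z) \<partial>std_gaussian)"
    unfolding std_gaussian_def by (subst nn_integral_density) auto
  finally show ?thesis by (simp add: c_def)
qed

section \<open>Densities of one Euler step\<close>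

text \<open>The induction invariant along the chain. Linear growth of the score gives quadratic
  growth of \<open>ln p\<close>; the last clause provides the Gaussian moment against which
  exponentials of small multiples of quadratics are integrated.\<close>

definition regular_density :: "('a::euclidean_space \<Rightarrow> real) \<Rightarrow> bool" where
  "regular_density p \<longleftrightarrow> (\<forall>x. 0 < p x) \<and> prob_space (density lborel p) \<and>
     (\<exists>d C. \<forall>x. ((\<lambda>x. ln (p x)) has_derivative (\<lambda>v. d x \<bullet> v)) (at x) \<and> norm (d x) \<le> C * (1 + norm x)) \<and>
     (\<exists>c>0. integrable lborel (\<lambda>x. p x * exp (c * (norm x)\<^sup>2)))"

text \<open>Here the law \<open>P\<close> of the old position is arbitrary up to its moment: at
  positive times the Gaussian kernel supplies all smoothness in the new position. A density of
  \<open>P\<close> is added in \<open>euler_density\<close>, for the analysis at time zero.\<close>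

locale euler_step =
  fixes P :: "'a::euclidean_space measure" and H :: "'a \<Rightarrow> 'a" and K c :: real
  assumes prob_P: "prob_space P"
    and sets_P [measurable_cong, simp]: "sets P = sets borel"
    and H_cont: "continuous_on UNIV H"
    and H_growth: "\<And>y. norm (H y) \<le> K * (1 + norm y)"
    and c_pos: "0 < c"
    and exp_moment: "integrable P (\<lambda>y. exp (c * (norm y)\<^sup>2))"
begin

sublocale P: prob_space P by (rule prob_P)
sublocale G: prob_space "std_gaussian :: 'a measure" by (rule prob_space_std_gaussian)
sublocale PG: pair_prob_space P "std_gaussian :: 'a measure" ..
sublocale PL: pair_sigma_finite P "lborel :: 'a measure" ..

abbreviation Q :: "('a \<times> 'a) measure" where
  "Q \<equiv> P \<Otimes>\<^sub>M std_gaussian"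

definition euler :: "real \<Rightarrow> 'a \<times> 'a \<Rightarrow> 'a" where
  "euler s p = fst p - s *\<^sub>R H (fst p) + sqrt (2 * s) *\<^sub>R snd p"

text \<open>The noise \<open>sqrt (2 s) z\<close> that a step from \<open>y\<close> to
  \<open>x\<close> must have used, so that \<open>kern s (offset s x y)\<close> is the transition
  density.\<close>

definition offset :: "real \<Rightarrow> 'a \<Rightarrow> 'a \<Rightarrow> 'a" where
  "offset s x y = x - y + s *\<^sub>R H y"

definition dens :: "real \<Rightarrow> 'a \<Rightarrow> real" where
  "dens s x = (\<integral>y. kern s (offset s x y) \<partial>P)"

definition grad_dens :: "real \<Rightarrow> 'a \<Rightarrow> 'a" where
  "grad_dens s x = (\<integral>y. - (kern s (offset s x y) / (2 * s)) *\<^sub>R offset s x y \<partial>P)"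

section \<open>Integrability under the joint law of old position and noise\<close>

lemma space_P [simp]: "space P = UNIV"
  using sets_eq_imp_space_eq[OF sets_P] by simp

lemma K_nonneg: "0 \<le> K"
  using order_trans[OF norm_ge_zero H_growth[of 0]] by simp

lemma H_measurable [measurable]: "H \<in> borel_measurable borel"
  using H_cont by (rule borel_measurable_continuous_onI)

lemma sets_Q: "sets Q = sets (borel \<Otimes>\<^sub>M borel)"
  by (rule sets_pair_measure_cong) auto

lemma euler_measurable [measurable]: "euler s \<in> borel_measurable Q"
  unfolding euler_def by measurable

lemma offset_measurable [measurable]:
  "(\<lambda>p. offset s (snd p) (fst p)) \<in> borel_measurable (P \<Otimes>\<^sub>M lborel)"
  "(\<lambda>p. offset s (fst p) (snd p)) \<in> borel_measurable (lborel \<Otimes>\<^sub>M P)"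
  "offset s x \<in> borel_measurable borel"
  unfolding offset_def by measurable

text \<open>\<open>Q\<close> is a product measure, so by Fubini the exponential moments of old
  position and noise multiply. Polynomial bounds under \<open>Q\<close> are reduced to this
  majorant.\<close>

lemma integrable_Q_exp:
  fixes F :: "'a \<times> 'a \<Rightarrow> real"
  assumes [measurable]: "F \<in> borel_measurable Q"
    and bound: "\<And>y z. \<bar>F (y, z)\<bar> \<le> C * (exp (c * (norm y)\<^sup>2) * exp ((norm z)\<^sup>2 / 4))"
  shows "integrable Q F"
proof (rule Bochner_Integration.integrable_bound)
  show "integrable Q (\<lambda>p. C * (exp (c * (norm (fst p))\<^sup>2) * exp ((norm (snd p))\<^sup>2 / 4)))"
  proof (intro integrable_mult_right PG.Fubini_integrable)
    show "integrable P (\<lambda>x. \<integral>y. norm (exp (c * (norm (fst (x, y)))\<^sup>2) * exp ((norm (snd (x, y)))\<^sup>2 / 4)) \<partial>std_gaussian)"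
      using exp_moment by simp
    show "AE x in P. integrable std_gaussian (\<lambda>y. exp (c * (norm (fst (x, y)))\<^sup>2) * exp ((norm (snd (x, y)))\<^sup>2 / 4))"
      using integrable_std_gaussian_exp by auto
  qed measurable
  show "AE p in Q. norm (F p) \<le> norm (C * (exp (c * (norm (fst p))\<^sup>2) * exp ((norm (snd p))\<^sup>2 / 4)))"
    using order_trans[OF bound abs_ge_self] by (auto split: prod.splits)
qed measurable

lemma integrable_Q_poly:
  fixes F :: "'a \<times> 'a \<Rightarrow> real"
  assumes [measurable]: "F \<in> borel_measurable Q"
    and bound: "\<And>y z. \<bar>F (y, z)\<bar> \<le> C * (1 + norm y + norm z) ^ m"
  shows "integrable Q F"
proof -
  obtain C1 where C1: "C1 > 0" "\<And>r::real. r\<ge>0 \<Longrightarrow> (1 + r) ^ m \<le> C1 * exp (c * r\<^sup>2)"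
    using power_le_exp_norm2[OF c_pos, of m] by auto
  obtain C2 where C2: "C2 > 0" "\<And>r::real. r\<ge>0 \<Longrightarrow> (1 + r) ^ m \<le> C2 * exp (r\<^sup>2 / 4)"
    using power_le_exp_norm2[of "1/4" m] by auto
  have "0 \<le> C" using order_trans[OF abs_ge_zero bound[of 0 0]] by simp
  show ?thesis
  proof (rule integrable_Q_exp)
    fix y z :: 'a
    have "(1 + norm y + norm z) ^ m \<le> ((1 + norm y) * (1 + norm z)) ^ m"
      by (intro power_mono) (auto simp: algebra_simps)
    also have "\<dots> \<le> (C1 * exp (c * (norm y)\<^sup>2)) * (C2 * exp ((norm z)\<^sup>2 / 4))"
      unfolding power_mult_distrib using C1(1) by (intro mult_mono C1(2) C2(2)) auto
    finally have "C * (1 + norm y + norm z) ^ m \<le> C * ((C1 * exp (c * (norm y)\<^sup>2)) * (C2 * exp ((norm z)\<^sup>2 / 4)))"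
      using \<open>0 \<le> C\<close> by (rule mult_left_mono)
    then show "\<bar>F (y, z)\<bar> \<le> (C * C1 * C2) * (exp (c * (norm y)\<^sup>2) * exp ((norm z)\<^sup>2 / 4))"
      using bound[of y z] by (simp add: algebra_simps)
  qed fact
qed

lemma integrable_P_poly:
  fixes F :: "'a \<Rightarrow> real"
  assumes [measurable]: "F \<in> borel_measurable borel"
    and bound: "\<And>y. \<bar>F y\<bar> \<le> C * (1 + norm y) ^ m"
  shows "integrable P F"
proof -
  obtain C1 where C1: "C1 > 0" "\<And>r::real. r\<ge>0 \<Longrightarrow> (1 + r) ^ m \<le> C1 * exp (c * r\<^sup>2)"
    using power_le_exp_norm2[OF c_pos, of m] by auto
  have "0 \<le> C" using order_trans[OF abs_ge_zero bound[of 0]] by simp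
  have "\<bar>F y\<bar> \<le> C * (C1 * exp (c * (norm y)\<^sup>2))" for y
    using order_trans[OF bound mult_left_mono[OF C1(2) \<open>0 \<le> C\<close>]] by simp
  then have le: "AE y in P. norm (F y) \<le> norm (C * (C1 * exp (c * (norm y)\<^sup>2)))"
    by (intro AE_I2) (simp add: order_trans[OF _ abs_ge_self])
  have "integrable P (\<lambda>y. C * (C1 * exp (c * (norm y)\<^sup>2)))"
    using exp_moment by (intro integrable_mult_right)
  from Bochner_Integration.integrable_bound[OF this _ le] show ?thesis by simp
qed

text \<open>For each fixed \<open>y\<close> this is the substitution
  \<open>x = y - s H y + sqrt (2 s) z\<close>. It trades the noise for the new position and so
  yields the joint density of old and new position with respect to \<open>P\<close> times Lebesgue
  measure.\<close>

lemma nn_integral_euler: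
  assumes F [measurable]: "F \<in> borel_measurable (borel \<Otimes>\<^sub>M borel)" and s: "0 < s"
  shows "(\<integral>\<^sup>+p. F (fst p, euler s p) \<partial>Q) = (\<integral>\<^sup>+p. ennreal (kern s (offset s (snd p) (fst p))) * F p \<partial>(P \<Otimes>\<^sub>M lborel))"
proof -
  have "sets (P \<Otimes>\<^sub>M lborel) = sets (borel \<Otimes>\<^sub>M (borel :: 'a measure))"
    by (rule sets_pair_measure_cong) auto
  then have [measurable]: "F \<in> borel_measurable (P \<Otimes>\<^sub>M lborel)"
    using F by (simp cong: measurable_cong_sets)
  have "(\<integral>\<^sup>+p. F (fst p, euler s p) \<partial>Q) = (\<integral>\<^sup>+y. \<integral>\<^sup>+z. F (y, euler s (y, z)) \<partial>std_gaussian \<partial>P)"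
    by (subst G.nn_integral_fst[symmetric]) auto
  also have "\<dots> = (\<integral>\<^sup>+y. \<integral>\<^sup>+x. ennreal (kern s (x - (y - s *\<^sub>R H y))) * F (y, x) \<partial>lborel \<partial>P)"
    using nn_integral_std_gaussian_affine[OF _ s, of "\<lambda>x. F (y, x)" "y - s *\<^sub>R H y" for y]
    by (simp add: euler_def)
  also have "\<dots> = (\<integral>\<^sup>+p. ennreal (kern s (offset s (snd p) (fst p))) * F p \<partial>(P \<Otimes>\<^sub>M lborel))"
    by (subst lborel.nn_integral_fst[symmetric]) (auto simp: offset_def diff_diff_eq2 diff_add_eq)
  finally show ?thesis .
qed

text \<open>An identity of measures, so that the rules for image measures and densities give
  \<open>integral_euler\<close> for signed functions.\<close>

lemma distr_euler_joint:
  assumes s: "0 < s"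
  shows "distr Q (P \<Otimes>\<^sub>M lborel) (\<lambda>p. (fst p, euler s p))
     = density (P \<Otimes>\<^sub>M lborel) (\<lambda>p. ennreal (kern s (offset s (snd p) (fst p))))"
proof (rule measure_eqI)
  fix A assume "A \<in> sets (distr Q (P \<Otimes>\<^sub>M lborel) (\<lambda>p. (fst p, euler s p)))"
  then have A [measurable]: "A \<in> sets (P \<Otimes>\<^sub>M lborel)" by simp
  have "sets (P \<Otimes>\<^sub>M lborel) = sets (borel \<Otimes>\<^sub>M (borel :: 'a measure))"
    by (rule sets_pair_measure_cong) auto
  then have A' [measurable]: "A \<in> sets (borel \<Otimes>\<^sub>M borel)" using A by simp
  have "emeasure (distr Q (P \<Otimes>\<^sub>M lborel) (\<lambda>p. (fst p, euler s p))) A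
      = (\<integral>\<^sup>+p. indicator A p \<partial>distr Q (P \<Otimes>\<^sub>M lborel) (\<lambda>p. (fst p, euler s p)))"
    by simp
  also have "\<dots> = (\<integral>\<^sup>+p. indicator A (fst p, euler s p) \<partial>Q)"
    by (rule nn_integral_distr) measurable
  also have "\<dots> = (\<integral>\<^sup>+p. ennreal (kern s (offset s (snd p) (fst p))) * indicator A p \<partial>(P \<Otimes>\<^sub>M lborel))"
    by (rule nn_integral_euler[OF _ s]) measurable
  also have "\<dots> = emeasure (density (P \<Otimes>\<^sub>M lborel) (\<lambda>p. ennreal (kern s (offset s (snd p) (fst p))))) A"
    by (subst emeasure_density) auto
  finally show "emeasure (distr Q (P \<Otimes>\<^sub>M lborel) (\<lambda>p. (fst p, euler s p))) A
     = emeasure (density (P \<Otimes>\<^sub>M lborel) (\<lambda>p. ennreal (kern s (offset s (snd p) (fst p))))) A" .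
qed simp

lemma integral_euler:
  fixes F :: "'a \<times> 'a \<Rightarrow> real"
  assumes F [measurable]: "F \<in> borel_measurable (P \<Otimes>\<^sub>M lborel)" and s: "0 < s"
  shows "(\<integral>p. F (fst p, euler s p) \<partial>Q) = (\<integral>p. kern s (offset s (snd p) (fst p)) * F p \<partial>(P \<Otimes>\<^sub>M lborel))"
    and "integrable Q (\<lambda>p. F (fst p, euler s p)) \<longleftrightarrow>
      integrable (P \<Otimes>\<^sub>M lborel) (\<lambda>p. kern s (offset s (snd p) (fst p)) * F p)"
proof -
  have [measurable]: "(\<lambda>p. (fst p, euler s p)) \<in> measurable Q (P \<Otimes>\<^sub>M lborel)"
    by measurable
  have "(\<integral>p. F (fst p, euler s p) \<partial>Q) = (\<integral>p. F p \<partial>distr Q (P \<Otimes>\<^sub>M lborel) (\<lambda>p. (fst p, euler s p)))"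
    by (rule integral_distr[symmetric]) measurable
  also have "\<dots> = (\<integral>p. kern s (offset s (snd p) (fst p)) * F p \<partial>(P \<Otimes>\<^sub>M lborel))"
    unfolding distr_euler_joint[OF s] using kern_pos[OF s] by (subst integral_density) (auto intro: less_imp_le)
  finally show "(\<integral>p. F (fst p, euler s p) \<partial>Q) = (\<integral>p. kern s (offset s (snd p) (fst p)) * F p \<partial>(P \<Otimes>\<^sub>M lborel))" .
  have "integrable Q (\<lambda>p. F (fst p, euler s p)) \<longleftrightarrow> integrable (distr Q (P \<Otimes>\<^sub>M lborel) (\<lambda>p. (fst p, euler s p))) F"
    by (rule integrable_distr_eq[symmetric]) measurable
  also have "\<dots> \<longleftrightarrow> integrable (P \<Otimes>\<^sub>M lborel) (\<lambda>p. kern s (offset s (snd p) (fst p)) * F p)"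
    unfolding distr_euler_joint[OF s] using kern_pos[OF s] by (subst integrable_density) (auto intro: less_imp_le)
  finally show "integrable Q (\<lambda>p. F (fst p, euler s p)) \<longleftrightarrow>
      integrable (P \<Otimes>\<^sub>M lborel) (\<lambda>p. kern s (offset s (snd p) (fst p)) * F p)" .
qed

section \<open>The density of the new position, its positivity and its score\<close>

lemma integrable_kern: "0 < s \<Longrightarrow> integrable P (\<lambda>y. kern s (offset s x y))"
  by (rule P.integrable_const_bound[where B="kern s (0::'a)"])
     (auto intro: kern_le simp: abs_of_pos[OF kern_pos])

lemma dens_measurable [measurable]: "dens s \<in> borel_measurable borel"
proof -
  have "(\<lambda>x. \<integral>y. kern s (offset s x y) \<partial>P) \<in> borel_measurable lborel"
    by (rule P.borel_measurable_lebesgue_integral) measurable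
  then show ?thesis by (simp add: dens_def[abs_def])
qed

lemma distr_euler:
  assumes s: "0 < s"
  shows "distr Q borel (euler s) = density lborel (dens s)"
proof (rule measure_eqI)
  fix A :: "'a set" assume "A \<in> sets (distr Q borel (euler s))"
  then have A [measurable]: "A \<in> sets borel" by simp
  have "emeasure (distr Q borel (euler s)) A = (\<integral>\<^sup>+p. indicator A p \<partial>distr Q borel (euler s))"
    by simp
  also have "\<dots> = (\<integral>\<^sup>+p. indicator A (snd (fst p, euler s p)) \<partial>Q)"
    by (subst nn_integral_distr) auto
  also have "\<dots> = (\<integral>\<^sup>+p. ennreal (kern s (offset s (snd p) (fst p))) * indicator A (snd p) \<partial>(P \<Otimes>\<^sub>M lborel))"
    by (rule nn_integral_euler[OF _ s]) measurable
  also have "\<dots> = (\<integral>\<^sup>+x. \<integral>\<^sup>+y. ennreal (kern s (offset s x y)) * indicator A x \<partial>P \<partial>lborel)"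
    by (subst PL.nn_integral_snd[symmetric]) auto
  also have "\<dots> = (\<integral>\<^sup>+x. ennreal (dens s x) * indicator A x \<partial>lborel)"
  proof (rule nn_integral_cong)
    fix x :: 'a
    have "(\<integral>\<^sup>+y. ennreal (kern s (offset s x y)) \<partial>P) = ennreal (dens s x)"
      unfolding dens_def using kern_pos[OF s] integrable_kern[OF s]
      by (intro nn_integral_eq_integral) (auto intro: less_imp_le)
    then show "(\<integral>\<^sup>+y. ennreal (kern s (offset s x y)) * indicator A x \<partial>P) = ennreal (dens s x) * indicator A x"
      by (subst nn_integral_multc) auto
  qed
  also have "\<dots> = emeasure (density lborel (dens s)) A"
    by (subst emeasure_density) auto
  finally show "emeasure (distr Q borel (euler s)) A = emeasure (density lborel (dens s)) A" .
qed simp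

lemma prob_space_dens: "0 < s \<Longrightarrow> prob_space (density lborel (dens s))"
  using PG.P.prob_space_distr[of "euler s" borel] by (simp add: distr_euler)

text \<open>The product form separates the variables: \<open>y\<close> can be integrated out against
  its moments while the dependence on \<open>x\<close> stays linear.\<close>

lemma norm_offset_le:
  assumes "0 \<le> s"
  shows "norm (offset s x y) \<le> (1 + norm x) * ((1 + s * K) * (1 + norm y))"
proof -
  have "norm (offset s x y) \<le> norm x + norm y + s * norm (H y)"
    unfolding offset_def using assms norm_triangle_ineq[of "x - y" "s *\<^sub>R H y"] norm_triangle_ineq4[of x y] by simp
  also have "\<dots> \<le> norm x + norm y + s * (K * (1 + norm y))"
    using assms H_growth by (intro add_left_mono mult_left_mono) auto
  also have "\<dots> \<le> norm x + (1 + s * K) * (1 + norm y)" by (simp add: algebra_simps)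
  also have "\<dots> \<le> norm x * ((1 + s * K) * (1 + norm y)) + (1 + s * K) * (1 + norm y)"
    using assms K_nonneg by (intro add_right_mono mult_right_mono[of 1 _ "norm x", simplified mult_1 mult.commute[of _ "norm x"]]) 
       (auto simp: algebra_simps)
  finally show ?thesis by (simp add: algebra_simps)
qed

lemma integrable_offset2:
  assumes "0 \<le> s"
  shows "integrable P (\<lambda>y. (norm (offset s x y))\<^sup>2)"
proof (rule integrable_P_poly[where m=2 and C="((1 + norm x) * (1 + s * K))\<^sup>2"])
  fix y
  have "(norm (offset s x y))\<^sup>2 \<le> ((1 + norm x) * ((1 + s * K) * (1 + norm y)))\<^sup>2"
    using norm_offset_le[OF assms] by (intro power_mono) auto
  then show "\<bar>(norm (offset s x y))\<^sup>2\<bar> \<le> ((1 + norm x) * (1 + s * K))\<^sup>2 * (1 + norm y)\<^sup>2"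
    by (simp add: power_mult_distrib)
qed measurable

text \<open>Jensen's inequality for \<open>exp\<close>, via its tangent line at the mean.\<close>

lemma dens_ge:
  assumes s: "0 < s"
  shows "kern s (0::'a) * exp (- (\<integral>y. (norm (offset s x y))\<^sup>2 \<partial>P) / (4 * s)) \<le> dens s x"
proof -
  define E where "E = (\<integral>y. (norm (offset s x y))\<^sup>2 \<partial>P) / (4 * s)"
  have k0: "kern s (0::'a) > 0" using s by (rule kern_pos)
  have "kern s (0::'a) * exp (- E) = (\<integral>y. kern s (0::'a) * exp (- E) * (1 + E - (norm (offset s x y))\<^sup>2 / (4 * s)) \<partial>P)"
    using integrable_offset2[of s x] s P.prob_space by (simp add: E_def)
  also have "\<dots> \<le> (\<integral>y. kern s (offset s x y) \<partial>P)"
  proof (rule integral_mono)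
    fix y
    let ?X = "(norm (offset s x y))\<^sup>2 / (4 * s)"
    have "exp (- E) * (1 + (E - ?X)) \<le> exp (- E) * exp (E - ?X)"
      by (intro mult_left_mono exp_ge_add_one_self) auto
    also have "\<dots> = exp (- ?X)" by (simp add: exp_add[symmetric])
    finally have "kern s (0::'a) * (exp (- E) * (1 + (E - ?X))) \<le> kern s (0::'a) * exp (- ?X)"
      using k0 by simp
    then show "kern s (0::'a) * exp (- E) * (1 + E - ?X) \<le> kern s (offset s x y)"
      by (subst (2) kern_eq[OF s]) (simp add: algebra_simps)
  qed (use integrable_offset2[of s x] s integrable_kern[OF s] in auto)
  finally show ?thesis by (simp add: E_def dens_def)
qed

lemma dens_pos: "0 < s \<Longrightarrow> 0 < dens s x"
  using less_le_trans[OF _ dens_ge[of s x]] kern_pos[of s "0::'a"] by simp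

lemma le_exp_square: "v \<le> exp (v\<^sup>2)" for v :: real
proof -
  have "2 * v \<le> v\<^sup>2 + 1" using sum_squares_bound[of v 1] by simp
  moreover have "0 \<le> v\<^sup>2" by simp
  ultimately have "v \<le> 1 + v\<^sup>2" by linarith
  also have "\<dots> \<le> exp (v\<^sup>2)" by (rule exp_ge_add_one_self)
  finally show ?thesis .
qed

text \<open>With \<open>v = |w| / sqrt (4 s)\<close> this is \<open>v exp (- v^2) \<le> 1\<close>.
  It makes the gradient of the kernel bounded, hence the kernel globally Lipschitz.\<close>

lemma norm_mult_kern_le:
  fixes w :: 'a
  assumes s: "0 < s"
  shows "kern s w * norm w \<le> kern s (0::'a) * sqrt (4 * s)"
proof -
  have "norm w / sqrt (4 * s) \<le> exp ((norm w / sqrt (4 * s))\<^sup>2)" by (rule le_exp_square)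
  also have "(norm w / sqrt (4 * s))\<^sup>2 = (norm w)\<^sup>2 / (4 * s)"
    using s by (simp add: power_divide)
  finally have "norm w \<le> exp ((norm w)\<^sup>2 / (4 * s)) * sqrt (4 * s)"
    using s by (simp add: pos_divide_le_eq)
  then have "kern s w * norm w \<le> kern s w * (exp ((norm w)\<^sup>2 / (4 * s)) * sqrt (4 * s))"
    using kern_pos[OF s, of w] by (intro mult_left_mono) auto
  also have "\<dots> = kern s (0::'a) * sqrt (4 * s)"
    by (subst kern_eq[OF s]) (simp add: exp_minus)
  finally show ?thesis .
qed

text \<open>The kernel has a bounded gradient, and for a probability measure the constant
  \<open>B\<close> is an admissible majorant for differentiation under the integral.\<close>

lemma dens_has_derivative:
  assumes s: "0 < s"
  shows "(dens s has_derivative (\<lambda>v. grad_dens s x \<bullet> v)) (at x)"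
    and "integrable P (\<lambda>y. - (kern s (offset s x y) / (2 * s)) *\<^sub>R offset s x y)"
proof -
  define B where "B = kern s (0::'a) * sqrt (4 * s) / (2 * s)"
  have B: "norm (- (kern s w / (2 * s)) *\<^sub>R w) \<le> B" for w :: 'a
    using divide_right_mono[OF norm_mult_kern_le[OF s, of w], of "2 * s"] s kern_pos[OF s, of w]
    by (simp add: B_def)
  have lip: "\<bar>kern s w - kern s w'\<bar> \<le> B * norm (w - w')" for w w' :: 'a
    by (rule gradient_bound_imp_lipschitz[OF convex_UNIV kern_has_derivative[OF s] B]) auto
  have der: "((\<lambda>x'. kern s (offset s x' y)) has_derivative
      (\<lambda>v. (- (kern s (offset s x y) / (2 * s)) *\<^sub>R offset s x y) \<bullet> v)) (at x)" for y
  proof -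
    have "((\<lambda>x'. offset s x' y) has_derivative (\<lambda>v. v)) (at x)"
      unfolding offset_def by (auto intro!: derivative_eq_intros)
    from has_derivative_compose[OF this kern_has_derivative[OF s]] show ?thesis by simp
  qed
  have le: "\<bar>kern s (offset s x' y) - kern s (offset s x y)\<bar> \<le> B * norm (x' - x)" for x' y
    using lip[of "offset s x' y" "offset s x y"] by (simp add: offset_def)
  show "(dens s has_derivative (\<lambda>v. grad_dens s x \<bullet> v)) (at x)"
    unfolding dens_def[abs_def] grad_dens_def
    by (rule has_derivative_integral_dominated(2)[where \<delta>=1 and g="\<lambda>_. B"])
       (use der le B integrable_kern[OF s] in auto)
  show "integrable P (\<lambda>y. - (kern s (offset s x y) / (2 * s)) *\<^sub>R offset s x y)"
    by (rule has_derivative_integral_dominated(1)[where f="\<lambda>x y. kern s (offset s x y)" and \<delta>=1 and g="\<lambda>_. B" and x=x])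
       (use der le B integrable_kern[OF s] in auto)
qed

text \<open>The score is a posterior mean of \<open>offset\<close>. Where \<open>|offset|\<close> exceeds a multiple of \<open>1 + |x|\<close>, half of
  the Gaussian exponent already beats the lower bound on \<open>dens\<close>, so the mean grows linearly.\<close>

lemma grad_dens_bound:
  assumes s: "0 < s"
  shows "\<exists>C. \<forall>x. norm (grad_dens s x) \<le> C * (1 + norm x) * dens s x"
proof -
  define m2 where "m2 = (\<integral>y. (1 + norm y)\<^sup>2 \<partial>P)"
  have int2: "integrable P (\<lambda>y. (1 + norm y)\<^sup>2)"
    by (rule integrable_P_poly[where m=2 and C=1]) auto
  \<comment> \<open>The fraction is the factor of \<open>(1 + |x|)^2\<close> in the exponent of
    \<open>dens_ge\<close>. The summand \<open>1\<close> gives \<open>a \<le> a^2\<close>, so the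
    exponent is at most the square of \<open>a (1 + |x|)\<close>.\<close>
  define a where "a = 1 + (1 + s * K)\<^sup>2 * m2 / (4 * s)"
  have m2: "0 \<le> m2" unfolding m2_def by simp
  have a: "a \<ge> 1" "(1 + s * K)\<^sup>2 * m2 / (4 * s) \<le> a" using m2 s by (auto simp: a_def)
  have bound: "norm (grad_dens s x) \<le> sqrt (8 * s) / (2 * s) * (a + 1) * (1 + norm x) * dens s x" for x
  proof -
    define \<rho> where "\<rho> = a * (1 + norm x)"
    have \<rho>: "\<rho> \<ge> 0" using a by (simp add: \<rho>_def)
    have "(\<integral>y. (norm (offset s x y))\<^sup>2 \<partial>P) \<le> (\<integral>y. ((1 + norm x) * (1 + s * K))\<^sup>2 * (1 + norm y)\<^sup>2 \<partial>P)"
    proof (rule integral_mono)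
      fix y
      have "(norm (offset s x y))\<^sup>2 \<le> ((1 + norm x) * ((1 + s * K) * (1 + norm y)))\<^sup>2"
        using norm_offset_le[of s x y] s by (intro power_mono) auto
      then show "(norm (offset s x y))\<^sup>2 \<le> ((1 + norm x) * (1 + s * K))\<^sup>2 * (1 + norm y)\<^sup>2"
        by (simp add: power_mult_distrib)
    qed (use int2 integrable_offset2[of s x] s in auto)
    also have "\<dots> = (1 + norm x)\<^sup>2 * ((1 + s * K)\<^sup>2 * m2)"
      by (simp add: m2_def power_mult_distrib)
    finally have "(\<integral>y. (norm (offset s x y))\<^sup>2 \<partial>P) / (4 * s) \<le> (1 + norm x)\<^sup>2 * ((1 + s * K)\<^sup>2 * m2) / (4 * s)"
      using s by (intro divide_right_mono) auto
    also have "\<dots> = (1 + norm x)\<^sup>2 * ((1 + s * K)\<^sup>2 * m2 / (4 * s))" by simp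
    also have "\<dots> \<le> (1 + norm x)\<^sup>2 * a" using a by (intro mult_left_mono) auto
    also have "\<dots> \<le> (1 + norm x)\<^sup>2 * a\<^sup>2"
      using a by (intro mult_left_mono) (auto simp: power2_eq_square)
    finally have E: "(\<integral>y. (norm (offset s x y))\<^sup>2 \<partial>P) / (4 * s) \<le> \<rho>\<^sup>2"
      by (simp add: \<rho>_def power_mult_distrib mult.commute)
    have "kern s (0::'a) * exp (- \<rho>\<^sup>2) \<le> kern s (0::'a) * exp (- (\<integral>y. (norm (offset s x y))\<^sup>2 \<partial>P) / (4 * s))"
      using E kern_pos[OF s, of "0::'a"] by (intro mult_left_mono) auto
    also note dens_ge[OF s]
    finally have low: "kern s (0::'a) * exp (- \<rho>\<^sup>2) \<le> dens s x" .
    \<comment> \<open>With \<open>8 s\<close> in place of \<open>4 s\<close> the kernel is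
      proportional to \<open>exp (- v^2) exp (- v^2)\<close>. For \<open>v > \<rho>\<close> one
      factor absorbs the prefactor \<open>v\<close> and the other is at most
      \<open>exp (- \<rho>^2)\<close>, which \<open>low\<close> compares with
      \<open>dens s x\<close>.\<close>
    define v where "v w = norm w / sqrt (8 * s)" for w :: 'a
    have v2: "(v w)\<^sup>2 = (norm w)\<^sup>2 / (8 * s)" for w
      using s by (simp add: v_def power_divide)
    have key: "v w * kern s w \<le> \<rho> * kern s w + kern s (0::'a) * exp (- \<rho>\<^sup>2)" for w
    proof (cases "v w \<le> \<rho>")
      case True
      then have "v w * kern s w \<le> \<rho> * kern s w" using kern_pos[OF s, of w] by simp
      then show ?thesis using kern_pos[OF s, of "0::'a"] by (simp add: add_increasing2)
    next
      case False
      have k: "kern s w = kern s (0::'a) * (exp (- (v w)\<^sup>2) * exp (- (v w)\<^sup>2))"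
        by (subst kern_eq[OF s]) (simp add: v2 exp_add[symmetric] field_simps)
      have "v w * exp (- (v w)\<^sup>2) \<le> 1"
        using le_exp_square[of "v w"] by (simp add: exp_minus field_simps)
      moreover have "exp (- (v w)\<^sup>2) \<le> exp (- \<rho>\<^sup>2)"
        using False \<rho> by (auto intro!: power_mono)
      ultimately have "(v w * exp (- (v w)\<^sup>2)) * exp (- (v w)\<^sup>2) \<le> 1 * exp (- \<rho>\<^sup>2)"
        by (intro mult_mono) auto
      then have "v w * kern s w \<le> kern s (0::'a) * exp (- \<rho>\<^sup>2)"
        unfolding k using kern_pos[OF s, of "0::'a"] by (simp add: mult.assoc mult.left_commute)
      then show ?thesis using \<rho> kern_pos[OF s, of w] by (simp add: add_increasing)
    qed
    have "norm (grad_dens s x) \<le> (\<integral>y. norm (- (kern s (offset s x y) / (2 * s)) *\<^sub>R offset s x y) \<partial>P)"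
      unfolding grad_dens_def by (rule integral_norm_bound)
    also have "\<dots> \<le> (\<integral>y. sqrt (8 * s) / (2 * s) * (\<rho> * kern s (offset s x y) + kern s (0::'a) * exp (- \<rho>\<^sup>2)) \<partial>P)"
    proof (rule integral_mono)
      fix y
      let ?w = "offset s x y"
      have "norm (- (kern s ?w / (2 * s)) *\<^sub>R ?w) = sqrt (8 * s) / (2 * s) * (v ?w * kern s ?w)"
        using s kern_pos[OF s, of ?w] by (simp add: v_def)
      also have "\<dots> \<le> sqrt (8 * s) / (2 * s) * (\<rho> * kern s ?w + kern s (0::'a) * exp (- \<rho>\<^sup>2))"
        using key s by (intro mult_left_mono) auto
      finally show "norm (- (kern s ?w / (2 * s)) *\<^sub>R ?w) \<le> \<dots>" .
    qed (use dens_has_derivative(2)[OF s, of x] integrable_kern[OF s] in \<open>auto simp del: norm_scaleR\<close>)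
    also have "\<dots> = sqrt (8 * s) / (2 * s) * (\<rho> * dens s x + kern s (0::'a) * exp (- \<rho>\<^sup>2))"
      using integrable_kern[OF s] P.prob_space by (simp add: dens_def)
    also have "\<dots> \<le> sqrt (8 * s) / (2 * s) * (\<rho> * dens s x + dens s x)"
      using low s by (intro mult_left_mono add_left_mono) auto
    also have "\<dots> = sqrt (8 * s) / (2 * s) * ((\<rho> + 1) * dens s x)" by (simp add: algebra_simps)
    also have "\<dots> \<le> sqrt (8 * s) / (2 * s) * ((a + 1) * (1 + norm x) * dens s x)"
      using s dens_pos[OF s, of x] by (intro mult_left_mono mult_right_mono) (auto simp: \<rho>_def algebra_simps)
    finally show ?thesis by (simp add: mult.assoc)
  qed
  then show ?thesis by blast
qed

section \<open>Moments of the new position\<close>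

lemma norm_euler_le:
  assumes "0 \<le> s" "s \<le> S"
  shows "norm (euler s (y, z)) \<le> (1 + S * K) * (1 + norm y) + sqrt (2 * S) * norm z"
proof -
  have "norm (euler s (y, z)) \<le> norm y + s * norm (H y) + sqrt (2 * s) * norm z"
    unfolding euler_def using assms norm_triangle_ineq[of "y - s *\<^sub>R H y" "sqrt (2 * s) *\<^sub>R z"]
      norm_triangle_ineq4[of y "s *\<^sub>R H y"] by simp
  also have "\<dots> \<le> norm y + S * (K * (1 + norm y)) + sqrt (2 * S) * norm z"
    using assms H_growth K_nonneg by (intro add_mono mult_mono) auto
  also have "\<dots> \<le> (1 + S * K) * (1 + norm y) + sqrt (2 * S) * norm z"
    by (simp add: algebra_simps)
  finally show ?thesis .
qed

lemma euler_exp_moment: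
  assumes s: "0 \<le> s"
  shows "\<exists>c'>0. integrable Q (\<lambda>p. exp (c' * (norm (euler s p))\<^sup>2))"
proof -
  define b where "b = 1 + s * K"
  have b: "b \<ge> 1" using s K_nonneg by (simp add: b_def)
  \<comment> \<open>Splitting the square of a sum twice costs a factor \<open>4 b^2\<close> on
    \<open>|y|^2\<close> and \<open>4 s\<close> on \<open>|z|^2\<close>; the two entries of the
    minimum bring these below the available rates \<open>c\<close> and \<open>1/4\<close>.\<close>
  define c' where "c' = min (c / (4 * b\<^sup>2)) (1 / (16 * (s + 1)))"
  have c': "c' > 0" "c' * (4 * b\<^sup>2) \<le> c" "c' * (4 * s) \<le> 1/4"
  proof -
    show "c' > 0" using c_pos b s by (auto simp: c'_def)
    have "c' * (4 * b\<^sup>2) \<le> c / (4 * b\<^sup>2) * (4 * b\<^sup>2)"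
      by (intro mult_right_mono) (auto simp: c'_def)
    then show "c' * (4 * b\<^sup>2) \<le> c" using b by simp
    have "c' * (4 * s) \<le> 1 / (16 * (s + 1)) * (4 * s)"
      using s by (intro mult_right_mono) (auto simp: c'_def)
    also have "\<dots> \<le> 1/4" using s by (simp add: field_simps)
    finally show "c' * (4 * s) \<le> 1/4" .
  qed
  have "integrable Q (\<lambda>p. exp (c' * (norm (euler s p))\<^sup>2))"
  proof (rule integrable_Q_exp)
    fix y z :: 'a
    have sq: "(u + v)\<^sup>2 \<le> 2 * u\<^sup>2 + 2 * v\<^sup>2" for u v :: real
      using sum_squares_bound[of u v] by (simp add: power2_sum)
    have "(norm (euler s (y, z)))\<^sup>2 \<le> (b * (1 + norm y) + sqrt (2 * s) * norm z)\<^sup>2"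
      using norm_euler_le[of s s y z] s by (intro power_mono) (auto simp: b_def)
    also have "\<dots> \<le> 2 * (b * (1 + norm y))\<^sup>2 + 2 * (sqrt (2 * s) * norm z)\<^sup>2" by (rule sq)
    also have "\<dots> = 2 * b\<^sup>2 * (1 + norm y)\<^sup>2 + 4 * s * (norm z)\<^sup>2"
      using s by (simp add: power_mult_distrib)
    also have "\<dots> \<le> 2 * b\<^sup>2 * (2 * 1\<^sup>2 + 2 * (norm y)\<^sup>2) + 4 * s * (norm z)\<^sup>2"
      by (intro add_right_mono mult_left_mono sq) auto
    finally have "c' * (norm (euler s (y, z)))\<^sup>2 \<le> c' * (2 * b\<^sup>2 * (2 + 2 * (norm y)\<^sup>2) + 4 * s * (norm z)\<^sup>2)"
      using c'(1) by simp
    also have "\<dots> = c' * (4 * b\<^sup>2) + c' * (4 * b\<^sup>2) * (norm y)\<^sup>2 + c' * (4 * s) * (norm z)\<^sup>2"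
      by (simp add: algebra_simps)
    also have "\<dots> \<le> c + c * (norm y)\<^sup>2 + 1/4 * (norm z)\<^sup>2"
      using c' by (intro add_mono mult_right_mono) auto
    finally have "exp (c' * (norm (euler s (y, z)))\<^sup>2) \<le> exp (c + c * (norm y)\<^sup>2 + 1/4 * (norm z)\<^sup>2)"
      by simp
    then show "\<bar>exp (c' * (norm (euler s (y, z)))\<^sup>2)\<bar> \<le> exp c * (exp (c * (norm y)\<^sup>2) * exp ((norm z)\<^sup>2 / 4))"
      by (simp add: exp_add)
  qed measurable
  then show ?thesis using c'(1) by blast
qed

lemma integral_dens:
  fixes f :: "'a \<Rightarrow> real"
  assumes [measurable]: "f \<in> borel_measurable borel" and s: "0 < s"
  shows "(\<integral>x. dens s x * f x \<partial>lborel) = (\<integral>p. f (euler s p) \<partial>Q)"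
    and "integrable lborel (\<lambda>x. dens s x * f x) \<longleftrightarrow> integrable Q (\<lambda>p. f (euler s p))"
proof -
  have "(\<integral>p. f (euler s p) \<partial>Q) = (\<integral>x. f x \<partial>density lborel (dens s))"
    by (subst distr_euler[OF s, symmetric]) (simp add: integral_distr)
  also have "\<dots> = (\<integral>x. dens s x * f x \<partial>lborel)"
    using dens_pos[OF s] by (subst integral_density) (auto intro: less_imp_le)
  finally show "(\<integral>x. dens s x * f x \<partial>lborel) = (\<integral>p. f (euler s p) \<partial>Q)" by simp
  have "integrable Q (\<lambda>p. f (euler s p)) \<longleftrightarrow> integrable (density lborel (dens s)) f"
    by (subst distr_euler[OF s, symmetric]) (simp add: integrable_distr_eq)
  also have "\<dots> \<longleftrightarrow> integrable lborel (\<lambda>x. dens s x * f x)"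
    using dens_pos[OF s] by (subst integrable_density) (auto intro: less_imp_le)
  finally show "integrable lborel (\<lambda>x. dens s x * f x) \<longleftrightarrow> integrable Q (\<lambda>p. f (euler s p))" by simp
qed

lemma ln_dens_has_derivative:
  assumes s: "0 < s"
  shows "((\<lambda>x. ln (dens s x)) has_derivative (\<lambda>v. (grad_dens s x /\<^sub>R dens s x) \<bullet> v)) (at x)"
  using dens_has_derivative(1)[OF s, of x] dens_pos[OF s, of x]
  by (auto intro!: derivative_eq_intros simp: divide_inverse)

lemma regular_density_dens:
  assumes s: "0 < s"
  shows "regular_density (dens s)"
  unfolding regular_density_def
proof (intro conjI allI)
  show "0 < dens s x" for x using s by (rule dens_pos)
  show "prob_space (density lborel (dens s))" using s by (rule prob_space_dens)
  obtain C where C: "\<And>x. norm (grad_dens s x) \<le> C * (1 + norm x) * dens s x"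
    using grad_dens_bound[OF s] by blast
  have "norm (grad_dens s x /\<^sub>R dens s x) \<le> C * (1 + norm x)" for x
    using C[of x] dens_pos[OF s, of x] by (simp add: field_simps)
  then show "\<exists>d C. \<forall>x. ((\<lambda>x. ln (dens s x)) has_derivative (\<lambda>v. d x \<bullet> v)) (at x) \<and> norm (d x) \<le> C * (1 + norm x)"
    using ln_dens_has_derivative[OF s]
    by (intro exI[of _ "\<lambda>x. grad_dens s x /\<^sub>R dens s x"] exI[of _ C]) blast
  show "\<exists>c>0. integrable lborel (\<lambda>x. dens s x * exp (c * (norm x)\<^sup>2))"
    using euler_exp_moment[of s] s by (simp add: integral_dens(2))
qed

end

section \<open>Time derivatives at positive times\<close>

text \<open>Both points lie in the convex ball of radius \<open>|x| + |y|\<close> about the origin,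
  where the gradient is at most its bound at that radius. The choice \<open>y = 0\<close> then gives
  the growth of \<open>f\<close>.\<close>

lemma polynomial_growth_of_gradient:
  fixes f :: "'a::real_inner \<Rightarrow> real"
  assumes der: "\<And>x. (f has_derivative (\<lambda>v. d x \<bullet> v)) (at x)"
    and bound: "\<And>x. norm (d x) \<le> C * (1 + norm x) ^ m"
  shows "\<bar>f x - f y\<bar> \<le> C * (1 + norm x + norm y) ^ m * norm (x - y)"
    and "\<exists>C'. \<forall>x. \<bar>f x\<bar> \<le> C' * (1 + norm x) ^ Suc m"
proof -
  have "0 \<le> C" using order_trans[OF norm_ge_zero bound[of 0]] by simp
  show lip: "\<bar>f x - f y\<bar> \<le> C * (1 + norm x + norm y) ^ m * norm (x - y)" for x y
  proof (rule gradient_bound_imp_lipschitz[where S="cball 0 (norm x + norm y)"])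
    fix w :: 'a assume "w \<in> cball 0 (norm x + norm y)"
    then have "C * (1 + norm w) ^ m \<le> C * (1 + norm x + norm y) ^ m"
      using \<open>0 \<le> C\<close> by (intro mult_left_mono power_mono) auto
    then show "norm (d w) \<le> C * (1 + norm x + norm y) ^ m" using bound[of w] by simp
  qed (auto intro: der has_derivative_at_withinI)
  have "\<bar>f x\<bar> \<le> (\<bar>f 0\<bar> + C) * (1 + norm x) ^ Suc m" for x
  proof -
    have "\<bar>f x\<bar> \<le> \<bar>f 0\<bar> + C * (1 + norm x) ^ m * norm x"
      using lip[of x 0] by simp
    also have "\<dots> \<le> \<bar>f 0\<bar> * (1 + norm x) ^ Suc m + C * (1 + norm x) ^ m * (1 + norm x)"
      using \<open>0 \<le> C\<close> one_le_power[of "1 + norm x" "Suc m"]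
      by (intro add_mono mult_left_mono mult_le_cancel_left1[THEN iffD2]) (auto simp del: power_Suc)
    finally show ?thesis by (simp add: algebra_simps)
  qed
  then show "\<exists>C'. \<forall>x. \<bar>f x\<bar> \<le> C' * (1 + norm x) ^ Suc m" by blast
qed

text \<open>Intended for relative entropies: they are nonnegative, vanish at \<open>t\<close>, and
  have an upper bound that is stationary at \<open>t\<close>.\<close>

lemma has_real_derivative_zero_squeeze:
  fixes f B :: "real \<Rightarrow> real"
  assumes "(B has_real_derivative 0) (at t within S)" "B t = 0" "f t = 0"
    and "eventually (\<lambda>s. 0 \<le> f s \<and> f s \<le> B s) (at t within S)"
  shows "(f has_real_derivative 0) (at t within S)"
  unfolding has_field_derivative_iff
proof (rule Lim_null_comparison)
  show "((\<lambda>s. \<bar>(B s - B t) / (s - t)\<bar>) \<longlongrightarrow> 0) (at t within S)"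
    using assms(1) unfolding has_field_derivative_iff by (rule tendsto_rabs_zero)
  show "eventually (\<lambda>s. norm ((f s - f t) / (s - t)) \<le> \<bar>(B s - B t) / (s - t)\<bar>) (at t within S)"
    using assms(4) by eventually_elim (auto simp: assms(2,3) intro!: divide_right_mono)
qed

lemma regular_densityE:
  assumes "regular_density p"
  obtains d C where "\<And>x. ((\<lambda>x. ln (p x)) has_derivative (\<lambda>v. d x \<bullet> v)) (at x)"
    "\<And>x. norm (d x) \<le> C * (1 + norm x)"
  using assms unfolding regular_density_def by blast

context euler_step
begin

lemma norm_euler_le_linear:
  assumes "0 \<le> s" "s \<le> S"
  shows "1 + norm (euler s (y, z)) \<le> (2 + S * K + sqrt (2 * S)) * (1 + norm y + norm z)"
proof -
  have "1 + norm (euler s (y, z)) \<le> 1 + ((1 + S * K) * (1 + norm y) + sqrt (2 * S) * norm z)"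
    using norm_euler_le[OF assms] by simp
  also have "\<dots> \<le> (1 + norm y + norm z) + ((1 + S * K) * (1 + norm y + norm z) + sqrt (2 * S) * (1 + norm y + norm z))"
  proof -
    have "(1 + S * K) * (1 + norm y) \<le> (1 + S * K) * (1 + norm y + norm z)"
      using assms K_nonneg by (intro mult_left_mono) auto
    moreover have "sqrt (2 * S) * norm z \<le> sqrt (2 * S) * (1 + norm y + norm z)"
      using assms by (intro mult_left_mono) auto
    moreover have "1 \<le> 1 + norm y + norm z" by simp
    ultimately show ?thesis by linarith
  qed
  finally show ?thesis by (simp add: algebra_simps)
qed

lemma integrable_euler_poly:
  fixes F :: "'a \<times> 'a \<Rightarrow> real"
  assumes [measurable]: "F \<in> borel_measurable Q" and s: "0 \<le> s"
    and bound: "\<And>y z. \<bar>F (y, z)\<bar> \<le> C * (1 + norm (euler s (y, z))) ^ m * (1 + norm y + norm z) ^ n"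
  shows "integrable Q F"
proof (rule integrable_Q_poly)
  fix y z :: 'a
  define b where "b = 2 + s * K + sqrt (2 * s)"
  have "0 \<le> C * (1 + norm (euler s (0, 0))) ^ m" using order_trans[OF abs_ge_zero bound[of 0 0]] by simp
  moreover have "0 < (1 + norm (euler s (0, 0))) ^ m"
    by (rule zero_less_power) (simp add: add_pos_nonneg)
  ultimately have "0 \<le> C" by (simp add: zero_le_mult_iff)
  have "\<bar>F (y, z)\<bar> \<le> C * (1 + norm (euler s (y, z))) ^ m * (1 + norm y + norm z) ^ n" by (rule bound)
  also have "\<dots> \<le> C * (b * (1 + norm y + norm z)) ^ m * (1 + norm y + norm z) ^ n"
    using \<open>0 \<le> C\<close> norm_euler_le_linear[OF s order_refl]
    by (intro mult_right_mono mult_left_mono power_mono) (auto simp: b_def)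
  finally show "\<bar>F (y, z)\<bar> \<le> (C * b ^ m) * (1 + norm y + norm z) ^ (m + n)"
    by (simp only: power_mult_distrib power_add mult_ac)
qed fact

lemma integrable_compose_euler:
  fixes f :: "'a \<Rightarrow> real"
  assumes [measurable]: "f \<in> borel_measurable borel" and "0 \<le> s" and "\<And>x. \<bar>f x\<bar> \<le> C * (1 + norm x) ^ m"
  shows "integrable Q (\<lambda>p. f (euler s p))"
  by (rule integrable_euler_poly[where s=s and n=0]) (use assms in auto)

text \<open>Pathwise chain rule: for fixed \<open>(y, z)\<close> the new position moves with
  velocity \<open>z / sqrt (2 s) - H y\<close>, where \<open>1 / sqrt (2 s)\<close> is written
  \<open>sqrt (2 s) / (2 s)\<close>. Away from \<open>s = 0\<close> the velocity has linear growth
  in \<open>(y, z)\<close>, so differentiation passes under the expectation.\<close>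

lemma expectation_euler_has_derivative:
  fixes f :: "'a \<Rightarrow> real"
  assumes der: "\<And>x. (f has_derivative (\<lambda>v. d x \<bullet> v)) (at x)"
    and bound: "\<And>x. norm (d x) \<le> C * (1 + norm x) ^ m"
    and t: "0 < t"
  shows "((\<lambda>s. \<integral>p. f (euler s p) \<partial>Q) has_real_derivative
      (\<integral>p. d (euler t p) \<bullet> ((sqrt (2 * t) / (2 * t)) *\<^sub>R snd p - H (fst p)) \<partial>Q)) (at t)"
proof -
  have [measurable]: "d \<in> borel_measurable borel" using der by (rule borel_measurable_gradient)
  have [measurable]: "f \<in> borel_measurable borel" using der by (rule borel_measurable_of_has_derivative)
  obtain C' where C': "\<And>x. \<bar>f x\<bar> \<le> C' * (1 + norm x) ^ Suc m"
    using polynomial_growth_of_gradient(2)[OF der bound] by blast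
  have "0 \<le> C" using order_trans[OF norm_ge_zero bound[of 0]] by simp
  define D where "D s p = d (euler s p) \<bullet> ((sqrt (2 * s) / (2 * s)) *\<^sub>R snd p - H (fst p))" for s p
  \<comment> \<open>On the ball of radius \<open>t / 2\<close> one has
    \<open>t / 2 \<le> s \<le> 2 t\<close>: \<open>b\<close> is the constant of
    \<open>norm_euler_le_linear\<close> for the largest time, and \<open>b'\<close> bounds the
    velocity using the smallest denominator.\<close>
  define b where "b = 2 + (2 * t) * K + sqrt (2 * (2 * t))"
  define b' where "b' = sqrt (4 * t) / t + K"
  have b: "0 \<le> b" "0 \<le> b'" using t K_nonneg by (auto simp: b_def b'_def)
  have D_der: "((\<lambda>s. f (euler s p)) has_derivative (\<lambda>v. D s p \<bullet> v)) (at s)" if "0 < s" for s p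
  proof -
    have "((\<lambda>s. euler s p) has_derivative (\<lambda>v. v *\<^sub>R ((sqrt (2 * s) / (2 * s)) *\<^sub>R snd p - H (fst p)))) (at s)"
      unfolding euler_def using that
      by (auto intro!: derivative_eq_intros simp: fun_eq_iff algebra_simps real_div_sqrt divide_simps)
    from has_derivative_compose[OF this der] show ?thesis
      by (simp add: D_def mult.commute)
  qed
  define g where "g p = C * b ^ m * b' * (1 + norm (fst p) + norm (snd p)) ^ Suc m" for p :: "'a \<times> 'a"
  have D_bound: "norm (D s p) \<le> g p" if s: "s \<in> ball t (t/2)" for s p
  proof -
    obtain y z where p: "p = (y, z)" by (cases p)
    have s': "t/2 \<le> s" "s \<le> 2 * t" "0 < s" using s t by (auto simp: dist_real_def abs_real_def split: if_splits)
    have 1: "norm (d (euler s p)) \<le> C * (b * (1 + norm y + norm z)) ^ m"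
      using norm_euler_le_linear[of s "2 * t" y z] s' \<open>0 \<le> C\<close>
      by (intro order_trans[OF bound] mult_left_mono power_mono) (auto simp: b_def p)
    have "sqrt (2 * s) / (2 * s) \<le> sqrt (4 * t) / t"
      using s' t by (intro frac_le) auto
    then have "norm ((sqrt (2 * s) / (2 * s)) *\<^sub>R z - H y) \<le> sqrt (4 * t) / t * norm z + K * (1 + norm y)"
      using s' H_growth[of y] mult_right_mono[of "sqrt (2 * s) / (2 * s)" "sqrt (4 * t) / t" "norm z"]
      by (intro order_trans[OF norm_triangle_ineq4] add_mono) auto
    also have "\<dots> \<le> sqrt (4 * t) / t * (1 + norm y + norm z) + K * (1 + norm y + norm z)"
      using t K_nonneg by (intro add_mono[OF mult_left_mono mult_left_mono]) auto
    also have "\<dots> = b' * (1 + norm y + norm z)" by (simp add: b'_def algebra_simps)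
    finally have 2: "norm ((sqrt (2 * s) / (2 * s)) *\<^sub>R z - H y) \<le> b' * (1 + norm y + norm z)" .
    have "norm (D s p) \<le> norm (d (euler s p)) * norm ((sqrt (2 * s) / (2 * s)) *\<^sub>R z - H y)"
      unfolding D_def p using Cauchy_Schwarz_ineq2 by simp
    also have "\<dots> \<le> (C * (b * (1 + norm y + norm z)) ^ m) * (b' * (1 + norm y + norm z))"
      using 1 2 \<open>0 \<le> C\<close> b by (intro mult_mono) auto
    also have "\<dots> = C * b ^ m * b' * (1 + norm y + norm z) ^ Suc m"
      unfolding power_mult_distrib by simp
    finally show ?thesis by (simp add: g_def p)
  qed
  have ball_pos: "0 < s" if "s \<in> ball t (t/2)" for s
    using that t by (auto simp: dist_real_def abs_real_def split: if_splits)
  have [measurable]: "g \<in> borel_measurable Q" unfolding g_def by measurable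
  have g_int: "integrable Q g"
  proof (rule integrable_Q_poly)
    show "\<bar>g (y, z)\<bar> \<le> (C * b ^ m * b') * (1 + norm y + norm z) ^ Suc m" for y z
      using \<open>0 \<le> C\<close> b by (simp add: g_def abs_mult)
  qed measurable
  have lip: "\<bar>f (euler s p) - f (euler t p)\<bar> \<le> g p * norm (s - t)" if s: "s \<in> ball t (t/2)" for s p
  proof -
    have 1: "((\<lambda>s. f (euler s p)) has_derivative (\<lambda>v. D x p \<bullet> v)) (at x within ball t (t/2))"
      if "x \<in> ball t (t/2)" for x
      by (rule has_derivative_at_withinI[OF D_der[OF ball_pos[OF that]]])
    have "\<bar>(\<lambda>s. f (euler s p)) s - (\<lambda>s. f (euler s p)) t\<bar> \<le> g p * norm (s - t)"
      by (rule gradient_bound_imp_lipschitz[where S="ball t (t/2)" and B="g p" and d="\<lambda>x. D x p"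
            and f="\<lambda>s. f (euler s p)" and x=s and y=t])
         (use t in \<open>simp_all only: convex_ball 1 D_bound s centre_in_ball half_gt_zero_iff\<close>)
    then show ?thesis by simp
  qed
  have int: "integrable Q (\<lambda>p. f (euler s p))" if "s \<in> ball t (t/2)" for s
    using ball_pos[OF that] by (intro integrable_compose_euler[OF _ _ C']) auto
  have meas: "(\<lambda>p. D t p) \<in> borel_measurable Q" unfolding D_def by measurable
  have t2: "0 < t/2" "t \<in> ball t (t/2)" using t by auto
  have "((\<lambda>s. \<integral>p. f (euler s p) \<partial>Q) has_derivative (\<lambda>v. (\<integral>p. D t p \<partial>Q) \<bullet> v)) (at t)"
    by (rule has_derivative_integral_dominated(2)[OF t2(1) int meas D_der[OF t] lip D_bound[OF t2(2)] g_int])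
  then show ?thesis
    by (simp add: has_field_derivative_def D_def[abs_def] mult_commute_abs)
qed

text \<open>Tweedie's formula: given that the new position is \<open>x\<close>, the conditional mean
  of \<open>z / sqrt (2 t)\<close> is \<open>- grad_dens t x / dens t x\<close>, because the
  gradient of the kernel is \<open>- kern\<close> times \<open>offset / (2 t)\<close>. No derivative
  of \<open>d\<close> appears.\<close>

lemma expectation_gradient_noise:
  fixes d :: "'a \<Rightarrow> 'a"
  assumes [measurable]: "d \<in> borel_measurable borel"
    and bound: "\<And>x. norm (d x) \<le> C * (1 + norm x) ^ m"
    and t: "0 < t"
  shows "(\<integral>p. d (euler t p) \<bullet> ((sqrt (2 * t) / (2 * t)) *\<^sub>R snd p) \<partial>Q)
      = - (\<integral>p. d (euler t p) \<bullet> (grad_dens t (euler t p) /\<^sub>R dens t (euler t p)) \<partial>Q)"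
    and "integrable Q (\<lambda>p. d (euler t p) \<bullet> ((sqrt (2 * t) / (2 * t)) *\<^sub>R snd p))"
proof -
  have "0 \<le> C" using order_trans[OF norm_ge_zero bound[of 0]] by simp
  define F where "F p = d (snd p) \<bullet> offset t (snd p) (fst p) / (2 * t)" for p
  have [measurable]: "F \<in> borel_measurable (P \<Otimes>\<^sub>M lborel)" unfolding F_def by measurable
  have off: "offset t (euler t p) (fst p) = sqrt (2 * t) *\<^sub>R snd p" for p
    by (simp add: offset_def euler_def)
  have F: "F (fst p, euler t p) = d (euler t p) \<bullet> ((sqrt (2 * t) / (2 * t)) *\<^sub>R snd p)" for p
    by (simp add: F_def off)
  show int: "integrable Q (\<lambda>p. d (euler t p) \<bullet> ((sqrt (2 * t) / (2 * t)) *\<^sub>R snd p))"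
  proof (rule integrable_euler_poly[where s=t and m=m and n=1 and C="C * (sqrt (2 * t) / (2 * t))"])
    fix y z :: 'a
    have "\<bar>d (euler t (y, z)) \<bullet> ((sqrt (2 * t) / (2 * t)) *\<^sub>R snd (y, z))\<bar>
      \<le> norm (d (euler t (y, z))) * norm ((sqrt (2 * t) / (2 * t)) *\<^sub>R z)"
      using Cauchy_Schwarz_ineq2[of "d (euler t (y, z))" "(sqrt (2 * t) / (2 * t)) *\<^sub>R z"] by simp
    also have "\<dots> \<le> (C * (1 + norm (euler t (y, z))) ^ m) * ((sqrt (2 * t) / (2 * t)) * (1 + norm y + norm z))"
      using t bound \<open>0 \<le> C\<close> by (intro mult_mono) (auto intro!: divide_right_mono mult_left_mono)
    finally show "\<bar>d (euler t (y, z)) \<bullet> ((sqrt (2 * t) / (2 * t)) *\<^sub>R snd (y, z))\<bar>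
      \<le> C * (sqrt (2 * t) / (2 * t)) * (1 + norm (euler t (y, z))) ^ m * (1 + norm y + norm z) ^ 1"
      by (simp add: mult_ac)
  qed (use t in auto)
  have intF: "integrable (P \<Otimes>\<^sub>M lborel) (\<lambda>(y, x). kern t (offset t x y) * F (y, x))"
    using int integral_euler(2)[of F t] t unfolding F[symmetric] by (simp add: split_beta')
  have [measurable]: "grad_dens t \<in> borel_measurable borel"
    using dens_has_derivative(1)[OF t] by (rule borel_measurable_gradient)
  have "(\<integral>p. d (euler t p) \<bullet> ((sqrt (2 * t) / (2 * t)) *\<^sub>R snd p) \<partial>Q)
      = (\<integral>p. (\<lambda>(y, x). kern t (offset t x y) * F (y, x)) p \<partial>(P \<Otimes>\<^sub>M lborel))"
    unfolding F[symmetric] using integral_euler(1)[of F t] t by (simp add: split_beta')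
  also have "\<dots> = (\<integral>x. \<integral>y. kern t (offset t x y) * F (y, x) \<partial>P \<partial>lborel)"
    using PL.integral_snd[OF intF] by simp
  also have "\<dots> = (\<integral>x. - (d x \<bullet> grad_dens t x) \<partial>lborel)"
  proof (intro Bochner_Integration.integral_cong refl)
    fix x :: 'a
    have "(\<integral>y. kern t (offset t x y) * F (y, x) \<partial>P)
        = (\<integral>y. - (d x \<bullet> (- (kern t (offset t x y) / (2 * t)) *\<^sub>R offset t x y)) \<partial>P)"
      by (intro Bochner_Integration.integral_cong) (auto simp: F_def)
    also have "\<dots> = - (d x \<bullet> grad_dens t x)"
      unfolding grad_dens_def by (simp only: integral_minus integral_inner_right[OF dens_has_derivative(2)[OF t]])
    finally show "(\<integral>y. kern t (offset t x y) * F (y, x) \<partial>P) = - (d x \<bullet> grad_dens t x)" .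
  qed
  also have "\<dots> = - (\<integral>x. dens t x * (d x \<bullet> (grad_dens t x /\<^sub>R dens t x)) \<partial>lborel)"
    using less_imp_neq[OF dens_pos[OF t], symmetric] by (simp add: mult.assoc[symmetric])
  also have "\<dots> = - (\<integral>p. d (euler t p) \<bullet> (grad_dens t (euler t p) /\<^sub>R dens t (euler t p)) \<partial>Q)"
    using t by (subst integral_dens(1)) auto
  finally show "(\<integral>p. d (euler t p) \<bullet> ((sqrt (2 * t) / (2 * t)) *\<^sub>R snd p) \<partial>Q)
      = - (\<integral>p. d (euler t p) \<bullet> (grad_dens t (euler t p) /\<^sub>R dens t (euler t p)) \<partial>Q)" .
qed

section \<open>Relative entropy between nearby positive times\<close>

lemma ln_dens_bound: "0 < s \<Longrightarrow> \<exists>C. \<forall>x. \<bar>ln (dens s x)\<bar> \<le> C * (1 + norm x) ^ 2"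
proof -
  assume s: "0 < s"
  obtain d C where d: "\<And>x. ((\<lambda>x. ln (dens s x)) has_derivative (\<lambda>v. d x \<bullet> v)) (at x)"
    "\<And>x. norm (d x) \<le> C * (1 + norm x)"
    using regular_densityE[OF regular_density_dens[OF s]] by metis
  show ?thesis using polynomial_growth_of_gradient(2)[OF d(1), of C 1] d(2) by (simp add: numeral_2_eq_2)
qed

lemma integrable_ln_dens:
  assumes s: "0 \<le> s" and t: "0 < t"
  shows "integrable Q (\<lambda>p. ln (dens t (euler s p)))"
  using ln_dens_bound[OF t] s by (auto intro: integrable_compose_euler)

lemma integral_Q_products:
  shows "(\<integral>p. H (fst p) \<bullet> snd p \<partial>Q) = 0" "integrable Q (\<lambda>p. H (fst p) \<bullet> snd p)"
    and "(\<integral>p. (norm (snd p))\<^sup>2 \<partial>Q) = DIM('a)" "integrable Q (\<lambda>p. (norm (snd p))\<^sup>2)"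
    and "(\<integral>p. (norm (H (fst p)))\<^sup>2 \<partial>Q) = (\<integral>y. (norm (H y))\<^sup>2 \<partial>P)" "integrable Q (\<lambda>p. (norm (H (fst p)))\<^sup>2)"
proof -
  have le: "norm (H y) \<le> K * (1 + norm y + norm z)" for y z :: 'a
    using order_trans[OF H_growth[of y] mult_left_mono[OF _ K_nonneg, of "1 + norm y" "1 + norm y + norm z"]] by simp
  show i1: "integrable Q (\<lambda>p. H (fst p) \<bullet> snd p)"
  proof (rule integrable_Q_poly[where C=K and m=2])
    fix y z :: 'a
    have "\<bar>H y \<bullet> z\<bar> \<le> (K * (1 + norm y + norm z)) * (1 + norm y + norm z)"
      using le K_nonneg by (intro order_trans[OF Cauchy_Schwarz_ineq2] mult_mono) auto
    then show "\<bar>H (fst (y, z)) \<bullet> snd (y, z)\<bar> \<le> K * (1 + norm y + norm z)\<^sup>2"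
      by (simp add: power2_eq_square mult.assoc)
  qed measurable
  show i2: "integrable Q (\<lambda>p. (norm (snd p))\<^sup>2)"
    by (rule integrable_Q_poly[where C=1 and m=2]) (auto intro!: power_mono)
  show i3: "integrable Q (\<lambda>p. (norm (H (fst p)))\<^sup>2)"
  proof (rule integrable_Q_poly[where C="K\<^sup>2" and m=2])
    show "\<bar>(norm (H (fst (y, z))))\<^sup>2\<bar> \<le> K\<^sup>2 * (1 + norm y + norm z)\<^sup>2" for y z :: 'a
      using power_mono[OF le[of y z] norm_ge_zero, of 2] by (simp add: power_mult_distrib)
  qed measurable
  show "(\<integral>p. H (fst p) \<bullet> snd p \<partial>Q) = 0"
    using PG.integral_fst'[OF i1] by (simp add: std_gaussian_mean)
  show "(\<integral>p. (norm (snd p))\<^sup>2 \<partial>Q) = DIM('a)"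
    using PG.integral_fst'[OF i2] P.prob_space by (simp add: std_gaussian_norm2)
  show "(\<integral>p. (norm (H (fst p)))\<^sup>2 \<partial>Q) = (\<integral>y. (norm (H y))\<^sup>2 \<partial>P)"
    using PG.integral_fst'[OF i3] G.prob_space by simp
qed

lemma ln_kern_ratio:
  fixes v w :: 'a
  assumes "0 < s" "0 < t"
  shows "ln (kern s v) - ln (kern t w)
    = - (DIM('a) / 2) * ln (s / t) - (norm v)\<^sup>2 / (4 * s) + (norm w)\<^sup>2 / (4 * t)"
proof -
  have *: "ln (kern s v) = ln (gauss (0::'a)) - DIM('a) / 2 * ln (2 * s) - (norm v)\<^sup>2 / (4 * s)" if "0 < s" for s and v :: 'a
  proof -
    have "ln (kern s v) = ln (kern s (0::'a)) - (norm v)\<^sup>2 / (4 * s)"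
      using kern_pos[OF that, of "0::'a"] by (subst kern_eq[OF that]) (simp add: ln_mult)
    also have "ln (kern s (0::'a)) = ln (gauss (0::'a)) - DIM('a) / 2 * ln (2 * s)"
      using that gauss_pos[of "0::'a"] by (simp add: kern_def ln_div ln_realpow ln_sqrt)
    finally show ?thesis .
  qed
  show ?thesis using assms by (simp add: * ln_div ln_mult field_simps)
qed

text \<open>Convexity of relative entropy: passing from the joint law of the old and new positions to the
  law of the new position can only decrease the divergence, and the joint laws are Gaussian given
  the old position.\<close>

lemma KL_dens_le:
  assumes s: "0 < s" and t: "0 < t"
  shows "(\<integral>p. ln (dens s (euler s p)) - ln (dens t (euler s p)) \<partial>Q)
    \<le> DIM('a) / 2 * (s / t - 1 - ln (s / t)) + (s - t)\<^sup>2 * (\<integral>y. (norm (H y))\<^sup>2 \<partial>P) / (4 * t)"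
proof -
  define w where "w r p = offset r (euler s p) (fst p)" for r p
  have [measurable]: "w r \<in> borel_measurable Q" for r unfolding w_def offset_def by measurable
  define A where "A p = ln (kern s (w s p)) - ln (kern t (w t p))" for p
  \<comment> \<open>The ratio, at \<open>t\<close> against \<open>s\<close>, of the conditional
    densities of the old position given the new one. It has mean one under the joint law at
    \<open>s\<close>, so \<open>ln R \<le> R - 1\<close> says that the conditional part of the
    divergence is nonnegative: the chain rule for relative entropy.\<close>
  define R where "R p = kern t (offset t (snd p) (fst p)) / kern s (offset s (snd p) (fst p)) * (dens s (snd p) / dens t (snd p))" for p
  have [measurable]: "R \<in> borel_measurable (P \<Otimes>\<^sub>M lborel)" unfolding R_def by measurable
  have ws: "w s p = sqrt (2 * s) *\<^sub>R snd p" for p by (simp add: w_def offset_def euler_def)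
  have wt: "w t p = (t - s) *\<^sub>R H (fst p) + sqrt (2 * s) *\<^sub>R snd p" for p
    by (simp add: w_def offset_def euler_def algebra_simps)
  have A: "A p = - (DIM('a) / 2) * ln (s / t) - (norm (snd p))\<^sup>2 / 2 + ((t - s)\<^sup>2 / (4 * t)) * (norm (H (fst p)))\<^sup>2
     + (2 * (t - s) * sqrt (2 * s) / (4 * t)) * (H (fst p) \<bullet> snd p) + (2 * s / (4 * t)) * (norm (snd p))\<^sup>2" for p
  proof -
    have 1: "(norm (w s p))\<^sup>2 = 2 * s * (norm (snd p))\<^sup>2"
      unfolding ws using s by (simp add: power_mult_distrib)
    have 2: "(norm (w t p))\<^sup>2 = (t - s)\<^sup>2 * (norm (H (fst p)))\<^sup>2 + 2 * (t - s) * sqrt (2 * s) * (H (fst p) \<bullet> snd p) + 2 * s * (norm (snd p))\<^sup>2"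
      unfolding wt power2_norm_eq_inner using s
      by (simp add: inner_add_left inner_add_right inner_commute power2_eq_square algebra_simps)
    show ?thesis
      unfolding A_def ln_kern_ratio[OF s t] 1 2 using s t by (simp add: add_divide_distrib)
  qed
  have intA: "integrable Q A" unfolding A by (intro Bochner_Integration.integrable_add Bochner_Integration.integrable_diff)
      (use integral_Q_products in auto)
  \<comment> \<open>The mixed term vanishes because the noise has mean zero, and
    \<open>|z|^2\<close> has mean \<open>DIM('a)\<close>; the result is the usual divergence of two
    Gaussians, averaged over the old position.\<close>
  have EA: "(\<integral>p. A p \<partial>Q) = DIM('a) / 2 * (s / t - 1 - ln (s / t)) + (s - t)\<^sup>2 * (\<integral>y. (norm (H y))\<^sup>2 \<partial>P) / (4 * t)"
    unfolding A using integral_Q_products t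
    by (simp add: PG.P.prob_space algebra_simps power2_commute[of t s])
  have kR: "kern s (offset s (snd p) (fst p)) * R p = kern t (offset t (snd p) (fst p)) * (dens s (snd p) / dens t (snd p))" for p
    using kern_pos[OF s, of "offset s (snd p) (fst p)"] by (simp add: R_def)
  have R0: "0 < R p" for p
    unfolding R_def by (intro mult_pos_pos divide_pos_pos kern_pos dens_pos s t)
  have nn: "(\<integral>\<^sup>+p. ennreal (kern s (offset s (snd p) (fst p)) * R p) \<partial>(P \<Otimes>\<^sub>M lborel)) = 1"
  proof -
    have "(\<integral>\<^sup>+p. ennreal (kern s (offset s (snd p) (fst p)) * R p) \<partial>(P \<Otimes>\<^sub>M lborel))
       = (\<integral>\<^sup>+x. \<integral>\<^sup>+y. ennreal (kern t (offset t x y) * (dens s x / dens t x)) \<partial>P \<partial>lborel)"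
      unfolding kR by (subst PL.nn_integral_snd[symmetric]) auto
    also have "\<dots> = (\<integral>\<^sup>+x. ennreal (dens s x) \<partial>lborel)"
    proof (rule nn_integral_cong)
      fix x :: 'a
      have "(\<integral>\<^sup>+y. ennreal (kern t (offset t x y) * (dens s x / dens t x)) \<partial>P)
          = ennreal (\<integral>y. kern t (offset t x y) * (dens s x / dens t x) \<partial>P)"
      proof (rule nn_integral_eq_integral)
        show "integrable P (\<lambda>y. kern t (offset t x y) * (dens s x / dens t x))"
          using integrable_kern[OF t] by (rule integrable_mult_left)
        show "AE y in P. 0 \<le> kern t (offset t x y) * (dens s x / dens t x)"
          by (intro AE_I2 less_imp_le mult_pos_pos divide_pos_pos kern_pos dens_pos s t)
      qed
      also have "(\<integral>y. kern t (offset t x y) * (dens s x / dens t x) \<partial>P) = dens s x"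
        using dens_pos[OF t, of x] by (simp add: dens_def[of t, symmetric])
      finally show "(\<integral>\<^sup>+y. ennreal (kern t (offset t x y) * (dens s x / dens t x)) \<partial>P) = ennreal (dens s x)" .
    qed
    also have "\<dots> = 1"
      using prob_space.emeasure_space_1[OF prob_space_dens[OF s]] by (simp add: emeasure_density)
    finally show ?thesis .
  qed
  have kR0: "0 \<le> kern s (offset s (snd p) (fst p)) * R p" for p
    using R0[of p] kern_pos[OF s, of "offset s (snd p) (fst p)"] by simp
  have intR: "integrable Q (\<lambda>p. R (fst p, euler s p))"
    unfolding integral_euler(2)[OF \<open>R \<in> _\<close> s] using kR0 nn by (intro integrableI_nonneg) auto
  have ER: "(\<integral>p. R (fst p, euler s p) \<partial>Q) = 1"
    unfolding integral_euler(1)[OF \<open>R \<in> _\<close> s] using kR0 nn by (subst integral_eq_nn_integral) auto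
  have "(\<integral>p. ln (dens s (euler s p)) - ln (dens t (euler s p)) \<partial>Q) \<le> (\<integral>p. A p + (R (fst p, euler s p) - 1) \<partial>Q)"
  proof (rule integral_mono)
    show "integrable Q (\<lambda>p. ln (dens s (euler s p)) - ln (dens t (euler s p)))"
      using integrable_ln_dens s t by simp
    show "integrable Q (\<lambda>p. A p + (R (fst p, euler s p) - 1))" using intA intR by simp
    fix p
    have "ln (R (fst p, euler s p)) \<le> R (fst p, euler s p) - 1"
      using R0 by (rule ln_le_minus_one)
    moreover have "ln (R (fst p, euler s p)) = - A p + (ln (dens s (euler s p)) - ln (dens t (euler s p)))"
      using less_imp_neq[OF kern_pos[OF s, where 'a='a], symmetric] less_imp_neq[OF kern_pos[OF t, where 'a='a], symmetric]
        less_imp_neq[OF dens_pos[OF s], symmetric] less_imp_neq[OF dens_pos[OF t], symmetric]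
      by (simp add: R_def A_def w_def ln_mult ln_div)
    ultimately show "ln (dens s (euler s p)) - ln (dens t (euler s p)) \<le> A p + (R (fst p, euler s p) - 1)"
      by linarith
  qed
  also have "\<dots> = (\<integral>p. A p \<partial>Q)" using intA intR ER PG.P.prob_space by simp
  finally show ?thesis unfolding EA .
qed

text \<open>Both densities have mass one, so \<open>q / dens s\<close> has mean one under the law of
  the new position, and \<open>1 - 1 / r \<le> ln r\<close>. The density \<open>q\<close> is general
  so that it can also be the initial density.\<close>

lemma KL_dens_nonneg:
  assumes s: "0 < s" and q: "\<And>x. 0 < q x" "prob_space (density lborel q)" "q \<in> borel_measurable borel"
    and int: "integrable Q (\<lambda>p. ln (q (euler s p)))"
  shows "0 \<le> (\<integral>p. ln (dens s (euler s p)) - ln (q (euler s p)) \<partial>Q)"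
proof -
  note [measurable] = q(3)
  have nn: "(\<integral>\<^sup>+x. ennreal (q x) \<partial>lborel) = 1"
    using prob_space.emeasure_space_1[OF q(2)] by (simp add: emeasure_density)
  have "integrable lborel q" "(\<integral>x. q x \<partial>lborel) = 1"
    using nn q(1) by (auto intro!: integrableI_nonneg simp: less_imp_le integral_eq_nn_integral)
  then have i: "integrable Q (\<lambda>p. q (euler s p) / dens s (euler s p))" "(\<integral>p. q (euler s p) / dens s (euler s p) \<partial>Q) = 1"
    using dens_pos[OF s] integral_dens[of "\<lambda>x. q x / dens s x", OF _ s] by (auto simp: less_imp_neq[symmetric])
  have "0 = (\<integral>p. 1 - q (euler s p) / dens s (euler s p) \<partial>Q)"
    using i PG.P.prob_space by simp
  also have "\<dots> \<le> (\<integral>p. ln (dens s (euler s p)) - ln (q (euler s p)) \<partial>Q)"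
  proof (rule integral_mono)
    fix p
    show "1 - q (euler s p) / dens s (euler s p) \<le> ln (dens s (euler s p)) - ln (q (euler s p))"
      using ln_le_minus_one[of "q (euler s p) / dens s (euler s p)"] q(1)[of "euler s p"] dens_pos[OF s, of "euler s p"]
      by (simp add: ln_div)
  qed (use i int integrable_ln_dens[of s s] s in auto)
  finally show ?thesis .
qed

lemma KL_dens_has_derivative_0:
  assumes t: "0 < t"
  shows "((\<lambda>s. \<integral>p. ln (dens s (euler s p)) - ln (dens t (euler s p)) \<partial>Q) has_real_derivative 0) (at t)"
proof (rule has_real_derivative_zero_squeeze)
  define e where "e = (\<integral>y. (norm (H y))\<^sup>2 \<partial>P)"
  \<comment> \<open>Both \<open>r - 1 - ln r\<close> at \<open>r = s / t\<close> and the square have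
    a double zero at \<open>s = t\<close>.\<close>
  show "((\<lambda>s. DIM('a) / 2 * (s / t - 1 - ln (s / t)) + (s - t)\<^sup>2 * e / (4 * t)) has_real_derivative 0) (at t)"
    using t by (auto intro!: derivative_eq_intros)
  have "eventually (\<lambda>s. 0 < s) (at t)"
    using eventually_at_in_open'[of "{0<..}" t] t by auto
  then show "eventually (\<lambda>s. 0 \<le> (\<integral>p. ln (dens s (euler s p)) - ln (dens t (euler s p)) \<partial>Q) \<and>
      (\<integral>p. ln (dens s (euler s p)) - ln (dens t (euler s p)) \<partial>Q)
        \<le> DIM('a) / 2 * (s / t - 1 - ln (s / t)) + (s - t)\<^sup>2 * e / (4 * t)) (at t)"
  proof eventually_elim
    case (elim s)
    show ?case
      using KL_dens_le[OF elim t] elim t unfolding e_def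
      by (intro conjI KL_dens_nonneg integrable_ln_dens dens_pos prob_space_dens) auto
  qed
qed (use t in auto)

end

section \<open>One Euler step from a regular density\<close>

text \<open>A Frechet derivative tolerates directions \<open>w s\<close> that converge without being
  constant. This is needed because the drift is evaluated at a moving point.\<close>

lemma directional_limit:
  fixes f :: "'a::real_inner \<Rightarrow> real"
  assumes der: "(f has_derivative (\<lambda>v. d \<bullet> v)) (at x)"
    and w: "(w \<longlongrightarrow> v) F" and e: "(e \<longlongrightarrow> 0) F" "eventually (\<lambda>s. (0::real) < e s) F"
  shows "((\<lambda>s. (f (x + e s *\<^sub>R w s) - f x) / e s) \<longlongrightarrow> d \<bullet> v) F"
proof -
  define r where "r h = (f (x + h) - f x - d \<bullet> h) / norm h" for h
  have "(r \<longlongrightarrow> 0) (at 0)"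
  proof -
    have "((\<lambda>y. norm ((f y - f x) - d \<bullet> (y - x)) / norm (y - x)) \<longlongrightarrow> 0) (at x)"
      using der by (simp add: has_derivative_iff_norm)
    then have "((\<lambda>h. norm (r h)) \<longlongrightarrow> 0) (at 0)"
      unfolding at_to_0[of x] filterlim_filtermap by (simp add: r_def add.commute)
    then show ?thesis by (rule tendsto_norm_zero_cancel)
  qed
  \<comment> \<open>Division by zero returns \<open>0\<close>, exactly the value that makes
    \<open>r\<close> continuous at the origin; steps with \<open>w s = 0\<close> need no separate
    treatment.\<close>
  moreover have "r 0 = 0" by (simp add: r_def)
  ultimately have "isCont r 0" by (simp add: isCont_def)
  moreover have ew: "((\<lambda>s. e s *\<^sub>R w s) \<longlongrightarrow> 0) F"
    using tendsto_scaleR[OF e(1) w] by simp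
  ultimately have "((\<lambda>s. r (e s *\<^sub>R w s)) \<longlongrightarrow> 0) F"
    using isCont_tendsto_compose[of "0::'a" r] \<open>r 0 = 0\<close> by metis
  then have "((\<lambda>s. d \<bullet> w s + r (e s *\<^sub>R w s) * norm (w s)) \<longlongrightarrow> d \<bullet> v + 0 * norm v) F"
    by (intro tendsto_intros w)
  moreover have "eventually (\<lambda>s. d \<bullet> w s + r (e s *\<^sub>R w s) * norm (w s) = (f (x + e s *\<^sub>R w s) - f x) / e s) F"
    using e(2)
  proof eventually_elim
    case (elim s)
    have "f (x + h) - f x = d \<bullet> h + r h * norm h" for h by (simp add: r_def)
    from this[of "e s *\<^sub>R w s"] elim show ?case
      by (simp add: add_divide_distrib)
  qed
  ultimately show ?thesis by (simp add: tendsto_cong)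
qed

text \<open>The quotient is \<open>z / e\<close> times \<open>(exp z - 1) / z\<close>. Extending the
  second factor by \<open>1\<close> at \<open>0\<close> makes it continuous, so \<open>z s\<close>
  may vanish.\<close>

lemma tendsto_expm1_quotient:
  fixes z e :: "'b \<Rightarrow> real"
  assumes "(z \<longlongrightarrow> 0) F" "((\<lambda>s. z s / e s) \<longlongrightarrow> L) F"
  shows "((\<lambda>s. (exp (z s) - 1) / e s) \<longlongrightarrow> L) F"
proof -
  define E where "E u = (if u = 0 then 1 else (exp u - 1) / u)" for u :: real
  have "((\<lambda>u. (exp u - 1) / u) \<longlongrightarrow> (1::real)) (at 0)"
    using DERIV_exp[of "0::real"] by (simp add: has_field_derivative_iff)
  then have "(E \<longlongrightarrow> 1) (at 0)"
    by (rule Lim_transform_eventually) (auto simp: E_def eventually_at_filter)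
  then have "isCont E 0" by (simp add: isCont_def E_def)
  from isCont_tendsto_compose[OF this assms(1)] have "((\<lambda>s. E (z s)) \<longlongrightarrow> 1) F" by (simp add: E_def)
  from tendsto_mult[OF assms(2) this] have "((\<lambda>s. z s / e s * E (z s)) \<longlongrightarrow> L) F" by simp
  moreover have "z s / e s * E (z s) = (exp (z s) - 1) / e s" for s by (simp add: E_def)
  ultimately show ?thesis by (simp only:)
qed

lemma abs_expm1_le: "\<bar>exp u - 1\<bar> \<le> \<bar>u\<bar> * exp \<bar>u\<bar>" for u :: real
proof (cases "0 \<le> u")
  case True
  have "1 - u \<le> exp (- u)" using exp_ge_add_one_self[of "-u"] by simp
  then have "(1 - u) * exp u \<le> exp (- u) * exp u" by (intro mult_right_mono) auto
  then have "exp u - 1 \<le> u * exp u" by (simp add: exp_minus algebra_simps)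
  then show ?thesis using True by simp
next
  case False
  have "1 - exp u \<le> - u" using exp_ge_add_one_self[of u] by linarith
  also have "\<dots> \<le> - u * exp (- u)" using False mult_left_mono[of 1 "exp (- u)" "- u"] by simp
  finally show ?thesis using False by simp
qed

text \<open>A quadratic exponent with a small prefactor \<open>\<eta>\<close> is dominated by any
  prescribed Gaussian weights. The first bound keeps a factor \<open>\<eta>\<close>, from
  \<open>|exp u - 1| \<le> |u| exp |u|\<close>, so that it survives division by
  \<open>\<eta>\<close>.\<close>

lemma exp_increment_bound:
  assumes "0 \<le> (\<Lambda>::real)" "0 < a" "0 < b"
  shows "\<exists>C>0. \<exists>\<delta>>0. \<forall>\<eta> \<xi> r t. 0 \<le> \<eta> \<longrightarrow> \<eta> < \<delta> \<longrightarrow> 0 \<le> r \<longrightarrow> 0 \<le> t \<longrightarrow> \<bar>\<xi>\<bar> \<le> \<eta> * \<Lambda> * (1 + r + t)\<^sup>2 \<longrightarrow>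
     \<bar>exp \<xi> - 1\<bar> \<le> \<eta> * (C * (exp (a * r\<^sup>2) * exp (b * t\<^sup>2))) \<and> exp \<xi> \<le> C * (exp (a * r\<^sup>2) * exp (b * t\<^sup>2))"
proof -
  \<comment> \<open>Half the smaller rate, because two copies of \<open>exp (\<kappa> X)\<close> are
    spent: one on the exponential itself, one on the polynomial factor \<open>X\<close>.\<close>
  define \<kappa> where "\<kappa> = min a b / 2"
  have \<kappa>: "0 < \<kappa>" "2 * \<kappa> \<le> a" "2 * \<kappa> \<le> b" using assms by (auto simp: \<kappa>_def)
  \<comment> \<open>Since \<open>(1 + r + t)^2 \<le> 3 (1 + r^2 + t^2)\<close>, this bounds the
    exponent by \<open>\<kappa> X\<close>. The \<open>+ 1\<close> covers
    \<open>\<Lambda> = 0\<close>.\<close>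
  define \<delta> where "\<delta> = \<kappa> / (3 * \<Lambda> + 1)"
  have \<delta>: "0 < \<delta>" "3 * \<Lambda> * \<delta> \<le> \<kappa>" using assms \<kappa> by (auto simp: \<delta>_def field_simps)
  define C where "C = (\<Lambda> * (3 / \<kappa>) + 1) * exp (2 * \<kappa>)"
  have main: "\<bar>exp \<xi> - 1\<bar> \<le> \<eta> * (C * (exp (a * r\<^sup>2) * exp (b * t\<^sup>2))) \<and> exp \<xi> \<le> C * (exp (a * r\<^sup>2) * exp (b * t\<^sup>2))"
    if \<eta>: "0 \<le> \<eta>" "\<eta> < \<delta>" and r: "0 \<le> r" "0 \<le> t" and \<xi>: "\<bar>\<xi>\<bar> \<le> \<eta> * \<Lambda> * (1 + r + t)\<^sup>2" for \<eta> \<xi> r t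
  proof -
    define X where "X = 1 + r\<^sup>2 + t\<^sup>2"
    have X0: "0 \<le> X" by (simp add: X_def)
    have q: "(1 + r + t)\<^sup>2 \<le> 3 * X"
      using sum_squares_bound[of 1 r] sum_squares_bound[of 1 t] sum_squares_bound[of r t]
      by (simp add: X_def power2_eq_square algebra_simps)
    have "\<eta> * \<Lambda> * (1 + r + t)\<^sup>2 \<le> \<delta> * \<Lambda> * (3 * X)"
      using \<eta> assms q by (intro mult_mono) auto
    also have "\<dots> = (3 * \<Lambda> * \<delta>) * X" by simp
    also have "\<dots> \<le> \<kappa> * X" using \<delta> X0 by (intro mult_right_mono) auto
    finally have \<xi>X: "\<bar>\<xi>\<bar> \<le> \<kappa> * X" using \<xi> by simp
    have E: "exp (\<kappa> * X) * exp (\<kappa> * X) \<le> exp (2 * \<kappa>) * (exp (a * r\<^sup>2) * exp (b * t\<^sup>2))"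
    proof -
      have "2 * \<kappa> * r\<^sup>2 \<le> a * r\<^sup>2" "2 * \<kappa> * t\<^sup>2 \<le> b * t\<^sup>2" using \<kappa> by (auto intro!: mult_right_mono)
      then have "\<kappa> * X + \<kappa> * X \<le> 2 * \<kappa> + (a * r\<^sup>2 + b * t\<^sup>2)" by (simp add: X_def algebra_simps)
      then have "exp (\<kappa> * X + \<kappa> * X) \<le> exp (2 * \<kappa> + (a * r\<^sup>2 + b * t\<^sup>2))" by simp
      then show ?thesis by (simp only: exp_add)
    qed
    have "\<kappa> * X \<le> exp (\<kappa> * X)" using exp_ge_add_one_self[of "\<kappa> * X"] by linarith
    then have X: "X \<le> 1 / \<kappa> * exp (\<kappa> * X)" using \<kappa> by (simp add: field_simps)
    have "\<bar>exp \<xi> - 1\<bar> \<le> \<bar>\<xi>\<bar> * exp \<bar>\<xi>\<bar>" by (rule abs_expm1_le)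
    also have "\<dots> \<le> (\<eta> * \<Lambda> * (3 * (1 / \<kappa> * exp (\<kappa> * X)))) * exp (\<kappa> * X)"
    proof (intro mult_mono)
      have "\<eta> * \<Lambda> * (1 + r + t)\<^sup>2 \<le> \<eta> * \<Lambda> * (3 * (1 / \<kappa> * exp (\<kappa> * X)))"
        using \<eta> assms q X by (intro mult_left_mono) auto
      then show "\<bar>\<xi>\<bar> \<le> \<eta> * \<Lambda> * (3 * (1 / \<kappa> * exp (\<kappa> * X)))" using \<xi> by simp
    qed (use \<xi>X \<eta> assms \<kappa> in auto)
    also have "\<dots> = \<eta> * ((\<Lambda> * (3 / \<kappa>)) * (exp (\<kappa> * X) * exp (\<kappa> * X)))" by simp
    also have "\<dots> \<le> \<eta> * ((\<Lambda> * (3 / \<kappa>) + 1) * (exp (2 * \<kappa>) * (exp (a * r\<^sup>2) * exp (b * t\<^sup>2))))"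
      using \<eta> assms \<kappa> by (intro mult_left_mono mult_mono[OF _ E]) auto
    finally have 1: "\<bar>exp \<xi> - 1\<bar> \<le> \<eta> * (C * (exp (a * r\<^sup>2) * exp (b * t\<^sup>2)))" by (simp add: C_def mult.assoc)
    have "exp \<xi> \<le> 1 * (exp (\<kappa> * X) * exp (\<kappa> * X))"
      using \<xi>X X0 \<kappa> mult_mono[of 1 "exp (\<kappa> * X)" "exp \<xi>" "exp (\<kappa> * X)"] by simp
    also have "\<dots> \<le> (\<Lambda> * (3 / \<kappa>) + 1) * (exp (2 * \<kappa>) * (exp (a * r\<^sup>2) * exp (b * t\<^sup>2)))"
      using assms \<kappa> by (intro mult_mono[OF _ E]) auto
    finally show ?thesis using 1 by (simp add: C_def mult.assoc)
  qed
  have "C > 0" using assms \<kappa> by (auto simp: C_def intro!: mult_pos_pos add_nonneg_pos)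
  then show ?thesis using \<delta>(1) main by blast
qed

locale euler_density = euler_step "density lborel p" H K c
  for p :: "'a::euclidean_space \<Rightarrow> real" and H K c +
  fixes dp :: "'a \<Rightarrow> 'a" and L0 :: real
  assumes p_pos: "0 < p x"
    and ln_p_der: "((\<lambda>x. ln (p x)) has_derivative (\<lambda>v. dp x \<bullet> v)) (at x)"
    and dp_bound: "norm (dp x) \<le> L0 * (1 + norm x)"
begin

lemma ln_p_measurable [measurable]: "(\<lambda>x. ln (p x)) \<in> borel_measurable borel"
  using ln_p_der by (intro borel_measurable_continuous_onI)
    (meson has_derivative_continuous continuous_at_imp_continuous_on)

lemma p_measurable [measurable]: "p \<in> borel_measurable borel"
proof -
  have "(\<lambda>x. exp (ln (p x))) \<in> borel_measurable borel" by measurable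
  then show ?thesis using p_pos by simp
qed

lemma dp_measurable [measurable]: "dp \<in> borel_measurable borel"
  using ln_p_der by (rule borel_measurable_gradient)

lemma L0_nonneg: "0 \<le> L0"
  using order_trans[OF norm_ge_zero dp_bound[of 0]] by simp

text \<open>The density ratio \<open>p (x - \<eta> z) / p x\<close>, which compensates a translation
  of the old position. In logarithmic form the increment bounds for \<open>ln p\<close> apply to it
  directly.\<close>

definition shift_weight :: "real \<Rightarrow> 'a \<times> 'a \<Rightarrow> real" where
  "shift_weight \<eta> q = exp (ln (p (fst q - \<eta> *\<^sub>R snd q)) - ln (p (fst q)))"

lemma shift_weight_measurable [measurable]: "shift_weight \<eta> \<in> borel_measurable Q"
  unfolding shift_weight_def by measurable

text \<open>For each fixed \<open>z\<close> Lebesgue measure is invariant under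
  \<open>x -> x - \<eta> z\<close>, and \<open>p x\<close> times the weight is
  \<open>p (x - \<eta> z)\<close>.\<close>

lemma nn_integral_shift:
  assumes F [measurable]: "F \<in> borel_measurable (borel \<Otimes>\<^sub>M borel)"
  shows "(\<integral>\<^sup>+q. F q \<partial>Q) = (\<integral>\<^sup>+q. ennreal (shift_weight \<eta> q) * F (fst q - \<eta> *\<^sub>R snd q, snd q) \<partial>Q)"
proof -
  have [measurable]: "F \<in> borel_measurable Q"
    using F sets_Q by (simp cong: measurable_cong_sets)
  have wp: "ennreal (p x) * ennreal (shift_weight \<eta> (x, z)) = ennreal (p (x - \<eta> *\<^sub>R z))" for x z
    using p_pos[of x] p_pos[of "x - \<eta> *\<^sub>R z"] by (simp add: shift_weight_def exp_diff ennreal_mult'[symmetric])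
  have "(\<integral>\<^sup>+q. ennreal (shift_weight \<eta> q) * F (fst q - \<eta> *\<^sub>R snd q, snd q) \<partial>Q)
      = (\<integral>\<^sup>+z. \<integral>\<^sup>+x. ennreal (shift_weight \<eta> (x, z)) * F (x - \<eta> *\<^sub>R z, z) \<partial>density lborel p \<partial>std_gaussian)"
    by (subst PG.nn_integral_snd[symmetric]) auto
  also have "\<dots> = (\<integral>\<^sup>+z. \<integral>\<^sup>+x. ennreal (p (x - \<eta> *\<^sub>R z)) * F (x - \<eta> *\<^sub>R z, z) \<partial>lborel \<partial>std_gaussian)"
    by (intro nn_integral_cong, subst nn_integral_density) (auto simp: shift_weight_def mult.assoc[symmetric] wp[unfolded shift_weight_def, simplified])
  also have "\<dots> = (\<integral>\<^sup>+z. \<integral>\<^sup>+x. ennreal (p x) * F (x, z) \<partial>lborel \<partial>std_gaussian)"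
  proof (rule nn_integral_cong)
    fix z :: 'a
    show "(\<integral>\<^sup>+x. ennreal (p (x - \<eta> *\<^sub>R z)) * F (x - \<eta> *\<^sub>R z, z) \<partial>lborel) = (\<integral>\<^sup>+x. ennreal (p x) * F (x, z) \<partial>lborel)"
      using nn_integral_lborel_affine[of "\<lambda>x. ennreal (p x) * F (x, z)" 1 "- \<eta> *\<^sub>R z"] by simp
  qed
  also have "\<dots> = (\<integral>\<^sup>+z. \<integral>\<^sup>+x. F (x, z) \<partial>density lborel p \<partial>std_gaussian)"
    by (intro nn_integral_cong, subst nn_integral_density) auto
  also have "\<dots> = (\<integral>\<^sup>+q. F q \<partial>Q)" by (rule PG.nn_integral_snd) measurable
  finally show ?thesis by simp
qed

lemma distr_shift:
  "distr (density Q (\<lambda>q. ennreal (shift_weight \<eta> q))) Q (\<lambda>q. (fst q - \<eta> *\<^sub>R snd q, snd q)) = Q"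
proof (rule measure_eqI)
  fix A assume "A \<in> sets (distr (density Q (\<lambda>q. ennreal (shift_weight \<eta> q))) Q (\<lambda>q. (fst q - \<eta> *\<^sub>R snd q, snd q)))"
  then have A [measurable]: "A \<in> sets Q" by simp
  then have [measurable]: "A \<in> sets (borel \<Otimes>\<^sub>M borel)" using sets_Q by simp
  have [measurable]: "(\<lambda>q. (fst q - \<eta> *\<^sub>R snd q, snd q)) \<in> measurable Q Q" by measurable
  have "emeasure (distr (density Q (\<lambda>q. ennreal (shift_weight \<eta> q))) Q (\<lambda>q. (fst q - \<eta> *\<^sub>R snd q, snd q))) A
     = (\<integral>\<^sup>+q. indicator A q \<partial>distr (density Q (\<lambda>q. ennreal (shift_weight \<eta> q))) Q (\<lambda>q. (fst q - \<eta> *\<^sub>R snd q, snd q)))"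
    by simp
  also have "\<dots> = (\<integral>\<^sup>+q. ennreal (shift_weight \<eta> q) * indicator A (fst q - \<eta> *\<^sub>R snd q, snd q) \<partial>Q)"
    by (subst nn_integral_distr, simp_all, subst nn_integral_density, simp_all)
  also have "\<dots> = (\<integral>\<^sup>+q. indicator A q \<partial>Q)"
    by (rule nn_integral_shift[symmetric]) measurable
  finally show "emeasure (distr (density Q (\<lambda>q. ennreal (shift_weight \<eta> q))) Q (\<lambda>q. (fst q - \<eta> *\<^sub>R snd q, snd q))) A = emeasure Q A"
    by simp
qed simp

lemma integral_shift:
  fixes F :: "'a \<times> 'a \<Rightarrow> real"
  assumes [measurable]: "F \<in> borel_measurable Q"
  shows "(\<integral>q. F q \<partial>Q) = (\<integral>q. shift_weight \<eta> q * F (fst q - \<eta> *\<^sub>R snd q, snd q) \<partial>Q)"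
    and "integrable Q F \<longleftrightarrow> integrable Q (\<lambda>q. shift_weight \<eta> q * F (fst q - \<eta> *\<^sub>R snd q, snd q))"
proof -
  have [measurable]: "(\<lambda>q. (fst q - \<eta> *\<^sub>R snd q, snd q)) \<in> measurable Q Q" by measurable
  have w0: "AE q in Q. 0 \<le> shift_weight \<eta> q" by (simp add: shift_weight_def)
  have "(\<integral>q. F q \<partial>Q) = (\<integral>q. F q \<partial>distr (density Q (\<lambda>q. ennreal (shift_weight \<eta> q))) Q (\<lambda>q. (fst q - \<eta> *\<^sub>R snd q, snd q)))"
    by (simp add: distr_shift)
  also have "\<dots> = (\<integral>q. F (fst q - \<eta> *\<^sub>R snd q, snd q) \<partial>density Q (\<lambda>q. ennreal (shift_weight \<eta> q)))"
    by (rule integral_distr) auto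
  also have "\<dots> = (\<integral>q. shift_weight \<eta> q * F (fst q - \<eta> *\<^sub>R snd q, snd q) \<partial>Q)"
    using w0 by (subst integral_density) auto
  finally show "(\<integral>q. F q \<partial>Q) = (\<integral>q. shift_weight \<eta> q * F (fst q - \<eta> *\<^sub>R snd q, snd q) \<partial>Q)" .
  have "integrable Q F \<longleftrightarrow> integrable (distr (density Q (\<lambda>q. ennreal (shift_weight \<eta> q))) Q (\<lambda>q. (fst q - \<eta> *\<^sub>R snd q, snd q))) F"
    by (simp add: distr_shift)
  also have "\<dots> \<longleftrightarrow> integrable (density Q (\<lambda>q. ennreal (shift_weight \<eta> q))) (\<lambda>q. F (fst q - \<eta> *\<^sub>R snd q, snd q))"
    by (rule integrable_distr_eq) auto
  also have "\<dots> \<longleftrightarrow> integrable Q (\<lambda>q. shift_weight \<eta> q * F (fst q - \<eta> *\<^sub>R snd q, snd q))"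
    using w0 by (subst integrable_density) auto
  finally show "integrable Q F \<longleftrightarrow> integrable Q (\<lambda>q. shift_weight \<eta> q * F (fst q - \<eta> *\<^sub>R snd q, snd q))" .
qed

text \<open>The Gaussian is even; the reflection is made for each fixed old position.\<close>

lemma integral_reflect:
  fixes F :: "'a \<times> 'a \<Rightarrow> real"
  assumes "integrable Q F" "integrable Q (\<lambda>q. F (fst q, - snd q))"
  shows "(\<integral>q. F (fst q, - snd q) \<partial>Q) = (\<integral>q. F q \<partial>Q)"
proof -
  have [measurable]: "F \<in> borel_measurable Q" using assms(1) by auto
  have "(\<integral>z. F (y, - z) \<partial>std_gaussian) = (\<integral>z. F (y, z) \<partial>std_gaussian)" for y
  proof -
    have [measurable]: "(\<lambda>z. F (y, z)) \<in> borel_measurable borel"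
      using measurable_compose[of "\<lambda>z. (y, z)" std_gaussian Q F borel] by simp
    show ?thesis
      using integral_lborel_affine[of "\<lambda>z. gauss z * F (y, z)" "-1" 0]
      by (simp add: integral_std_gaussian gauss_def)
  qed
  then show ?thesis
    using PG.integral_fst'[OF assms(1)] PG.integral_fst'[OF assms(2)] by simp
qed

section \<open>Short-time expansion of the density around the initial one\<close>

lemma norm_shift_le:
  fixes x z :: 'a
  assumes "\<bar>\<eta>\<bar> \<le> 1"
  shows "norm (x - \<eta> *\<^sub>R z) \<le> norm x + norm z" "norm (x + \<eta> *\<^sub>R z) \<le> norm x + norm z"
proof -
  have "\<bar>\<eta>\<bar> * norm z \<le> norm z" using assms mult_right_mono[of "\<bar>\<eta>\<bar>" 1 "norm z"] by simp
  then show "norm (x - \<eta> *\<^sub>R z) \<le> norm x + norm z" "norm (x + \<eta> *\<^sub>R z) \<le> norm x + norm z"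
    using norm_triangle_ineq4[of x "\<eta> *\<^sub>R z"] norm_triangle_ineq[of x "\<eta> *\<^sub>R z"] by auto
qed

lemma ln_p_increment:
  assumes "\<bar>\<eta>\<bar> \<le> 1"
  shows "\<bar>ln (p (x - \<eta> *\<^sub>R z)) - ln (p x)\<bar> \<le> \<bar>\<eta>\<bar> * (2 * L0) * (1 + norm x + norm z)\<^sup>2"
proof -
  have "\<bar>ln (p (x - \<eta> *\<^sub>R z)) - ln (p x)\<bar> \<le> L0 * (1 + norm (x - \<eta> *\<^sub>R z) + norm x) ^ 1 * norm ((x - \<eta> *\<^sub>R z) - x)"
    using dp_bound by (intro polynomial_growth_of_gradient(1)[where f="\<lambda>x. ln (p x)", OF ln_p_der]) simp
  also have "\<dots> \<le> L0 * (2 * (1 + norm x + norm z)) * (\<bar>\<eta>\<bar> * (1 + norm x + norm z))"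
  proof (intro mult_mono mult_left_mono)
    show "(1 + norm (x - \<eta> *\<^sub>R z) + norm x) ^ 1 \<le> 2 * (1 + norm x + norm z)"
      unfolding power_one_right
    proof -
      have "1 + norm (x - \<eta> *\<^sub>R z) + norm x \<le> 1 + (norm x + norm z) + norm x"
        by (intro add_right_mono add_left_mono norm_shift_le(1) assms)
      also have "\<dots> \<le> 2 * (1 + norm x + norm z)" by simp
      finally show "1 + norm (x - \<eta> *\<^sub>R z) + norm x \<le> 2 * (1 + norm x + norm z)" .
    qed
    show "norm ((x - \<eta> *\<^sub>R z) - x) \<le> \<bar>\<eta>\<bar> * (1 + norm x + norm z)"
      by (simp add: mult_left_mono)
  qed (use L0_nonneg in auto)
  finally show ?thesis by (simp add: power2_eq_square mult_ac)
qed

text \<open>The exponent left after substituting \<open>y = x - \<eta> z\<close> in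
  \<open>dens\<close> and dividing by \<open>p x\<close> and \<open>gauss z\<close>: the increment
  of \<open>ln p\<close>, plus the change of the Gaussian exponent when \<open>z\<close> is replaced
  by \<open>z + (\<eta> / 2) v\<close>.\<close>

definition log_ratio :: "real \<Rightarrow> 'a \<times> 'a \<Rightarrow> real" where
  "log_ratio \<eta> q = (let v = H (fst q - \<eta> *\<^sub>R snd q) in
     ln (p (fst q - \<eta> *\<^sub>R snd q)) - ln (p (fst q)) - \<eta> / 2 * (snd q \<bullet> v) - \<eta>\<^sup>2 / 8 * (norm v)\<^sup>2)"

lemma log_ratio_measurable [measurable]: "log_ratio \<eta> \<in> borel_measurable Q"
  unfolding log_ratio_def Let_def by measurable

lemma log_ratio_bound:
  assumes \<eta>: "0 \<le> \<eta>" "\<eta> \<le> 1"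
  shows "\<bar>log_ratio \<eta> (x, z)\<bar> \<le> \<eta> * (2 * L0 + K + K\<^sup>2) * (1 + norm x + norm z)\<^sup>2"
proof -
  define b where "b = 1 + norm x + norm z"
  define v where "v = H (x - \<eta> *\<^sub>R z)"
  have "norm v \<le> K * (1 + norm (x - \<eta> *\<^sub>R z))" unfolding v_def by (rule H_growth)
  also have "\<dots> \<le> K * b" using K_nonneg norm_shift_le(1)[of \<eta> x z] \<eta> by (intro mult_left_mono) (auto simp: b_def)
  finally have v: "norm v \<le> K * b" .
  have "\<bar>z \<bullet> v\<bar> \<le> b * (K * b)"
    using v by (intro order_trans[OF Cauchy_Schwarz_ineq2] mult_mono) (auto simp: b_def)
  then have 1: "\<bar>\<eta> / 2 * (z \<bullet> v)\<bar> \<le> \<eta> * (K * b\<^sup>2)"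
    using \<eta> mult_mono[of "\<eta> / 2" \<eta> "\<bar>z \<bullet> v\<bar>" "K * b\<^sup>2"] by (simp add: abs_mult power2_eq_square mult_ac)
  have "(norm v)\<^sup>2 \<le> (K * b)\<^sup>2" using v by (intro power_mono) auto
  moreover have "\<eta>\<^sup>2 / 8 \<le> \<eta>" using \<eta> mult_mono[of \<eta> 1 \<eta> \<eta>] by (simp add: power2_eq_square)
  ultimately have 2: "\<bar>\<eta>\<^sup>2 / 8 * (norm v)\<^sup>2\<bar> \<le> \<eta> * (K\<^sup>2 * b\<^sup>2)"
    using \<eta> mult_mono[of "\<eta>\<^sup>2 / 8" \<eta> "(norm v)\<^sup>2" "(K * b)\<^sup>2"] by (simp add: power_mult_distrib)
  have 3: "\<bar>ln (p (x - \<eta> *\<^sub>R z)) - ln (p x)\<bar> \<le> \<eta> * (2 * L0) * b\<^sup>2"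
    using ln_p_increment[of \<eta> x z] \<eta> by (simp add: b_def)
  have "log_ratio \<eta> (x, z) = (ln (p (x - \<eta> *\<^sub>R z)) - ln (p x)) - \<eta> / 2 * (z \<bullet> v) - \<eta>\<^sup>2 / 8 * (norm v)\<^sup>2"
    by (simp add: log_ratio_def v_def Let_def)
  then have "\<bar>log_ratio \<eta> (x, z)\<bar> \<le> \<eta> * (2 * L0) * b\<^sup>2 + \<eta> * (K * b\<^sup>2) + \<eta> * (K\<^sup>2 * b\<^sup>2)"
    using 1 2 3 by linarith
  then show ?thesis unfolding b_def[symmetric] by (simp add: algebra_simps)
qed

text \<open>Substituting \<open>y = x - \<eta> z\<close> with \<open>\<eta> = sqrt (2 s)\<close> removes the singularity of the kernel at \<open>s = 0\<close>.\<close>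

lemma dens_eq:
  assumes s: "0 < s"
  shows "dens s x = p x * (\<integral>z. exp (log_ratio (sqrt (2 * s)) (x, z)) \<partial>std_gaussian)"
proof -
  define \<eta> where "\<eta> = sqrt (2 * s)"
  have \<eta>: "0 < \<eta>" "\<eta>\<^sup>2 = 2 * s" using s by (auto simp: \<eta>_def)
  have [measurable]: "(\<lambda>z. exp (log_ratio \<eta> (x, z))) \<in> borel_measurable borel"
    unfolding log_ratio_def Let_def by simp
  have "dens s x = (\<integral>y. p y * kern s (offset s x y) \<partial>lborel)"
    unfolding dens_def using p_pos by (subst integral_density) (auto simp: less_imp_le)
  also have "\<dots> = \<bar>- \<eta>\<bar> ^ DIM('a) * (\<integral>z. p (x + (- \<eta>) *\<^sub>R z) * kern s (offset s x (x + (- \<eta>) *\<^sub>R z)) \<partial>lborel)"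
    using \<eta> by (intro integral_lborel_affine) auto
  also have "\<dots> = (\<integral>z. \<eta> ^ DIM('a) * (p (x + (- \<eta>) *\<^sub>R z) * kern s (offset s x (x + (- \<eta>) *\<^sub>R z))) \<partial>lborel)"
    using \<eta> by simp
  also have "\<dots> = (\<integral>z. p x * (gauss z * exp (log_ratio \<eta> (x, z))) \<partial>lborel)"
  proof (intro Bochner_Integration.integral_cong refl)
    fix z :: 'a
    define v where "v = H (x - \<eta> *\<^sub>R z)"
    have "(offset s x (x - \<eta> *\<^sub>R z)) /\<^sub>R \<eta> = z + (\<eta> / 2) *\<^sub>R v"
    proof -
      have "s / \<eta> = \<eta> / 2" using \<eta> by (simp add: power2_eq_square field_simps)
      then show ?thesis using \<eta> by (simp add: offset_def v_def scaleR_add_right divide_inverse_commute[symmetric])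
    qed
    then have k: "\<eta> ^ DIM('a) * kern s (offset s x (x - \<eta> *\<^sub>R z)) = gauss (z + (\<eta> / 2) *\<^sub>R v)"
      using \<eta>(1) by (simp add: kern_def \<eta>_def[symmetric])
    have "(norm (z + (\<eta> / 2) *\<^sub>R v))\<^sup>2 = (norm z)\<^sup>2 + \<eta> * (z \<bullet> v) + \<eta>\<^sup>2 / 4 * (norm v)\<^sup>2"
      unfolding power2_norm_eq_inner
      by (simp add: inner_add_left inner_add_right inner_commute power2_eq_square algebra_simps)
    then have "- (norm (z + (\<eta> / 2) *\<^sub>R v))\<^sup>2 / 2 = - (norm z)\<^sup>2 / 2 + (- \<eta> / 2 * (z \<bullet> v) - \<eta>\<^sup>2 / 8 * (norm v)\<^sup>2)"
      by (simp add: field_simps)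
    then have "gauss (z + (\<eta> / 2) *\<^sub>R v) = gauss z * exp (- \<eta> / 2 * (z \<bullet> v) - \<eta>\<^sup>2 / 8 * (norm v)\<^sup>2)"
      unfolding gauss_def by (simp only: exp_add times_divide_eq_left)
    note gx = this
    have px: "p (x - \<eta> *\<^sub>R z) = p x * exp (ln (p (x - \<eta> *\<^sub>R z)) - ln (p x))"
      using p_pos[of x] p_pos[of "x - \<eta> *\<^sub>R z"] by (simp add: exp_diff)
    have "\<eta> ^ DIM('a) * (p (x - \<eta> *\<^sub>R z) * kern s (offset s x (x - \<eta> *\<^sub>R z)))
        = (\<eta> ^ DIM('a) * kern s (offset s x (x - \<eta> *\<^sub>R z))) * p (x - \<eta> *\<^sub>R z)"
      by (simp only: mult_ac)
    also have "\<dots> = (gauss z * exp (- \<eta> / 2 * (z \<bullet> v) - \<eta>\<^sup>2 / 8 * (norm v)\<^sup>2)) * (p x * exp (ln (p (x - \<eta> *\<^sub>R z)) - ln (p x)))"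
      by (rule arg_cong2[where f="(*)", OF trans[OF k gx] px])
    also have "\<dots> = p x * (gauss z * (exp (ln (p (x - \<eta> *\<^sub>R z)) - ln (p x)) * exp (- \<eta> / 2 * (z \<bullet> v) - \<eta>\<^sup>2 / 8 * (norm v)\<^sup>2)))"
      by (simp only: mult_ac)
    also have "\<dots> = p x * (gauss z * exp (log_ratio \<eta> (x, z)))"
      by (simp add: log_ratio_def v_def[symmetric] Let_def exp_add[symmetric])
    finally show "\<eta> ^ DIM('a) * (p (x + (- \<eta>) *\<^sub>R z) * kern s (offset s x (x + (- \<eta>) *\<^sub>R z)))
        = p x * (gauss z * exp (log_ratio \<eta> (x, z)))" by simp
  qed
  also have "\<dots> = p x * (\<integral>z. exp (log_ratio \<eta> (x, z)) \<partial>std_gaussian)"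
    by (simp add: integral_std_gaussian)
  finally show ?thesis by (simp add: \<eta>_def)
qed

lemma sqrt_at_0: "((\<lambda>s. sqrt (2 * s)) \<longlongrightarrow> 0) (at 0 within {0..})"
  using tendsto_real_sqrt[OF tendsto_mult_right_zero[of "\<lambda>s::real. s" "at 0 within {0..}" 2]] by simp

lemma eventually_small:
  assumes "0 < \<delta>"
  shows "eventually (\<lambda>s. 0 < s \<and> s < 1 \<and> 0 < sqrt (2 * s) \<and> sqrt (2 * s) \<le> 1 \<and> sqrt (2 * s) < \<delta>) (at (0::real) within {0..})"
proof -
  have 1: "eventually (\<lambda>s. sqrt (2 * s) < min 1 \<delta>) (at (0::real) within {0..})"
    using assms by (intro order_tendstoD(2)[OF sqrt_at_0]) auto
  have 2: "eventually (\<lambda>s. 0 < s \<and> s < 1) (at (0::real) within {0..})"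
    unfolding eventually_at by (intro exI[of _ 1]) (auto simp: dist_real_def)
  from 1 2 show ?thesis by eventually_elim auto
qed

lemma shift_tendsto: "((\<lambda>s. x - sqrt (2 * s) *\<^sub>R z) \<longlongrightarrow> x) (at 0 within {0..})"
  for x z :: 'a
  using tendsto_diff[OF tendsto_const[of x] tendsto_scaleR[OF sqrt_at_0 tendsto_const[of z]]] by simp

lemma H_shift_tendsto: "((\<lambda>s. H (x - sqrt (2 * s) *\<^sub>R z)) \<longlongrightarrow> H x) (at 0 within {0..})"
  using H_cont isCont_tendsto_compose[OF _ shift_tendsto] by (auto simp: continuous_on_eq_continuous_at)

lemma ln_p_quotient_tendsto:
  "((\<lambda>s. (ln (p (x - sqrt (2 * s) *\<^sub>R z)) - ln (p x)) / sqrt (2 * s)) \<longlongrightarrow> - (dp x \<bullet> z)) (at 0 within {0..})"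
proof -
  have "eventually (\<lambda>s. 0 < sqrt (2 * s)) (at (0::real) within {0..})"
    using eventually_small[OF zero_less_one] by eventually_elim auto
  from directional_limit[OF ln_p_der[of x] tendsto_const[of "- z"] sqrt_at_0 this] show ?thesis by simp
qed

text \<open>The limit is linear in \<open>z\<close>, hence of Gaussian mean zero. This cancellation
  makes \<open>dens s / p - 1\<close> of smaller order than \<open>sqrt s\<close>. Continuity of
  \<open>H\<close> is enough, since \<open>H\<close> enters already multiplied by
  \<open>\<eta>\<close>.\<close>

lemma log_ratio_quotient_tendsto:
  "((\<lambda>s. log_ratio (sqrt (2 * s)) (x, z) / sqrt (2 * s)) \<longlongrightarrow> - ((dp x + (1/2) *\<^sub>R H x) \<bullet> z)) (at 0 within {0..})"
proof -
  let ?e = "\<lambda>s. sqrt (2 * s)"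
  have "((\<lambda>s. (ln (p (x - ?e s *\<^sub>R z)) - ln (p x)) / ?e s - 1/2 * (z \<bullet> H (x - ?e s *\<^sub>R z)) - ?e s / 8 * (norm (H (x - ?e s *\<^sub>R z)))\<^sup>2)
     \<longlongrightarrow> - (dp x \<bullet> z) - 1/2 * (z \<bullet> H x) - 0 / 8 * (norm (H x))\<^sup>2) (at 0 within {0..})"
    by (intro tendsto_intros ln_p_quotient_tendsto H_shift_tendsto sqrt_at_0) auto
  then have lim: "((\<lambda>s. (ln (p (x - ?e s *\<^sub>R z)) - ln (p x)) / ?e s - 1/2 * (z \<bullet> H (x - ?e s *\<^sub>R z)) - ?e s / 8 * (norm (H (x - ?e s *\<^sub>R z)))\<^sup>2)
     \<longlongrightarrow> - ((dp x + (1/2) *\<^sub>R H x) \<bullet> z)) (at 0 within {0..})"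
    by (simp add: inner_add_left inner_add_right inner_commute)
  show ?thesis
  proof (rule Lim_transform_eventually[OF lim])
    show "eventually (\<lambda>s. (ln (p (x - ?e s *\<^sub>R z)) - ln (p x)) / ?e s - 1/2 * (z \<bullet> H (x - ?e s *\<^sub>R z)) - ?e s / 8 * (norm (H (x - ?e s *\<^sub>R z)))\<^sup>2
      = log_ratio (?e s) (x, z) / ?e s) (at 0 within {0..})"
      using eventually_small[OF zero_less_one]
    proof eventually_elim
      case (elim s)
      define e where "e = ?e s"
      then have "e \<noteq> 0" using elim by simp
      then show ?case
        unfolding e_def[symmetric] by (simp add: log_ratio_def Let_def diff_divide_distrib power2_eq_square)
    qed
  qed
qed

lemma log_ratio_tendsto_0: "((\<lambda>s. log_ratio (sqrt (2 * s)) (x, z)) \<longlongrightarrow> 0) (at 0 within {0..})"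
proof (rule Lim_transform_eventually)
  show "((\<lambda>s. log_ratio (sqrt (2 * s)) (x, z) / sqrt (2 * s) * sqrt (2 * s)) \<longlongrightarrow> 0) (at 0 within {0..})"
    using tendsto_mult[OF log_ratio_quotient_tendsto sqrt_at_0] by simp
  show "eventually (\<lambda>s. log_ratio (sqrt (2 * s)) (x, z) / sqrt (2 * s) * sqrt (2 * s) = log_ratio (sqrt (2 * s)) (x, z)) (at 0 within {0..})"
    using eventually_small[OF zero_less_one] by eventually_elim auto
qed

lemma ln_p_bound: "\<exists>C. \<forall>x. \<bar>ln (p x)\<bar> \<le> C * (1 + norm x) ^ 2"
  using polynomial_growth_of_gradient(2)[OF ln_p_der, of L0 1] dp_bound by (simp add: numeral_2_eq_2)

end

section \<open>Time derivatives at the left endpoint\<close>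

context euler_density
begin

lemma integral_P: 
  fixes f :: "'a \<Rightarrow> real"
  assumes [measurable]: "f \<in> borel_measurable borel"
  shows "(\<integral>x. f x \<partial>density lborel p) = (\<integral>x. p x * f x \<partial>lborel)"
    and "integrable (density lborel p) f \<longleftrightarrow> integrable lborel (\<lambda>x. p x * f x)"
  using p_pos by (subst integral_density integrable_density; auto simp: less_imp_le)+

text \<open>The rates \<open>c / 4\<close> and \<open>1/8\<close> leave room: a second copy of each
  weight absorbs the polynomial, and the totals \<open>c / 2\<close> and \<open>1/4\<close> are
  still integrable.\<close>

lemma integrable_Q_exp_poly:
  fixes F :: "'a \<times> 'a \<Rightarrow> real"
  assumes [measurable]: "F \<in> borel_measurable Q"
    and bound: "\<And>x z. \<bar>F (x, z)\<bar> \<le> C * (1 + norm x + norm z) ^ m * (exp (c / 4 * (norm x)\<^sup>2) * exp (1 / 8 * (norm z)\<^sup>2))"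
  shows "integrable Q F"
proof -
  have "c / 4 > 0" using c_pos by simp
  then obtain C1 where C1: "C1 > 0" "\<And>r::real. r\<ge>0 \<Longrightarrow> (1 + r) ^ m \<le> C1 * exp (c / 4 * r\<^sup>2)"
    using power_le_exp_norm2[of "c / 4" m] by auto
  obtain C2 where C2: "C2 > 0" "\<And>r::real. r\<ge>0 \<Longrightarrow> (1 + r) ^ m \<le> C2 * exp (1 / 8 * r\<^sup>2)"
    using power_le_exp_norm2[of "1/8" m] by auto
  have "0 \<le> C" using order_trans[OF abs_ge_zero bound[of 0 0]] by simp
  show ?thesis
  proof (rule integrable_Q_exp)
    fix x z :: 'a
    have "(1 + norm x + norm z) ^ m \<le> ((1 + norm x) * (1 + norm z)) ^ m"
      by (intro power_mono) (auto simp: algebra_simps)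
    also have "\<dots> \<le> (C1 * exp (c / 4 * (norm x)\<^sup>2)) * (C2 * exp (1 / 8 * (norm z)\<^sup>2))"
      unfolding power_mult_distrib using C1(1) by (intro mult_mono C1(2) C2(2)) auto
    finally have "C * (1 + norm x + norm z) ^ m * (exp (c / 4 * (norm x)\<^sup>2) * exp (1 / 8 * (norm z)\<^sup>2))
        \<le> C * ((C1 * exp (c / 4 * (norm x)\<^sup>2)) * (C2 * exp (1 / 8 * (norm z)\<^sup>2))) * (exp (c / 4 * (norm x)\<^sup>2) * exp (1 / 8 * (norm z)\<^sup>2))"
      using \<open>0 \<le> C\<close> by (intro mult_right_mono mult_left_mono) auto
    also have "\<dots> = (C * C1 * C2) * ((exp (c / 4 * (norm x)\<^sup>2) * exp (c / 4 * (norm x)\<^sup>2)) * (exp (1 / 8 * (norm z)\<^sup>2) * exp (1 / 8 * (norm z)\<^sup>2)))"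
      by (simp only: mult_ac)
    also have "exp (1 / 8 * (norm z)\<^sup>2) * exp (1 / 8 * (norm z)\<^sup>2) = exp ((norm z)\<^sup>2 / 4)"
      by (simp add: exp_add[symmetric])
    also have "exp (c / 4 * (norm x)\<^sup>2) * exp (c / 4 * (norm x)\<^sup>2) = exp (c / 2 * (norm x)\<^sup>2)"
      by (simp add: exp_add[symmetric])
    also have "(C * C1 * C2) * (exp (c / 2 * (norm x)\<^sup>2) * exp ((norm z)\<^sup>2 / 4))
       \<le> (C * C1 * C2) * (exp (c * (norm x)\<^sup>2) * exp ((norm z)\<^sup>2 / 4))"
      using \<open>0 \<le> C\<close> C1 C2 c_pos by (intro mult_left_mono mult_right_mono) (auto intro!: mult_right_mono)
    finally show "\<bar>F (x, z)\<bar> \<le> (C * C1 * C2) * (exp (c * (norm x)\<^sup>2) * exp ((norm z)\<^sup>2 / 4))"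
      using bound[of x z] by linarith
  qed fact
qed

lemma increment_bounds:
  obtains C \<delta> where "0 < C" "0 < \<delta>"
    "\<And>\<eta> x z. 0 \<le> \<eta> \<Longrightarrow> \<eta> \<le> 1 \<Longrightarrow> \<eta> < \<delta> \<Longrightarrow>
      \<bar>exp (log_ratio \<eta> (x, z)) - 1\<bar> \<le> \<eta> * (C * (exp (c / 4 * (norm x)\<^sup>2) * exp (1 / 8 * (norm z)\<^sup>2)))"
    "\<And>\<eta> x z. 0 \<le> \<eta> \<Longrightarrow> \<eta> \<le> 1 \<Longrightarrow> \<eta> < \<delta> \<Longrightarrow>
      \<bar>shift_weight \<eta> (x, z) - 1\<bar> \<le> \<eta> * (C * (exp (c / 4 * (norm x)\<^sup>2) * exp (1 / 8 * (norm z)\<^sup>2)))"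
    "\<And>\<eta> x z. 0 \<le> \<eta> \<Longrightarrow> \<eta> \<le> 1 \<Longrightarrow> \<eta> < \<delta> \<Longrightarrow>
      shift_weight \<eta> (x, z) \<le> C * (exp (c / 4 * (norm x)\<^sup>2) * exp (1 / 8 * (norm z)\<^sup>2))"
proof -
  define \<Lambda> where "\<Lambda> = 2 * L0 + K + K\<^sup>2"
  have \<Lambda>: "0 \<le> \<Lambda>" "2 * L0 \<le> \<Lambda>" using L0_nonneg K_nonneg by (auto simp: \<Lambda>_def)
  have c4: "0 < c / 4" "(0::real) < 1 / 8" using c_pos by auto
  from exp_increment_bound[OF \<Lambda>(1) c4] obtain C \<delta> where C: "0 < C" "0 < \<delta>"
    and main: "\<And>\<eta> \<xi> r t. 0 \<le> \<eta> \<Longrightarrow> \<eta> < \<delta> \<Longrightarrow> 0 \<le> r \<Longrightarrow> 0 \<le> t \<Longrightarrow> \<bar>\<xi>\<bar> \<le> \<eta> * \<Lambda> * (1 + r + t)\<^sup>2 \<Longrightarrow>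
     \<bar>exp \<xi> - 1\<bar> \<le> \<eta> * (C * (exp (c / 4 * r\<^sup>2) * exp (1 / 8 * t\<^sup>2))) \<and> exp \<xi> \<le> C * (exp (c / 4 * r\<^sup>2) * exp (1 / 8 * t\<^sup>2))"
    by blast
  have wb: "\<bar>ln (p (x - \<eta> *\<^sub>R z)) - ln (p x)\<bar> \<le> \<eta> * \<Lambda> * (1 + norm x + norm z)\<^sup>2"
    if "0 \<le> \<eta>" "\<eta> \<le> 1" for \<eta> x z
  proof -
    have "\<bar>ln (p (x - \<eta> *\<^sub>R z)) - ln (p x)\<bar> \<le> \<eta> * (2 * L0) * (1 + norm x + norm z)\<^sup>2"
      using ln_p_increment[of \<eta> x z] that by simp
    also have "\<dots> \<le> \<eta> * \<Lambda> * (1 + norm x + norm z)\<^sup>2"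
      using that \<Lambda> by (intro mult_right_mono mult_left_mono) auto
    finally show ?thesis .
  qed
  show ?thesis
  proof (rule that[OF C])
    fix \<eta> :: real and x z :: 'a assume \<eta>: "0 \<le> \<eta>" "\<eta> \<le> 1" "\<eta> < \<delta>"
    show "\<bar>exp (log_ratio \<eta> (x, z)) - 1\<bar> \<le> \<eta> * (C * (exp (c / 4 * (norm x)\<^sup>2) * exp (1 / 8 * (norm z)\<^sup>2)))"
      using main[OF \<eta>(1,3) norm_ge_zero norm_ge_zero log_ratio_bound[OF \<eta>(1,2), folded \<Lambda>_def, of x z]] by simp
    show "\<bar>shift_weight \<eta> (x, z) - 1\<bar> \<le> \<eta> * (C * (exp (c / 4 * (norm x)\<^sup>2) * exp (1 / 8 * (norm z)\<^sup>2)))"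
      "shift_weight \<eta> (x, z) \<le> C * (exp (c / 4 * (norm x)\<^sup>2) * exp (1 / 8 * (norm z)\<^sup>2))"
      using main[OF \<eta>(1,3) norm_ge_zero norm_ge_zero wb[OF \<eta>(1,2), of x z]] by (auto simp: shift_weight_def)
  qed
qed

lemma integrable_std_gaussian_exp8: "integrable std_gaussian (\<lambda>z::'a. exp (1 / 8 * (norm z)\<^sup>2))"
  by (rule Bochner_Integration.integrable_bound[OF integrable_std_gaussian_exp]) auto

text \<open>The divergence is at most the chi-square distance, which equals \<open>2 s\<close> times
  the integral of \<open>\<rho>^2\<close> against \<open>p\<close>. By the cancellation of the
  linear term \<open>\<rho>\<close> tends to zero pointwise, and the Gaussian moment dominates its
  square. Zero is put in by hand at \<open>s = 0\<close>, where \<open>dens\<close> is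
  degenerate.\<close>

lemma KL_dens_has_derivative_0_at_0:
  "((\<lambda>s. if s = 0 then 0 else \<integral>q. ln (dens s (euler s q)) - ln (p (euler s q)) \<partial>Q) has_real_derivative 0) (at 0 within {0..})"
proof -
  let ?P = "density lborel p"
  define \<rho> where "\<rho> s x = (dens s x / p x - 1) / sqrt (2 * s)" for s x
  obtain C \<delta> where C: "0 < C" "0 < \<delta>" and
    ratio_bound: "\<And>\<eta> x z. 0 \<le> \<eta> \<Longrightarrow> \<eta> \<le> 1 \<Longrightarrow> \<eta> < \<delta> \<Longrightarrow>
      \<bar>exp (log_ratio \<eta> (x, z)) - 1\<bar> \<le> \<eta> * (C * (exp (c / 4 * (norm x)\<^sup>2) * exp (1 / 8 * (norm z)\<^sup>2)))"
    using increment_bounds by metis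
  define G8 where "G8 = (\<integral>z. exp (1 / 8 * (norm (z::'a))\<^sup>2) \<partial>std_gaussian)"
  note small = eventually_small[OF C(2)]
  have [measurable]: "(\<lambda>z. log_ratio \<eta> (x, z)) \<in> borel_measurable std_gaussian" for \<eta> x
    unfolding log_ratio_def Let_def by simp
  have [measurable]: "\<rho> s \<in> borel_measurable borel" for s unfolding \<rho>_def by measurable
  define B where "B x z = C * (exp (c / 4 * (norm x)\<^sup>2) * exp (1 / 8 * (norm z)\<^sup>2))" for x z :: 'a
  have B_int: "integrable std_gaussian (B x)" for x
    unfolding B_def by (intro integrable_mult_right integrable_std_gaussian_exp8)
  have \<psi>_bound: "\<bar>(exp (log_ratio (sqrt (2 * s)) (x, z)) - 1) / sqrt (2 * s)\<bar> \<le> B x z"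
    if "0 < s" "sqrt (2 * s) \<le> 1" "sqrt (2 * s) < \<delta>" for s x z
    using ratio_bound[of "sqrt (2 * s)" x z] that by (simp add: B_def field_simps)
  have \<rho>_eq: "\<rho> s x = (\<integral>z. (exp (log_ratio (sqrt (2 * s)) (x, z)) - 1) / sqrt (2 * s) \<partial>std_gaussian)"
    if s: "0 < s" "sqrt (2 * s) \<le> 1" "sqrt (2 * s) < \<delta>" for s x
  proof -
    have i: "integrable std_gaussian (\<lambda>z. (exp (log_ratio (sqrt (2 * s)) (x, z)) - 1) / sqrt (2 * s))"
    proof (rule Bochner_Integration.integrable_bound[OF B_int[of x]])
      show "AE z in std_gaussian. norm ((exp (log_ratio (sqrt (2 * s)) (x, z)) - 1) / sqrt (2 * s)) \<le> norm (B x z)"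
        using order_trans[OF \<psi>_bound[OF s] abs_ge_self] by (intro AE_I2) simp
    qed measurable
    have "integrable std_gaussian (\<lambda>z. (exp (log_ratio (sqrt (2 * s)) (x, z)) - 1) / sqrt (2 * s) * sqrt (2 * s) + 1)"
      using integrable_mult_left[OF i, of "sqrt (2 * s)"] by (intro Bochner_Integration.integrable_add) auto
    then have i2: "integrable std_gaussian (\<lambda>z. exp (log_ratio (sqrt (2 * s)) (x, z)))" using s(1) by simp
    have "dens s x / p x = (\<integral>z. exp (log_ratio (sqrt (2 * s)) (x, z)) \<partial>std_gaussian)"
      using dens_eq[OF s(1), of x] p_pos[of x] by simp
    then show ?thesis using i2 G.prob_space by (simp add: \<rho>_def)
  qed
  have \<rho>_lim: "((\<lambda>s. \<rho> s x) \<longlongrightarrow> 0) (at 0 within {0..})" for x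
  proof -
    have "((\<lambda>s. \<integral>z. (exp (log_ratio (sqrt (2 * s)) (x, z)) - 1) / sqrt (2 * s) \<partial>std_gaussian)
       \<longlongrightarrow> (\<integral>z. - ((dp x + (1/2) *\<^sub>R H x) \<bullet> z) \<partial>std_gaussian)) (at 0 within {0..})"
    proof (rule tendsto_integral_dominated[where g="B x"])
      show "eventually (\<lambda>s. \<forall>z\<in>space std_gaussian. \<bar>(exp (log_ratio (sqrt (2 * s)) (x, z)) - 1) / sqrt (2 * s)\<bar> \<le> B x z) (at 0 within {0..})"
        using small by eventually_elim (use \<psi>_bound in auto)
      show "((\<lambda>s. (exp (log_ratio (sqrt (2 * s)) (x, z)) - 1) / sqrt (2 * s)) \<longlongrightarrow> - ((dp x + (1/2) *\<^sub>R H x) \<bullet> z)) (at 0 within {0..})" for z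
        by (rule tendsto_expm1_quotient[OF log_ratio_tendsto_0 log_ratio_quotient_tendsto])
    qed (use B_int in auto)
    then have "((\<lambda>s. \<integral>z. (exp (log_ratio (sqrt (2 * s)) (x, z)) - 1) / sqrt (2 * s) \<partial>std_gaussian) \<longlongrightarrow> 0) (at 0 within {0..})"
      by (simp only: integral_minus std_gaussian_mean minus_zero)
    moreover have "eventually (\<lambda>s. (\<integral>z. (exp (log_ratio (sqrt (2 * s)) (x, z)) - 1) / sqrt (2 * s) \<partial>std_gaussian) = \<rho> s x) (at 0 within {0..})"
      using small by eventually_elim (use \<rho>_eq in auto)
    ultimately show ?thesis by (rule Lim_transform_eventually)
  qed
  \<comment> \<open>The weight with rate \<open>c / 4\<close> can be squared and still stays below
    the exponential moment with rate \<open>c\<close>.\<close>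
  have \<rho>_bound: "(\<rho> s x)\<^sup>2 \<le> (C * G8)\<^sup>2 * exp (c * (norm x)\<^sup>2)"
    if s: "0 < s" "sqrt (2 * s) \<le> 1" "sqrt (2 * s) < \<delta>" for s x
  proof -
    have "\<bar>\<rho> s x\<bar> \<le> (\<integral>z. B x z \<partial>std_gaussian)"
      unfolding \<rho>_eq[OF s]
    proof (rule order_trans[OF integral_abs_bound integral_mono_AE'[OF B_int]])
      show "AE z in std_gaussian. \<bar>(exp (log_ratio (sqrt (2 * s)) (x, z)) - 1) / sqrt (2 * s)\<bar> \<le> B x z"
        by (intro AE_I2 \<psi>_bound[OF s])
      show "AE z in std_gaussian. 0 \<le> B x z"
        by (intro AE_I2 order_trans[OF abs_ge_zero \<psi>_bound[OF s]])
    qed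
    also have "\<dots> = C * G8 * exp (c / 4 * (norm x)\<^sup>2)" by (simp add: B_def G8_def)
    finally have "\<bar>\<rho> s x\<bar>\<^sup>2 \<le> (C * G8 * exp (c / 4 * (norm x)\<^sup>2))\<^sup>2" by (intro power_mono) auto
    also have "\<dots> = (C * G8)\<^sup>2 * exp (c / 2 * (norm x)\<^sup>2)"
      by (simp add: power_mult_distrib exp_double[symmetric])
    also have "\<dots> \<le> (C * G8)\<^sup>2 * exp (c * (norm x)\<^sup>2)"
      using c_pos by (intro mult_left_mono) (auto intro!: mult_right_mono)
    finally show ?thesis by simp
  qed
  have int_\<rho>2: "integrable ?P (\<lambda>x. (\<rho> s x)\<^sup>2)" and int_\<rho>: "integrable ?P (\<rho> s)"
    if s: "0 < s" "sqrt (2 * s) \<le> 1" "sqrt (2 * s) < \<delta>" for s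
  proof -
    have i: "integrable ?P (\<lambda>x. (C * G8)\<^sup>2 * exp (c * (norm x)\<^sup>2))"
      using exp_moment by (rule integrable_mult_right)
    show 1: "integrable ?P (\<lambda>x. (\<rho> s x)\<^sup>2)"
      by (rule Bochner_Integration.integrable_bound[OF i]) (use \<rho>_bound[OF s] in auto)
    have "integrable ?P (\<lambda>x. 1 + (\<rho> s x)\<^sup>2)" using 1 by simp
    then show "integrable ?P (\<rho> s)"
    proof (rule Bochner_Integration.integrable_bound)
      have "\<bar>r\<bar> \<le> 1 + r\<^sup>2" for r :: real
      proof -
        have "2 * \<bar>r\<bar> \<le> r\<^sup>2 + 1" using sum_squares_bound[of "\<bar>r\<bar>" 1] by simp
        moreover have "0 \<le> r\<^sup>2" by simp
        ultimately show ?thesis by linarith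
      qed
      then show "AE x in ?P. norm (\<rho> s x) \<le> norm (1 + (\<rho> s x)\<^sup>2)" by simp
    qed simp
  qed
  have "((\<lambda>s. \<integral>x. (\<rho> s x)\<^sup>2 \<partial>?P) \<longlongrightarrow> (\<integral>x. 0 \<partial>?P)) (at 0 within {0..})"
  proof (rule tendsto_integral_dominated)
    show "eventually (\<lambda>s. \<forall>x\<in>space ?P. \<bar>(\<rho> s x)\<^sup>2\<bar> \<le> (C * G8)\<^sup>2 * exp (c * (norm x)\<^sup>2)) (at 0 within {0..})"
      using small by eventually_elim (use \<rho>_bound in auto)
    show "((\<lambda>s. (\<rho> s x)\<^sup>2) \<longlongrightarrow> 0) (at 0 within {0..})" for x
      using tendsto_power[OF \<rho>_lim, of x 2] by simp
    show "integrable ?P (\<lambda>x. (C * G8)\<^sup>2 * exp (c * (norm x)\<^sup>2))"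
      using exp_moment by (rule integrable_mult_right)
  qed auto
  then have lim: "((\<lambda>s. 2 * (\<integral>x. (\<rho> s x)\<^sup>2 \<partial>?P)) \<longlongrightarrow> 0) (at 0 within {0..})"
    by (simp add: tendsto_mult_right_zero)
  have ln_p_int: "integrable Q (\<lambda>q. ln (p (euler s q)))" if "0 < s" for s
    using ln_p_bound that by (auto intro: integrable_compose_euler[OF ln_p_measurable])
  define KL where "KL s = (\<integral>q. ln (dens s (euler s q)) - ln (p (euler s q)) \<partial>Q)" for s
  have KL0: "0 \<le> KL s" if s: "0 < s" for s
    unfolding KL_def by (rule KL_dens_nonneg[OF s p_pos prob_P p_measurable ln_p_int[OF s]])
  have KL1: "KL s \<le> 2 * s * (\<integral>x. (\<rho> s x)\<^sup>2 \<partial>?P)"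
    if s: "0 < s" "sqrt (2 * s) \<le> 1" "sqrt (2 * s) < \<delta>" for s
  proof -
    define \<eta> where "\<eta> = sqrt (2 * s)"
    have \<eta>: "0 < \<eta>" "\<eta> * \<eta> = 2 * s" using s by (auto simp: \<eta>_def)
    have r: "dens s x / p x = 1 + \<eta> * \<rho> s x" for x
      using \<eta>(1) by (simp add: \<rho>_def \<eta>_def[symmetric])
    have nn: "(\<integral>\<^sup>+x. ennreal (dens s x) \<partial>lborel) = 1"
      using prob_space.emeasure_space_1[OF prob_space_dens[OF s(1)]] by (simp add: emeasure_density)
    \<comment> \<open>Both densities have mass one, so \<open>\<rho>\<close> has mean zero under
      \<open>p\<close>; this removes the term of order \<open>sqrt s\<close> from the bound.\<close>
    have "(\<integral>x. 1 + \<eta> * \<rho> s x \<partial>?P) = (\<integral>x. dens s x \<partial>lborel)"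
      unfolding r[symmetric] using p_pos by (subst integral_P) (auto simp: less_imp_neq[symmetric])
    also have "\<dots> = 1" using nn dens_pos[OF s(1)] by (simp add: integral_eq_nn_integral less_imp_le)
    finally have \<rho>0: "(\<integral>x. \<rho> s x \<partial>?P) = 0" using int_\<rho>[OF s] \<eta>(1) P.prob_space by simp
    have f_int: "integrable ?P (\<lambda>x. \<eta> * \<rho> s x + \<eta> * \<eta> * (\<rho> s x)\<^sup>2)"
      using int_\<rho>[OF s] int_\<rho>2[OF s] by simp
    \<comment> \<open>Passing from the law at time \<open>s\<close> back to \<open>p\<close>
      multiplies by \<open>1 + \<eta> \<rho>\<close>, which turns the mean of
      \<open>\<eta> \<rho>\<close> into the square of order \<open>s\<close>.\<close>
    have eq: "dens s x * (\<eta> * \<rho> s x) = p x * (\<eta> * \<rho> s x + \<eta> * \<eta> * (\<rho> s x)\<^sup>2)" for x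
    proof -
      have "dens s x = p x * (1 + \<eta> * \<rho> s x)" using r[of x] p_pos[of x] by (simp add: field_simps)
      then show ?thesis by (simp add: power2_eq_square algebra_simps)
    qed
    have i: "integrable Q (\<lambda>q. \<eta> * \<rho> s (euler s q))"
      using f_int integral_dens(2)[of "\<lambda>x. \<eta> * \<rho> s x", OF _ s(1)] integral_P(2)[of "\<lambda>x. \<eta> * \<rho> s x + \<eta> * \<eta> * (\<rho> s x)\<^sup>2"]
      by (simp add: eq)
    have "KL s \<le> (\<integral>q. \<eta> * \<rho> s (euler s q) \<partial>Q)"
      unfolding KL_def
    proof (rule integral_mono)
      fix q
      have pos: "0 < p (euler s q)" "0 < dens s (euler s q)" by (rule p_pos, rule dens_pos[OF s(1)])
      have "ln (dens s (euler s q)) - ln (p (euler s q)) = ln (dens s (euler s q) / p (euler s q))"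
        using pos by (simp add: ln_div)
      also have "\<dots> \<le> dens s (euler s q) / p (euler s q) - 1"
        using pos by (intro ln_le_minus_one divide_pos_pos)
      also have "\<dots> = \<eta> * \<rho> s (euler s q)" by (simp add: r)
      finally show "ln (dens s (euler s q)) - ln (p (euler s q)) \<le> \<eta> * \<rho> s (euler s q)" .
    qed (use i integrable_ln_dens[of s s] ln_p_int s in auto)
    also have "\<dots> = (\<integral>x. dens s x * (\<eta> * \<rho> s x) \<partial>lborel)"
      by (rule integral_dens(1)[symmetric]) (use s in auto)
    also have "\<dots> = (\<integral>x. \<eta> * \<rho> s x + \<eta> * \<eta> * (\<rho> s x)\<^sup>2 \<partial>?P)"
      unfolding eq by (rule integral_P(1)[symmetric]) measurable
    also have "\<dots> = 2 * s * (\<integral>x. (\<rho> s x)\<^sup>2 \<partial>?P)"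
      using int_\<rho>[OF s] int_\<rho>2[OF s] \<rho>0 by (simp add: \<eta>(2))
    finally show ?thesis .
  qed
  show ?thesis
    unfolding has_field_derivative_iff
  proof (rule Lim_null_comparison[OF _ lim])
    show "eventually (\<lambda>s. norm (((if s = 0 then 0 else \<integral>q. ln (dens s (euler s q)) - ln (p (euler s q)) \<partial>Q)
        - (if (0::real) = 0 then 0 else \<integral>q. ln (dens 0 (euler 0 q)) - ln (p (euler 0 q)) \<partial>Q)) / (s - 0))
       \<le> 2 * (\<integral>x. (\<rho> s x)\<^sup>2 \<partial>?P)) (at 0 within {0..})"
      using small
    proof eventually_elim
      case (elim s)
      then have "0 \<le> KL s" "KL s \<le> 2 * s * (\<integral>x. (\<rho> s x)\<^sup>2 \<partial>?P)" using KL0[of s] KL1[of s] by auto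
      then show ?case using elim by (simp add: KL_def[symmetric] field_simps)
    qed
  qed
qed

text \<open>With \<open>\<eta> = sqrt (2 s)\<close>, the increment of \<open>E f (Y + \<eta> z)\<close> is of second order in \<open>\<eta>\<close>, but only first
  derivatives are available. Averaging over \<open>z\<close> and \<open>- z\<close> and shifting \<open>y\<close> in one of the halves turns it
  into \<open>- 1/2 E ((f (Y - \<eta> z) - f Y) (p (Y - \<eta> z) / p Y - 1))\<close>, a product of two first-order increments.\<close>

lemma expectation_euler_has_derivative_at_0:
  fixes f :: "'a \<Rightarrow> real"
  assumes der: "\<And>x. (f has_derivative (\<lambda>v. d x \<bullet> v)) (at x)"
    and bound: "\<And>x. norm (d x) \<le> C * (1 + norm x) ^ m"
  shows "((\<lambda>s. \<integral>q. f (euler s q) \<partial>Q) has_real_derivative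
      - (\<integral>q. d (fst q) \<bullet> (dp (fst q) + H (fst q)) \<partial>Q)) (at 0 within {0..})"
proof -
  have d_meas [measurable]: "d \<in> borel_measurable borel" using der by (rule borel_measurable_gradient)
  have f_meas [measurable]: "f \<in> borel_measurable borel" using der by (rule borel_measurable_of_has_derivative)
  obtain C' where C': "\<And>x. \<bar>f x\<bar> \<le> C' * (1 + norm x) ^ Suc m"
    using polynomial_growth_of_gradient(2)[OF der bound] by blast
  have C0: "0 \<le> C" using order_trans[OF norm_ge_zero bound[of 0]] by simp
  obtain C1 \<delta> where C1: "0 < C1" "0 < \<delta>" and
    w1: "\<And>\<eta> x z. 0 \<le> \<eta> \<Longrightarrow> \<eta> \<le> 1 \<Longrightarrow> \<eta> < \<delta> \<Longrightarrow>
      \<bar>shift_weight \<eta> (x, z) - 1\<bar> \<le> \<eta> * (C1 * (exp (c / 4 * (norm x)\<^sup>2) * exp (1 / 8 * (norm z)\<^sup>2)))" and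
    w2: "\<And>\<eta> x z. 0 \<le> \<eta> \<Longrightarrow> \<eta> \<le> 1 \<Longrightarrow> \<eta> < \<delta> \<Longrightarrow>
      shift_weight \<eta> (x, z) \<le> C1 * (exp (c / 4 * (norm x)\<^sup>2) * exp (1 / 8 * (norm z)\<^sup>2))"
    using increment_bounds by metis
  note small = eventually_small[OF C1(2)]
  define e :: "real \<Rightarrow> real" where "e s = sqrt (2 * s)" for s
  \<comment> \<open>The drift part, compared with the pure noise step \<open>Y + \<eta> z\<close>.
    After the translation \<open>y = x - \<eta> z\<close> that step ends in \<open>x\<close>, so
    \<open>f\<close> is differentiated at a fixed point along the converging direction
    \<open>- H (x - \<eta> z)\<close>.\<close>
  define F1 where "F1 s q = shift_weight (e s) q * ((f (fst q - s *\<^sub>R H (fst q - e s *\<^sub>R snd q)) - f (fst q)) / s)" for s q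
  \<comment> \<open>The symmetrised noise part: two quotients at scale \<open>\<eta>\<close>, whose
    product carries the factor \<open>\<eta>^2 = 2 s\<close>, a genuine time increment.\<close>
  define F2 where "F2 s q = - ((f (fst q - e s *\<^sub>R snd q) - f (fst q)) / e s * ((shift_weight (e s) q - 1) / e s))" for s q
  have F_meas [measurable]: "F1 s \<in> borel_measurable Q" "F2 s \<in> borel_measurable Q" for s
    unfolding F1_def F2_def by measurable
  define b where "b x z = 1 + norm x + norm z" for x z :: 'a
  have b1: "1 \<le> b x z" for x z by (simp add: b_def)
  define E where "E x z = exp (c / 4 * (norm x)\<^sup>2) * exp (1 / 8 * (norm z)\<^sup>2)" for x z :: 'a
  define B where "B = C1 * (C * (2 + K) ^ m * (1 + K))"
  have B: "0 \<le> B" using C1 C0 K_nonneg by (simp add: B_def)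
  have f_inc: "\<bar>f (x - v) - f x\<bar> \<le> C * ((2 + K) * b x z) ^ m * norm v" if "norm v \<le> K * b x z \<or> norm v \<le> norm z" for x v z
  proof -
    have "norm v \<le> K * b x z + norm z" using that b1[of x z] K_nonneg
      by (auto simp: add_increasing add_increasing2)
    then have "1 + norm (x - v) + norm x \<le> 1 + norm x + norm x + (K * b x z + norm z)"
      using norm_triangle_ineq4[of x v] by linarith
    also have "\<dots> \<le> (2 + K) * b x z" by (simp add: b_def algebra_simps)
    finally have le: "1 + norm (x - v) + norm x \<le> (2 + K) * b x z" .
    have "\<bar>f (x - v) - f x\<bar> \<le> C * (1 + norm (x - v) + norm x) ^ m * norm ((x - v) - x)"
      by (rule polynomial_growth_of_gradient(1)[OF der bound])
    also have "\<dots> \<le> C * ((2 + K) * b x z) ^ m * norm v"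
      using le C0 K_nonneg b1[of x z] by (intro mult_mono mult_left_mono power_mono) auto
    finally show ?thesis .
  qed
  have F1_bound: "\<bar>F1 s (x, z)\<bar> \<le> B * b x z ^ Suc m * E x z"
    if s: "0 < s" "s < 1" "0 < e s" "e s \<le> 1" "e s < \<delta>" for s x z
  proof -
    have H: "norm (H (x - e s *\<^sub>R z)) \<le> K * b x z"
      using norm_shift_le(1)[of "e s" x z] s K_nonneg
      by (intro order_trans[OF H_growth] mult_left_mono) (auto simp: b_def)
    then have sH: "norm (s *\<^sub>R H (x - e s *\<^sub>R z)) \<le> s * (K * b x z)" using s by simp
    also have "\<dots> \<le> 1 * (K * b x z)" using s K_nonneg b1[of x z] by (intro mult_right_mono) auto
    finally have "\<bar>f (x - s *\<^sub>R H (x - e s *\<^sub>R z)) - f x\<bar> \<le> C * ((2 + K) * b x z) ^ m * norm (s *\<^sub>R H (x - e s *\<^sub>R z))"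
      by (intro f_inc) simp
    also have "\<dots> \<le> C * ((2 + K) * b x z) ^ m * (s * (K * b x z))"
      using C0 K_nonneg b1[of x z] by (intro mult_left_mono sH) auto
    finally have "\<bar>(f (x - s *\<^sub>R H (x - e s *\<^sub>R z)) - f x) / s\<bar> \<le> C * ((2 + K) * b x z) ^ m * (K * b x z)"
      using s by (simp add: pos_divide_le_eq mult_ac)
    also have "\<dots> \<le> C * ((2 + K) * b x z) ^ m * ((1 + K) * b x z)"
      using C0 K_nonneg b1[of x z] by (intro mult_left_mono mult_right_mono) auto
    finally have 1: "\<bar>(f (x - s *\<^sub>R H (x - e s *\<^sub>R z)) - f x) / s\<bar> \<le> C * ((2 + K) * b x z) ^ m * ((1 + K) * b x z)" .
    have "\<bar>F1 s (x, z)\<bar> = shift_weight (e s) (x, z) * \<bar>(f (x - s *\<^sub>R H (x - e s *\<^sub>R z)) - f x) / s\<bar>"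
      by (simp add: F1_def abs_mult shift_weight_def)
    also have "\<dots> \<le> (C1 * E x z) * (C * ((2 + K) * b x z) ^ m * ((1 + K) * b x z))"
      using w2[of "e s" x z] s 1 C1 by (intro mult_mono) (auto simp: E_def)
    finally show ?thesis by (simp add: B_def power_mult_distrib mult_ac)
  qed
  have F2_bound: "\<bar>F2 s (x, z)\<bar> \<le> B * b x z ^ Suc m * E x z"
    if s: "0 < s" "s < 1" "0 < e s" "e s \<le> 1" "e s < \<delta>" for s x z
  proof -
    have "\<bar>f (x - e s *\<^sub>R z) - f x\<bar> \<le> C * ((2 + K) * b x z) ^ m * norm (e s *\<^sub>R z)"
      using s mult_right_mono[of "e s" 1 "norm z"] by (intro f_inc) auto
    then have "\<bar>(f (x - e s *\<^sub>R z) - f x) / e s\<bar> \<le> C * ((2 + K) * b x z) ^ m * norm z"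
      using s by (simp add: pos_divide_le_eq mult_ac)
    also have "\<dots> \<le> C * ((2 + K) * b x z) ^ m * ((1 + K) * b x z)"
    proof -
      have "norm z \<le> 1 * b x z" by (simp add: b_def)
      also have "\<dots> \<le> (1 + K) * b x z" using K_nonneg b1[of x z] by (intro mult_right_mono) auto
      finally show ?thesis using C0 K_nonneg b1[of x z] by (intro mult_left_mono) auto
    qed
    finally have 1: "\<bar>(f (x - e s *\<^sub>R z) - f x) / e s\<bar> \<le> C * ((2 + K) * b x z) ^ m * ((1 + K) * b x z)" .
    have 2: "\<bar>(shift_weight (e s) (x, z) - 1) / e s\<bar> \<le> C1 * E x z"
      using w1[of "e s" x z] s by (simp add: E_def pos_divide_le_eq mult_ac)
    have "\<bar>F2 s (x, z)\<bar> = \<bar>(f (x - e s *\<^sub>R z) - f x) / e s\<bar> * \<bar>(shift_weight (e s) (x, z) - 1) / e s\<bar>"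
      by (simp add: F2_def abs_mult)
    also have "\<dots> \<le> (C * ((2 + K) * b x z) ^ m * ((1 + K) * b x z)) * (C1 * E x z)"
      using 1 2 C0 K_nonneg b1[of x z] by (intro mult_mono) auto
    finally show ?thesis by (simp add: B_def power_mult_distrib mult_ac)
  qed
  define g where "g q = B * b (fst q) (snd q) ^ Suc m * E (fst q) (snd q)" for q
  have g_meas [measurable]: "g \<in> borel_measurable Q" unfolding g_def b_def E_def by measurable
  have bE_int: "integrable Q F" if "F \<in> borel_measurable Q" "\<And>x z. \<bar>F (x, z)\<bar> \<le> B * b x z ^ Suc m * E x z" for F
    by (rule integrable_Q_exp_poly[where C=B and m="Suc m", OF that(1) that(2)[unfolded b_def E_def]])
  have g_int: "integrable Q g"
  proof (rule bE_int)
    fix x z :: 'a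
    have "0 \<le> B * b x z ^ Suc m * E x z"
      using B order_trans[OF zero_le_one b1[of x z]] by (intro mult_nonneg_nonneg zero_le_power) (auto simp: E_def)
    then show "\<bar>g (x, z)\<bar> \<le> B * b x z ^ Suc m * E x z" by (simp add: g_def)
  qed measurable
  have F_int: "integrable Q (F1 s)" "integrable Q (F2 s)"
    if s: "0 < s" "s < 1" "0 < e s" "e s \<le> 1" "e s < \<delta>" for s
    using bE_int[OF F_meas(1) F1_bound[OF s]] bE_int[OF F_meas(2) F2_bound[OF s]] by auto
  have e_lim: "(e \<longlongrightarrow> 0) (at 0 within {0..})" unfolding e_def by (rule sqrt_at_0)
  have e_pos: "eventually (\<lambda>s. 0 < e s) (at 0 within {0..})"
    using small by eventually_elim (simp add: e_def)
  have s_pos: "eventually (\<lambda>s. 0 < s) (at (0::real) within {0..})"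
    using small by eventually_elim simp
  have lnp0: "((\<lambda>s. ln (p (x - e s *\<^sub>R z)) - ln (p x)) \<longlongrightarrow> 0) (at 0 within {0..})" for x z
  proof (rule Lim_transform_eventually)
    show "((\<lambda>s. (ln (p (x - e s *\<^sub>R z)) - ln (p x)) / e s * e s) \<longlongrightarrow> 0) (at 0 within {0..})"
      using tendsto_mult[OF ln_p_quotient_tendsto[folded e_def] e_lim] by simp
    show "eventually (\<lambda>s. (ln (p (x - e s *\<^sub>R z)) - ln (p x)) / e s * e s = ln (p (x - e s *\<^sub>R z)) - ln (p x)) (at 0 within {0..})"
      using e_pos by eventually_elim simp
  qed
  have F1_lim: "((\<lambda>s. F1 s q) \<longlongrightarrow> - (d (fst q) \<bullet> H (fst q))) (at 0 within {0..})" for q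
  proof -
    obtain x z where q: "q = (x, z)" by (cases q)
    have "((\<lambda>s. shift_weight (e s) (x, z)) \<longlongrightarrow> exp 0) (at 0 within {0..})"
      unfolding shift_weight_def fst_conv snd_conv by (intro tendsto_exp lnp0)
    moreover have "((\<lambda>s. (f (x + s *\<^sub>R (- H (x - e s *\<^sub>R z))) - f x) / s) \<longlongrightarrow> d x \<bullet> (- H x)) (at 0 within {0..})"
      using tendsto_ident_at[of 0 "{0..}"]
      by (rule directional_limit[OF der tendsto_minus[OF H_shift_tendsto[folded e_def]] _ s_pos])
    ultimately have "((\<lambda>s. shift_weight (e s) (x, z) * ((f (x + s *\<^sub>R (- H (x - e s *\<^sub>R z))) - f x) / s)) \<longlongrightarrow> exp 0 * (d x \<bullet> (- H x))) (at 0 within {0..})"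
      by (rule tendsto_mult)
    then show ?thesis by (simp add: F1_def q)
  qed
  have F2_lim: "((\<lambda>s. F2 s q) \<longlongrightarrow> - ((d (fst q) \<bullet> snd q) * (dp (fst q) \<bullet> snd q))) (at 0 within {0..})" for q
  proof -
    obtain x z where q: "q = (x, z)" by (cases q)
    have 1: "((\<lambda>s. (shift_weight (e s) (x, z) - 1) / e s) \<longlongrightarrow> - (dp x \<bullet> z)) (at 0 within {0..})"
      unfolding shift_weight_def fst_conv snd_conv by (rule tendsto_expm1_quotient[OF lnp0 ln_p_quotient_tendsto[folded e_def]])
    have 2: "((\<lambda>s. (f (x + e s *\<^sub>R (- z)) - f x) / e s) \<longlongrightarrow> d x \<bullet> (- z)) (at 0 within {0..})"
      by (rule directional_limit[OF der tendsto_const e_lim e_pos])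
    from tendsto_minus[OF tendsto_mult[OF 2 1]] show ?thesis by (simp add: F2_def q)
  qed
  have lim1: "((\<lambda>s. \<integral>q. F1 s q \<partial>Q) \<longlongrightarrow> (\<integral>q. - (d (fst q) \<bullet> H (fst q)) \<partial>Q)) (at 0 within {0..})"
  proof (rule tendsto_integral_dominated[OF _ _ _ F1_lim g_int])
    show "eventually (\<lambda>s. \<forall>q\<in>space Q. \<bar>F1 s q\<bar> \<le> g q) (at 0 within {0..})"
      using small by eventually_elim (use F1_bound in \<open>auto simp: g_def e_def\<close>)
  qed auto
  have lim2: "((\<lambda>s. \<integral>q. F2 s q \<partial>Q) \<longlongrightarrow> (\<integral>q. - ((d (fst q) \<bullet> snd q) * (dp (fst q) \<bullet> snd q)) \<partial>Q)) (at 0 within {0..})"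
  proof (rule tendsto_integral_dominated[OF _ _ _ F2_lim g_int])
    show "eventually (\<lambda>s. \<forall>q\<in>space Q. \<bar>F2 s q\<bar> \<le> g q) (at 0 within {0..})"
      using small by eventually_elim (use F2_bound in \<open>auto simp: g_def e_def\<close>)
  qed auto
  have d_le: "norm (d x) \<le> C * b x z ^ m" for x z
    using C0 by (intro order_trans[OF bound] mult_left_mono power_mono) (auto simp: b_def)
  have dp_le: "norm (dp x) \<le> L0 * b x z" for x z
    using L0_nonneg by (intro order_trans[OF dp_bound] mult_left_mono) (auto simp: b_def)
  have H_le: "norm (H x) \<le> K * b x z" for x z
    using K_nonneg by (intro order_trans[OF H_growth] mult_left_mono) (auto simp: b_def)
  have z_le: "norm z \<le> b x z" for x z by (simp add: b_def)
  have i_dz: "integrable Q (\<lambda>q. (d (fst q) \<bullet> snd q) * (dp (fst q) \<bullet> snd q))"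
  proof (rule integrable_Q_poly)
    fix x z :: 'a
    have "\<bar>(d x \<bullet> z) * (dp x \<bullet> z)\<bar> \<le> ((C * b x z ^ m) * b x z) * ((L0 * b x z) * b x z)"
      unfolding abs_mult using C0 L0_nonneg b1[of x z]
      by (intro mult_mono order_trans[OF Cauchy_Schwarz_ineq2] d_le dp_le z_le) auto
    then show "\<bar>(d (fst (x, z)) \<bullet> snd (x, z)) * (dp (fst (x, z)) \<bullet> snd (x, z))\<bar> \<le> (C * L0) * (1 + norm x + norm z) ^ (m + 3)"
      by (simp add: b_def[symmetric] power_add power3_eq_cube mult_ac)
  qed measurable
  have i_dd: "integrable Q (\<lambda>q. d (fst q) \<bullet> dp (fst q))" "integrable Q (\<lambda>q. d (fst q) \<bullet> H (fst q))"
  proof -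
    have 1: "\<bar>d x \<bullet> v\<bar> \<le> (C * b x z ^ m) * (k * b x z)" if "norm v \<le> k * b x z" for x z v k
      using C0 b1[of x z] that by (intro order_trans[OF Cauchy_Schwarz_ineq2] mult_mono d_le) auto
    show "integrable Q (\<lambda>q. d (fst q) \<bullet> dp (fst q))"
      by (rule integrable_Q_poly[where C="C * L0" and m="Suc m"])
         (use 1[OF dp_le] in \<open>auto simp: b_def[symmetric] mult_ac\<close>)
    show "integrable Q (\<lambda>q. d (fst q) \<bullet> H (fst q))"
      by (rule integrable_Q_poly[where C="C * K" and m="Suc m"])
         (use 1[OF H_le] in \<open>auto simp: b_def[symmetric] mult_ac\<close>)
  qed
  \<comment> \<open>The identity covariance of the noise turns the product of directional
    derivatives into \<open>d \<bullet> dp\<close>. This is where the initial score appears.\<close>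
  have cov: "(\<integral>q. (d (fst q) \<bullet> snd q) * (dp (fst q) \<bullet> snd q) \<partial>Q) = (\<integral>q. d (fst q) \<bullet> dp (fst q) \<partial>Q)"
    using PG.integral_fst'[OF i_dz] PG.integral_fst'[OF i_dd(1)] G.prob_space by (simp add: std_gaussian_covariance)
  have "((\<lambda>s. (\<integral>q. F1 s q \<partial>Q) + (\<integral>q. F2 s q \<partial>Q)) \<longlongrightarrow>
      (\<integral>q. - (d (fst q) \<bullet> H (fst q)) \<partial>Q) + (\<integral>q. - ((d (fst q) \<bullet> snd q) * (dp (fst q) \<bullet> snd q)) \<partial>Q)) (at 0 within {0..})"
    by (rule tendsto_add[OF lim1 lim2])
  also have "(\<integral>q. - (d (fst q) \<bullet> H (fst q)) \<partial>Q) + (\<integral>q. - ((d (fst q) \<bullet> snd q) * (dp (fst q) \<bullet> snd q)) \<partial>Q)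
     = - (\<integral>q. d (fst q) \<bullet> (dp (fst q) + H (fst q)) \<partial>Q)"
    using i_dd by (simp add: cov inner_add_right)
  finally have lim: "((\<lambda>s. (\<integral>q. F1 s q \<partial>Q) + (\<integral>q. F2 s q \<partial>Q)) \<longlongrightarrow>
     - (\<integral>q. d (fst q) \<bullet> (dp (fst q) + H (fst q)) \<partial>Q)) (at 0 within {0..})" .
  show ?thesis
    unfolding has_field_derivative_iff
  proof (rule Lim_transform_eventually[OF lim])
    show "eventually (\<lambda>s. (\<integral>q. F1 s q \<partial>Q) + (\<integral>q. F2 s q \<partial>Q)
       = ((\<integral>q. f (euler s q) \<partial>Q) - (\<integral>q. f (euler 0 q) \<partial>Q)) / (s - 0)) (at 0 within {0..})"
      using small
    proof eventually_elim
      case (elim s)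
      then have s: "0 < s" "s < 1" "0 < e s" "e s \<le> 1" "e s < \<delta>" by (auto simp: e_def)
      have ee: "e s * e s = 2 * s" using s(1) by (simp add: e_def)
      have i0: "integrable Q (\<lambda>q. f (fst q + \<epsilon> *\<^sub>R snd q))" if "\<bar>\<epsilon>\<bar> \<le> 1" for \<epsilon>
      proof (rule integrable_Q_poly)
        fix x z :: 'a
        have "0 \<le> C'" using order_trans[OF abs_ge_zero C'[of 0]] by simp
        then have "C' * (1 + norm (x + \<epsilon> *\<^sub>R z)) ^ Suc m \<le> C' * (1 + norm x + norm z) ^ Suc m"
          using norm_shift_le(2)[OF that, of x z] by (intro mult_left_mono power_mono) auto
        then show "\<bar>f (fst (x, z) + \<epsilon> *\<^sub>R snd (x, z))\<bar> \<le> C' * (1 + norm x + norm z) ^ Suc m"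
          using C'[of "x + \<epsilon> *\<^sub>R z"] by simp
      qed measurable
      have ip: "integrable Q (\<lambda>q. f (fst q + e s *\<^sub>R snd q))" using s by (intro i0) auto
      have im: "integrable Q (\<lambda>q. f (fst q - e s *\<^sub>R snd q))" using i0[of "- e s"] s by simp
      have i00: "integrable Q (\<lambda>q. f (fst q))" using i0[of 0] by simp
      have ie: "integrable Q (\<lambda>q. f (euler s q))"
        using s by (intro integrable_compose_euler[OF f_meas _ C']) auto
      have fst1: "(\<integral>q. f (euler s q) - f (fst q + e s *\<^sub>R snd q) \<partial>Q) = s * (\<integral>q. F1 s q \<partial>Q)"
      proof -
        have "(\<integral>q. f (euler s q) - f (fst q + e s *\<^sub>R snd q) \<partial>Q)
           = (\<integral>q. shift_weight (e s) q * (f (fst q - e s *\<^sub>R snd q - s *\<^sub>R H (fst q - e s *\<^sub>R snd q) + e s *\<^sub>R snd q) - f (fst q - e s *\<^sub>R snd q + e s *\<^sub>R snd q)) \<partial>Q)"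
          using integral_shift(1)[of "\<lambda>q. f (euler s q) - f (fst q + e s *\<^sub>R snd q)" "e s"]
          by (simp add: euler_def e_def)
        also have "\<dots> = (\<integral>q. s * F1 s q \<partial>Q)"
        proof (intro Bochner_Integration.integral_cong refl)
          fix q :: "'a \<times> 'a"
          define v where "v = H (fst q - e s *\<^sub>R snd q)"
          have "fst q - e s *\<^sub>R snd q - s *\<^sub>R v + e s *\<^sub>R snd q = fst q - s *\<^sub>R v"
            by (simp add: algebra_simps)
          then show "shift_weight (e s) q * (f (fst q - e s *\<^sub>R snd q - s *\<^sub>R H (fst q - e s *\<^sub>R snd q) + e s *\<^sub>R snd q)
              - f (fst q - e s *\<^sub>R snd q + e s *\<^sub>R snd q)) = s * F1 s q"
            using s(1) by (simp add: F1_def v_def)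
        qed
        finally show ?thesis by simp
      qed
      define A where "A = (\<integral>q. f (fst q + e s *\<^sub>R snd q) - f (fst q) \<partial>Q)"
      have A1: "A = (\<integral>q. f (fst q - e s *\<^sub>R snd q) - f (fst q) \<partial>Q)"
        using integral_reflect[of "\<lambda>q. f (fst q + e s *\<^sub>R snd q) - f (fst q)"] ip im i00 by (simp add: A_def)
      have A2: "A = (\<integral>q. shift_weight (e s) q * (f (fst q) - f (fst q - e s *\<^sub>R snd q)) \<partial>Q)"
        and i2: "integrable Q (\<lambda>q. shift_weight (e s) q * (f (fst q) - f (fst q - e s *\<^sub>R snd q)))"
        using integral_shift[of "\<lambda>q. f (fst q + e s *\<^sub>R snd q) - f (fst q)" "e s"] ip i00 by (auto simp: A_def)
      \<comment> \<open>The reflected form contributes the increment of \<open>f\<close>, the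
        translated form minus that increment times the weight. Their sum is the increment times
        \<open>1\<close> minus the weight, which is \<open>\<eta>^2\<close> times
        \<open>F2\<close>.\<close>
      have "2 * A = (\<integral>q. (f (fst q - e s *\<^sub>R snd q) - f (fst q)) + shift_weight (e s) q * (f (fst q) - f (fst q - e s *\<^sub>R snd q)) \<partial>Q)"
        using A1 A2 i2 im i00 by simp
      also have "\<dots> = (\<integral>q. (e s * e s) * F2 s q \<partial>Q)"
        using s(3) by (intro Bochner_Integration.integral_cong refl) (simp add: F2_def field_simps)
      finally have "A = s * (\<integral>q. F2 s q \<partial>Q)" by (simp add: ee)
      moreover have "(\<integral>q. f (euler s q) \<partial>Q) - (\<integral>q. f (euler 0 q) \<partial>Q) = (\<integral>q. f (euler s q) - f (fst q + e s *\<^sub>R snd q) \<partial>Q) + A"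
        using ie ip i00 by (simp add: A_def euler_def)
      ultimately show ?case using fst1 s(1) by (simp add: field_simps)
    qed
  qed
qed

end

section \<open>Entropy dissipation\<close>

context euler_density
begin

text \<open>At \<open>s = 0\<close> the kernel divides by zero and \<open>dens 0\<close> is the zero
  function, so the initial density has to be inserted by hand.\<close>

definition law :: "real \<Rightarrow> 'a \<Rightarrow> real" where
  "law s = (if s = 0 then p else dens s)"

definition grad_ln_law :: "real \<Rightarrow> 'a \<Rightarrow> 'a" where
  "grad_ln_law s x = (if s = 0 then dp x else grad_dens s x /\<^sub>R dens s x)"

lemma law_pos: "0 \<le> s \<Longrightarrow> 0 < law s x"
  by (simp add: law_def p_pos dens_pos)

lemma law_measurable [measurable]: "law s \<in> borel_measurable borel"
  by (simp add: law_def)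

lemma ln_law_has_derivative:
  "0 \<le> s \<Longrightarrow> ((\<lambda>x. ln (law s x)) has_derivative (\<lambda>v. grad_ln_law s x \<bullet> v)) (at x)"
  unfolding law_def grad_ln_law_def using ln_p_der ln_dens_has_derivative[of s x] by auto

lemma grad_ln_law_bound:
  assumes "0 \<le> s"
  shows "\<exists>C. \<forall>x. norm (grad_ln_law s x) \<le> C * (1 + norm x)"
proof (cases "s = 0")
  case True
  then show ?thesis using dp_bound by (auto simp: grad_ln_law_def)
next
  case False
  then have s: "0 < s" using assms by simp
  obtain C where C: "\<And>x. norm (grad_dens s x) \<le> C * (1 + norm x) * dens s x"
    using grad_dens_bound[OF s] by blast
  have "norm (grad_ln_law s x) \<le> C * (1 + norm x)" for x
    using C[of x] dens_pos[OF s, of x] s by (simp add: grad_ln_law_def field_simps)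
  then show ?thesis by blast
qed

lemma ln_law_bound:
  assumes "0 \<le> s"
  shows "\<exists>C. \<forall>x. \<bar>ln (law s x)\<bar> \<le> C * (1 + norm x) ^ 2"
  using ln_p_bound ln_dens_bound[of s] assms by (cases "s = 0") (auto simp: law_def)

lemma distr_law:
  assumes "0 \<le> s"
  shows "distr Q borel (euler s) = density lborel (law s)"
proof (cases "s = 0")
  case True
  have "distr Q borel (euler 0) = distr Q (density lborel p) fst"
    by (rule distr_cong) (auto simp: euler_def)
  also have "\<dots> = density lborel p" by (rule G.distr_pair_fst)
  finally show ?thesis using True by (simp add: law_def)
next
  case False
  then show ?thesis using assms distr_euler[of s] by (simp add: law_def)
qed

lemma integral_law:
  fixes f :: "'a \<Rightarrow> real"
  assumes [measurable]: "f \<in> borel_measurable borel" and s: "0 \<le> s"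
  shows "(\<integral>x. law s x * f x \<partial>lborel) = (\<integral>q. f (euler s q) \<partial>Q)"
proof -
  have "(\<integral>q. f (euler s q) \<partial>Q) = (\<integral>x. f x \<partial>density lborel (law s))"
    by (subst distr_law[OF s, symmetric]) (simp add: integral_distr)
  also have "\<dots> = (\<integral>x. law s x * f x \<partial>lborel)"
    using law_pos[OF s] by (subst integral_density) (auto intro: less_imp_le)
  finally show ?thesis by simp
qed

lemma KL_law_has_derivative_0:
  assumes "0 \<le> t"
  shows "((\<lambda>s. \<integral>q. ln (law s (euler s q)) - ln (law t (euler s q)) \<partial>Q) has_real_derivative 0) (at t within {0..})"
proof (cases "t = 0")
  case True
  have "(\<lambda>s. \<integral>q. ln (law s (euler s q)) - ln (law 0 (euler s q)) \<partial>Q)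
      = (\<lambda>s. if s = 0 then 0 else \<integral>q. ln (dens s (euler s q)) - ln (p (euler s q)) \<partial>Q)"
    by (rule ext) (simp add: law_def)
  then show ?thesis using KL_dens_has_derivative_0_at_0 True by simp
next
  case False
  then have t: "0 < t" using assms by simp
  show ?thesis
  proof (rule has_field_derivative_transform_within)
    show "((\<lambda>s. \<integral>q. ln (dens s (euler s q)) - ln (dens t (euler s q)) \<partial>Q) has_real_derivative 0) (at t within {0..})"
      using KL_dens_has_derivative_0[OF t] by (rule has_field_derivative_at_within)
    show "(\<integral>q. ln (dens s (euler s q)) - ln (dens t (euler s q)) \<partial>Q) = (\<integral>q. ln (law s (euler s q)) - ln (law t (euler s q)) \<partial>Q)"
      if "s \<in> {0..}" "dist s t < t" for s
      using that t by (auto simp: law_def dist_real_def)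
  qed (use t in auto)
qed

text \<open>One formula for both regimes: at \<open>t > 0\<close> the noise term of the pathwise
  derivative is exchanged for the score by \<open>expectation_gradient_noise\<close>; at
  \<open>t = 0\<close> the new position is the old one and the score is \<open>dp\<close>.\<close>

lemma expectation_law_has_derivative:
  fixes f :: "'a \<Rightarrow> real"
  assumes der: "\<And>x. (f has_derivative (\<lambda>v. d x \<bullet> v)) (at x)"
    and bound: "\<And>x. norm (d x) \<le> C * (1 + norm x) ^ m"
    and t: "0 \<le> t"
  shows "((\<lambda>s. \<integral>q. f (euler s q) \<partial>Q) has_real_derivative
      - (\<integral>q. d (euler t q) \<bullet> (grad_ln_law t (euler t q) + H (fst q)) \<partial>Q)) (at t within {0..})"
proof (cases "t = 0")
  case True
  then show ?thesis
    using expectation_euler_has_derivative_at_0[OF der bound] by (simp add: euler_def grad_ln_law_def)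
next
  case False
  then have t: "0 < t" using assms by simp
  have [measurable]: "d \<in> borel_measurable borel" using der by (rule borel_measurable_gradient)
  have C0: "0 \<le> C" using order_trans[OF norm_ge_zero bound[of 0]] by simp
  have gm [measurable]: "grad_ln_law t \<in> borel_measurable borel"
    using ln_law_has_derivative t by (intro borel_measurable_gradient[where f="\<lambda>x. ln (law t x)"]) auto
  obtain Cg where Cg: "\<And>x. norm (grad_ln_law t x) \<le> Cg * (1 + norm x)"
    using grad_ln_law_bound[of t] t by auto
  have Cg0: "0 \<le> Cg" using order_trans[OF norm_ge_zero Cg[of 0]] by simp
  have ig: "integrable Q (\<lambda>q. d (euler t q) \<bullet> grad_ln_law t (euler t q))"
  proof (rule integrable_compose_euler[where f="\<lambda>x. d x \<bullet> grad_ln_law t x"])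
    fix x
    have "\<bar>d x \<bullet> grad_ln_law t x\<bar> \<le> (C * (1 + norm x) ^ m) * (Cg * (1 + norm x))"
      using C0 Cg0 by (intro order_trans[OF Cauchy_Schwarz_ineq2] mult_mono bound Cg) auto
    then show "\<bar>d x \<bullet> grad_ln_law t x\<bar> \<le> (C * Cg) * (1 + norm x) ^ Suc m" by (simp add: mult_ac)
  qed (use t in auto)
  have iH: "integrable Q (\<lambda>q. d (euler t q) \<bullet> H (fst q))"
  proof (rule integrable_euler_poly[where s=t and m=m and n=1 and C="C * K"])
    fix y z :: 'a
    have "norm (H y) \<le> K * (1 + norm y + norm z)"
      using K_nonneg by (intro order_trans[OF H_growth] mult_left_mono) auto
    then have "\<bar>d (euler t (y, z)) \<bullet> H y\<bar> \<le> (C * (1 + norm (euler t (y, z))) ^ m) * (K * (1 + norm y + norm z))"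
      using C0 by (intro order_trans[OF Cauchy_Schwarz_ineq2] mult_mono bound) auto
    then show "\<bar>d (euler t (y, z)) \<bullet> H (fst (y, z))\<bar> \<le> C * K * (1 + norm (euler t (y, z))) ^ m * (1 + norm y + norm z) ^ 1"
      by (simp add: mult_ac)
  qed (use t in auto)
  have "(\<integral>q. d (euler t q) \<bullet> ((sqrt (2 * t) / (2 * t)) *\<^sub>R snd q - H (fst q)) \<partial>Q)
     = (\<integral>q. d (euler t q) \<bullet> ((sqrt (2 * t) / (2 * t)) *\<^sub>R snd q) - d (euler t q) \<bullet> H (fst q) \<partial>Q)"
    by (simp only: inner_diff_right)
  also have "\<dots> = (\<integral>q. d (euler t q) \<bullet> ((sqrt (2 * t) / (2 * t)) *\<^sub>R snd q) \<partial>Q) - (\<integral>q. d (euler t q) \<bullet> H (fst q) \<partial>Q)"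
    by (rule Bochner_Integration.integral_diff[OF expectation_gradient_noise(2)[OF _ bound t] iH]) measurable
  also have "(\<integral>q. d (euler t q) \<bullet> ((sqrt (2 * t) / (2 * t)) *\<^sub>R snd q) \<partial>Q)
      = - (\<integral>q. d (euler t q) \<bullet> grad_ln_law t (euler t q) \<partial>Q)"
    using t by (subst expectation_gradient_noise(1)[OF _ bound t]) (auto simp: grad_ln_law_def)
  also have "- (\<integral>q. d (euler t q) \<bullet> grad_ln_law t (euler t q) \<partial>Q) - (\<integral>q. d (euler t q) \<bullet> H (fst q) \<partial>Q)
     = - (\<integral>q. d (euler t q) \<bullet> (grad_ln_law t (euler t q) + H (fst q)) \<partial>Q)"
    using ig iH by (simp add: inner_add_right)
  finally show ?thesis
    using has_field_derivative_at_within[OF expectation_euler_has_derivative[OF der bound t], of "{0..}"] by simp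
qed

text \<open>With \<open>U = u + ln Z\<close>, where \<open>Z\<close> is the normalising constant,
  the differentiated functional is the relative entropy with respect to the Gibbs measure, and
  \<open>grad_ln_law t + h\<close> is the gradient of the relative log-density.\<close>

lemma entropy_dissipation:
  fixes U :: "'a \<Rightarrow> real" and h :: "'a \<Rightarrow> 'a"
  assumes U_der: "\<And>x. (U has_derivative (\<lambda>v. h x \<bullet> v)) (at x)"
    and h_bound: "\<And>x. norm (h x) \<le> Ch * (1 + norm x) ^ m"
    and t: "0 \<le> t"
  obtains D where
    "((\<lambda>s. \<integral>x. law s x * (ln (law s x) + U x) \<partial>lborel) has_real_derivative D) (at t within {0..})"
    "integrable Q (\<lambda>q. (norm (grad_ln_law t (euler t q) + h (euler t q)))\<^sup>2)"
    "integrable Q (\<lambda>q. (norm (h (euler t q) - H (fst q)))\<^sup>2)"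
    "D \<le> - (3/4) * (\<integral>q. (norm (grad_ln_law t (euler t q) + h (euler t q)))\<^sup>2 \<partial>Q)
       + (\<integral>q. (norm (h (euler t q) - H (fst q)))\<^sup>2 \<partial>Q)"
proof -
  define d where "d x = grad_ln_law t x + h x" for x
  define f where "f x = ln (law t x) + U x" for x
  have [measurable]: "h \<in> borel_measurable borel" using U_der by (rule borel_measurable_gradient)
  have [measurable]: "U \<in> borel_measurable borel" using U_der by (rule borel_measurable_of_has_derivative)
  have [measurable]: "grad_ln_law t \<in> borel_measurable borel"
    by (rule borel_measurable_gradient[OF ln_law_has_derivative[OF t]])
  have [measurable]: "d \<in> borel_measurable borel" unfolding d_def by measurable
  have Ch0: "0 \<le> Ch" using order_trans[OF norm_ge_zero h_bound[of 0]] by simp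
  obtain Cg where Cg: "\<And>x. norm (grad_ln_law t x) \<le> Cg * (1 + norm x)"
    using grad_ln_law_bound[OF t] by auto
  have Cg0: "0 \<le> Cg" using order_trans[OF norm_ge_zero Cg[of 0]] by simp
  obtain CU where CU: "\<And>x. \<bar>U x\<bar> \<le> CU * (1 + norm x) ^ Suc m"
    using polynomial_growth_of_gradient(2)[OF U_der h_bound] by blast
  have f_der: "(f has_derivative (\<lambda>v. d x \<bullet> v)) (at x)" for x
    using has_derivative_add[OF ln_law_has_derivative[OF t, of x] U_der[of x]]
    by (simp add: f_def[abs_def] d_def inner_add_left)
  \<comment> \<open>The exponent \<open>Suc m\<close> dominates the growth of \<open>h\<close> and
    the linear growth of the score at once, also when \<open>m = 0\<close>.\<close>
  have d_bound: "norm (d x) \<le> (Cg + Ch) * (1 + norm x) ^ Suc m" for x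
  proof -
    have "norm (d x) \<le> Cg * (1 + norm x) ^ 1 + Ch * (1 + norm x) ^ m"
      unfolding d_def using norm_triangle_mono[OF Cg h_bound] by simp
    also have "\<dots> \<le> Cg * (1 + norm x) ^ Suc m + Ch * (1 + norm x) ^ Suc m"
      using Cg0 Ch0 by (intro add_mono mult_left_mono power_increasing) auto
    finally show ?thesis by (simp only: distrib_right)
  qed
  have gap_bound: "norm (h (euler t (y, z)) - H y) \<le> (Ch + K) * (1 + norm (euler t (y, z))) ^ m * (1 + norm y + norm z)" for y z
  proof -
    have one: "1 \<le> (1 + norm (euler t (y, z))) ^ m" by (rule one_le_power) simp
    have "norm (h (euler t (y, z)) - H y) \<le> Ch * (1 + norm (euler t (y, z))) ^ m + K * (1 + norm y)"
      by (intro order_trans[OF norm_triangle_ineq4] add_mono h_bound H_growth)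
    also have "\<dots> \<le> Ch * (1 + norm (euler t (y, z))) ^ m * (1 + norm y + norm z)
        + K * ((1 + norm (euler t (y, z))) ^ m * (1 + norm y + norm z))"
    proof (rule add_mono)
      show "Ch * (1 + norm (euler t (y, z))) ^ m \<le> Ch * (1 + norm (euler t (y, z))) ^ m * (1 + norm y + norm z)"
        using Ch0 one mult_left_mono[of 1 "1 + norm y + norm z" "Ch * (1 + norm (euler t (y, z))) ^ m"] by simp
      have "1 * (1 + norm y) \<le> (1 + norm (euler t (y, z))) ^ m * (1 + norm y + norm z)"
        using one by (intro mult_mono) auto
      then show "K * (1 + norm y) \<le> K * ((1 + norm (euler t (y, z))) ^ m * (1 + norm y + norm z))"
        using K_nonneg by (intro mult_left_mono) auto
    qed
    finally show ?thesis by (simp add: algebra_simps)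
  qed
  have i_d: "integrable Q (\<lambda>q. (norm (d (euler t q)))\<^sup>2)"
  proof (rule integrable_compose_euler[where f="\<lambda>x. (norm (d x))\<^sup>2"])
    show "\<bar>(norm (d x))\<^sup>2\<bar> \<le> (Cg + Ch)\<^sup>2 * (1 + norm x) ^ (Suc m * 2)" for x
      using power_mono[OF d_bound[of x] norm_ge_zero, of 2]
      by (simp only: power_mult_distrib power_mult abs_power2)
  qed (use t in auto)
  have i_gap: "integrable Q (\<lambda>q. (norm (h (euler t q) - H (fst q)))\<^sup>2)"
  proof (rule integrable_euler_poly[where s=t and m="m * 2" and n=2 and C="(Ch + K)\<^sup>2"])
    show "\<bar>(norm (h (euler t (y, z)) - H (fst (y, z))))\<^sup>2\<bar>
      \<le> (Ch + K)\<^sup>2 * (1 + norm (euler t (y, z))) ^ (m * 2) * (1 + norm y + norm z)\<^sup>2" for y z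
      using power_mono[OF gap_bound[of y z] norm_ge_zero, of 2]
      by (simp only: power_mult_distrib power_mult abs_power2 fst_conv)
  qed (use t in auto)
  have i_cross: "integrable Q (\<lambda>q. d (euler t q) \<bullet> (h (euler t q) - H (fst q)))"
  proof (rule Bochner_Integration.integrable_bound[OF Bochner_Integration.integrable_add[OF i_d i_gap]])
    have "\<bar>a \<bullet> b\<bar> \<le> (norm a)\<^sup>2 + (norm b)\<^sup>2" for a b :: 'a
      using Cauchy_Schwarz_ineq2[of a b] sum_squares_bound[of "norm a" "norm b"]
        mult_nonneg_nonneg[OF norm_ge_zero[of a] norm_ge_zero[of b]] by linarith
    then show "AE q in Q. norm (d (euler t q) \<bullet> (h (euler t q) - H (fst q)))
        \<le> norm ((norm (d (euler t q)))\<^sup>2 + (norm (h (euler t q) - H (fst q)))\<^sup>2)"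
      by (intro AE_I2) simp
  qed measurable
  define D where "D = (\<integral>q. d (euler t q) \<bullet> (h (euler t q) - H (fst q)) - (norm (d (euler t q)))\<^sup>2 \<partial>Q)"
  have "- (\<integral>q. d (euler t q) \<bullet> (grad_ln_law t (euler t q) + H (fst q)) \<partial>Q)
     = (\<integral>q. - (d (euler t q) \<bullet> (grad_ln_law t (euler t q) + H (fst q))) \<partial>Q)"
    by simp
  also have "\<dots> = D"
    unfolding D_def
  proof (intro Bochner_Integration.integral_cong refl)
    fix q
    \<comment> \<open>Adding and subtracting \<open>h\<close> splits off the relative score
      \<open>d\<close>: one part produces the Fisher information, the other the discretisation
      error.\<close>
    have "grad_ln_law t (euler t q) + H (fst q) = d (euler t q) - (h (euler t q) - H (fst q))"
      by (simp add: d_def)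
    then show "- (d (euler t q) \<bullet> (grad_ln_law t (euler t q) + H (fst q)))
       = d (euler t q) \<bullet> (h (euler t q) - H (fst q)) - (norm (d (euler t q)))\<^sup>2"
      by (simp only: inner_diff_right power2_norm_eq_inner)
  qed
  finally have D: "- (\<integral>q. d (euler t q) \<bullet> (grad_ln_law t (euler t q) + H (fst q)) \<partial>Q) = D" .
  from DERIV_add[OF expectation_law_has_derivative[OF f_der d_bound t, unfolded D] KL_law_has_derivative_0[OF t]]
  have sum_der: "((\<lambda>s. (\<integral>q. f (euler s q) \<partial>Q) + (\<integral>q. ln (law s (euler s q)) - ln (law t (euler s q)) \<partial>Q))
      has_real_derivative D) (at t within {0..})" by simp
  have eq: "(\<integral>q. f (euler s q) \<partial>Q) + (\<integral>q. ln (law s (euler s q)) - ln (law t (euler s q)) \<partial>Q)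
      = (\<integral>x. law s x * (ln (law s x) + U x) \<partial>lborel)" if s: "0 \<le> s" for s
  proof -
    have i: "integrable Q (\<lambda>q. ln (law r (euler s q)))" if "0 \<le> r" for r
      using ln_law_bound[OF that] s by (auto intro: integrable_compose_euler[where f="\<lambda>x. ln (law r x)"])
    have iU: "integrable Q (\<lambda>q. U (euler s q))"
      using s by (intro integrable_compose_euler[OF _ _ CU]) auto
    have "(\<integral>x. law s x * (ln (law s x) + U x) \<partial>lborel) = (\<integral>q. ln (law s (euler s q)) + U (euler s q) \<partial>Q)"
      using s by (intro integral_law) auto
    then show ?thesis using i[OF s] i[OF t] iU by (simp add: f_def)
  qed
  show ?thesis
  proof (rule that[of D])
    show "((\<lambda>s. \<integral>x. law s x * (ln (law s x) + U x) \<partial>lborel) has_real_derivative D) (at t within {0..})"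
      by (rule has_field_derivative_transform_within[OF sum_der zero_less_one]) (use t eq in auto)
    show "integrable Q (\<lambda>q. (norm (grad_ln_law t (euler t q) + h (euler t q)))\<^sup>2)"
      using i_d by (simp add: d_def)
    show "integrable Q (\<lambda>q. (norm (h (euler t q) - H (fst q)))\<^sup>2)" by (rule i_gap)
    have "D \<le> (\<integral>q. - (3/4) * (norm (d (euler t q)))\<^sup>2 + (norm (h (euler t q) - H (fst q)))\<^sup>2 \<partial>Q)"
      unfolding D_def
    proof (rule integral_mono)
      fix q
      \<comment> \<open>Expanding the square of \<open>a / 2 - b\<close> gives
        \<open>a \<bullet> b \<le> |a|^2 / 4 + |b|^2\<close>; the quarter lost from
        \<open>|a|^2\<close> is the origin of \<open>3/4\<close>, and the error keeps the factor
        one.\<close>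
      define a b where "a = d (euler t q)" and "b = h (euler t q) - H (fst q)"
      have "0 \<le> (norm ((1/2) *\<^sub>R a - b))\<^sup>2" by simp
      also have "\<dots> = 1/4 * (norm a)\<^sup>2 - a \<bullet> b + (norm b)\<^sup>2"
        by (simp add: power2_norm_eq_inner inner_diff_left inner_diff_right inner_commute)
      finally show "d (euler t q) \<bullet> (h (euler t q) - H (fst q)) - (norm (d (euler t q)))\<^sup>2
          \<le> - (3/4) * (norm (d (euler t q)))\<^sup>2 + (norm (h (euler t q) - H (fst q)))\<^sup>2"
        by (simp add: a_def b_def)
    qed (use i_d i_gap i_cross in auto)
    then show "D \<le> - (3/4) * (\<integral>q. (norm (grad_ln_law t (euler t q) + h (euler t q)))\<^sup>2 \<partial>Q)
       + (\<integral>q. (norm (h (euler t q) - H (fst q)))\<^sup>2 \<partial>Q)"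
      using i_d i_gap by (simp add: d_def)
  qed
qed

end

section \<open>Tamed drift, Gaussian start, Gibbs measure\<close>

lemma norm_R_fun_le: "a \<le> 2 \<Longrightarrow> norm (R_fun a x) \<le> norm x"
proof -
  assume a: "a \<le> 2"
  have "1 \<le> (1 + (norm x)\<^sup>2) powr (1 - a / 2)"
    using a by (intro ge_one_powr_ge_zero) auto
  then have "norm x / (1 + (norm x)\<^sup>2) powr (1 - a / 2) \<le> norm x / 1"
    by (intro divide_left_mono) auto
  then show ?thesis by (simp add: R_fun_def)
qed

lemma continuous_on_R_fun: "continuous_on UNIV (R_fun a :: real^'n \<Rightarrow> _)"
proof -
  have pos: "0 < 1 + (norm x)\<^sup>2" for x :: "real^'n" by (simp add: add_pos_nonneg)
  have "continuous_on UNIV (\<lambda>x::real^'n. (1 + (norm x)\<^sup>2) powr (1 - a / 2))"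
    using less_imp_neq[OF pos, symmetric] pos by (intro continuous_on_powr' continuous_intros) (auto simp: less_imp_le)
  then show ?thesis
    unfolding R_fun_def using less_imp_neq[OF pos, symmetric]
    by (intro continuous_on_scaleR continuous_on_divide continuous_on_const continuous_on_id) auto
qed

lemma rpow_nonneg: "0 \<le> rpow r q"
  by (simp add: rpow_def)

text \<open>The convention in \<open>rpow\<close> matters for \<open>q = 0\<close>: plain
  \<open>0 powr 0\<close> is \<open>0\<close>, which would break continuity at the origin.\<close>

lemma continuous_on_rpow_norm:
  assumes "0 \<le> q"
  shows "continuous_on UNIV (\<lambda>x::'a::real_normed_vector. rpow (norm x) q)"
proof (cases "q = 0")
  case False
  then have "continuous_on UNIV (\<lambda>x::'a. norm x powr q)"
    using assms by (intro continuous_on_powr' continuous_on_norm continuous_on_id continuous_on_const) auto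
  then show ?thesis using False by (simp add: rpow_def)
qed (simp add: rpow_def)

lemma rpow_le_power:
  assumes "0 \<le> q" "0 \<le> r"
  shows "rpow r q \<le> (1 + r) ^ nat \<lceil>q\<rceil>"
proof (cases "q = 0")
  case False
  have "r powr q \<le> (1 + r) powr q" using assms by (intro powr_mono2) auto
  also have "\<dots> \<le> (1 + r) powr real (nat \<lceil>q\<rceil>)" using assms by (intro powr_mono) auto
  also have "\<dots> = (1 + r) ^ nat \<lceil>q\<rceil>" using assms by (intro powr_realpow) auto
  finally show ?thesis using False by (simp add: rpow_def)
qed (simp add: rpow_def)

lemma continuous_on_h_tamed:
  assumes "0 < lam" "0 \<le> l" "continuous_on UNIV h"
  shows "continuous_on UNIV (h_tamed A a l lam h)"
proof -
  have "0 < 1 + sqrt lam * rpow (norm x) (2 * l)" for x :: "real^'n"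
    using assms rpow_nonneg[of "norm x" "2 * l"] by (simp add: add_pos_nonneg)
  then have "1 + sqrt lam * rpow (norm x) (2 * l) \<noteq> 0" for x :: "real^'n"
    using less_imp_neq by metis
  moreover have "continuous_on UNIV (\<lambda>x::real^'n. rpow (norm x) (2 * l))"
    using assms by (intro continuous_on_rpow_norm) auto
  ultimately show ?thesis
    unfolding h_tamed_def
    using assms(3) continuous_on_R_fun[of a]
    by (intro continuous_on_add continuous_on_scaleR continuous_on_divide continuous_on_diff continuous_on_mult continuous_on_const) auto
qed

text \<open>The taming factor cancels the polynomial growth of \<open>h\<close>:
  \<open>(1 + r) / (1 + sqrt lam r)\<close> is at most \<open>1 + 1 / sqrt lam\<close>. What remains
  grows like \<open>R_fun\<close>, at most linearly for \<open>a \<le> 2\<close>.\<close>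

lemma h_tamed_growth:
  fixes h :: "real^'n \<Rightarrow> real^'n"
  assumes "0 < lam" "0 < A" "a \<le> 2" "0 < L"
    and h: "\<And>x. norm (h x) \<le> L * (1 + rpow (norm x) (2 * l))"
  shows "norm (h_tamed A a l lam h x) \<le> (2 * A + L * (1 + 1 / sqrt lam)) * (1 + norm x)"
proof -
  define r where "r = rpow (norm x) (2 * l)"
  have r: "0 \<le> r" by (simp add: r_def rpow_nonneg)
  have sl: "0 < sqrt lam" using assms by simp
  have den: "1 \<le> 1 + sqrt lam * r" using r sl by simp
  have R: "norm (A *\<^sub>R R_fun a x) \<le> A * norm x"
    using norm_R_fun_le[OF assms(3), of x] assms(2) by simp
  have "norm ((1 / (1 + sqrt lam * r)) *\<^sub>R (h x - A *\<^sub>R R_fun a x))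
      = norm (h x - A *\<^sub>R R_fun a x) / (1 + sqrt lam * r)"
    using den by simp
  also have "\<dots> \<le> (L * (1 + r) + A * norm x) / (1 + sqrt lam * r)"
  proof (rule divide_right_mono)
    show "norm (h x - A *\<^sub>R R_fun a x) \<le> L * (1 + r) + A * norm x"
      by (rule order_trans[OF norm_triangle_ineq4 add_mono[OF h[of x, folded r_def] R]])
  qed (use den in simp)
  also have "\<dots> = L * ((1 + r) / (1 + sqrt lam * r)) + A * norm x / (1 + sqrt lam * r)"
    by (simp add: add_divide_distrib[where a="L * (1 + r)"])
  also have "\<dots> \<le> L * (1 + 1 / sqrt lam) + A * norm x"
  proof (intro add_mono mult_left_mono)
    have "1 + r \<le> (1 + 1 / sqrt lam) * (1 + sqrt lam * r)" using r sl by (simp add: algebra_simps)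
    then show "(1 + r) / (1 + sqrt lam * r) \<le> 1 + 1 / sqrt lam" using den by (simp add: pos_divide_le_eq)
    have "A * norm x / (1 + sqrt lam * r) \<le> A * norm x / 1"
      using assms(2) den by (intro divide_left_mono) auto
    then show "A * norm x / (1 + sqrt lam * r) \<le> A * norm x" by simp
  qed (use assms in auto)
  finally have "norm (h_tamed A a l lam h x) \<le> A * norm x + (L * (1 + 1 / sqrt lam) + A * norm x)"
    unfolding h_tamed_def r_def[symmetric] using R by (intro order_trans[OF norm_triangle_ineq] add_mono) auto
  also have "\<dots> \<le> (2 * A + L * (1 + 1 / sqrt lam)) * (1 + norm x)"
  proof -
    define \<kappa> where "\<kappa> = L * (1 + 1 / sqrt lam)"
    have "0 \<le> \<kappa> * norm x" using assms sl by (simp add: \<kappa>_def)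
    then show ?thesis using assms unfolding \<kappa>_def[symmetric] by (simp add: algebra_simps)
  qed
  finally show ?thesis .
qed

section \<open>Gaussian laws given by a covariance matrix\<close>

lemma matrix_inv_right: "invertible S \<Longrightarrow> S ** matrix_inv S = mat 1"
  unfolding matrix_inv_def invertible_def by (rule someI2_ex) auto

text \<open>Positivity passes to the inverse by writing \<open>w = S v\<close>. The form attains a
  positive minimum on the compact unit sphere, and homogeneity extends the bound to all
  vectors.\<close>

lemma pos_def_matrix_inv_coercive:
  fixes S :: "real^'n^'n"
  assumes S: "pos_def_matrix S"
  shows "\<exists>c>0. \<forall>w. c * (norm w)\<^sup>2 \<le> w \<bullet> (matrix_inv S *v w)"
proof -
  have "\<forall>x. S *v x = 0 \<longrightarrow> x = 0"
    using S unfolding pos_def_matrix_def by (metis inner_zero_right less_irrefl)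
  then have "invertible S" by (simp add: invertible_left_inverse matrix_left_invertible_ker)
  then have inv: "S *v (matrix_inv S *v w) = w" for w
    using matrix_inv_right[of S] by (simp add: matrix_vector_mul_assoc)
  have pos: "0 < w \<bullet> (matrix_inv S *v w)" if "w \<noteq> 0" for w
  proof -
    have "matrix_inv S *v w \<noteq> 0" using inv[of w] that by auto
    then have "0 < (matrix_inv S *v w) \<bullet> (S *v (matrix_inv S *v w))"
      using S by (simp add: pos_def_matrix_def)
    then show ?thesis by (simp add: inv inner_commute)
  qed
  have ne: "sphere (0::real^'n) 1 \<noteq> {}" by simp
  have "continuous_on (sphere 0 1) (\<lambda>w. w \<bullet> (matrix_inv S *v w))"
    by (intro continuous_on_inner continuous_on_id linear_continuous_on) (rule matrix_vector_mul_bounded_linear)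
  from continuous_attains_inf[OF compact_sphere ne this]
  obtain w0 where w0: "w0 \<in> sphere 0 1" "\<And>w. w \<in> sphere 0 1 \<Longrightarrow> w0 \<bullet> (matrix_inv S *v w0) \<le> w \<bullet> (matrix_inv S *v w)"
    by blast
  define c where "c = w0 \<bullet> (matrix_inv S *v w0)"
  have "0 < c" unfolding c_def using w0(1) by (intro pos) auto
  moreover have "c * (norm w)\<^sup>2 \<le> w \<bullet> (matrix_inv S *v w)" for w
  proof (cases "w = 0")
    case False
    define v where "v = w /\<^sub>R norm w"
    have w: "w = norm w *\<^sub>R v" using False by (simp add: v_def)
    have "c \<le> v \<bullet> (matrix_inv S *v v)" unfolding c_def using False by (intro w0(2)) (simp add: v_def)
    then have "c * (norm w)\<^sup>2 \<le> (v \<bullet> (matrix_inv S *v v)) * (norm w)\<^sup>2" by (intro mult_right_mono) auto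
    also have "\<dots> = (norm w *\<^sub>R v) \<bullet> (matrix_inv S *v (norm w *\<^sub>R v))"
      by (simp add: power2_eq_square matrix_vector_mult_scaleR)
    finally show ?thesis using w by simp
  qed simp
  ultimately show ?thesis by blast
qed

text \<open>No sign of \<open>det S\<close> is assumed: were the square root not positive, division by it would
  make the density vanish, contradicting total mass one.\<close>

lemma nondeg_gaussian_regular:
  fixes \<rho> :: "(real^'n) measure"
  assumes "nondeg_gaussian \<rho>" "prob_space \<rho>"
  shows "\<exists>p. regular_density p \<and> \<rho> = density lborel p"
proof -
  obtain m S where S: "pos_def_matrix S" and \<rho>: "\<rho> = gaussian_measure m S"
    using assms(1) by (auto simp: nondeg_gaussian_def)
  define N where "N = sqrt ((2 * pi) ^ CARD('n) * det S)"
  define I where "I = matrix_inv S"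
  define p where "p x = exp (- (1/2) * ((x - m) \<bullet> (I *v (x - m)))) / N" for x
  have \<rho>p: "\<rho> = density lborel p" by (simp add: \<rho> gaussian_measure_def p_def[abs_def] N_def I_def)
  have bl: "bounded_linear ((*v) I)" by (rule matrix_vector_mul_bounded_linear)
  have bl': "bounded_linear (\<lambda>w. w v* I)"
  proof -
    have "(\<lambda>w. w v* I) = (*v) (transpose I)" by (rule ext) simp
    then show ?thesis by (simp only: matrix_vector_mul_bounded_linear)
  qed
  have cont: "continuous_on UNIV p"
    unfolding p_def divide_inverse
    by (intro continuous_intros continuous_on_compose2[OF linear_continuous_on[OF bl]]) auto
  then have [measurable]: "p \<in> borel_measurable borel" by (rule borel_measurable_continuous_onI)
  have N: "0 < N"
  proof (rule ccontr)
    assume "\<not> 0 < N"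
    then have "ennreal (p x) = 0" for x by (auto simp: p_def ennreal_eq_0_iff divide_nonneg_nonpos)
    then have "emeasure \<rho> (space \<rho>) = 0" by (simp add: \<rho>p emeasure_density)
    then show False using prob_space.emeasure_space_1[OF assms(2)] by simp
  qed
  obtain c where c: "0 < c" "\<And>w. c * (norm w)\<^sup>2 \<le> w \<bullet> (I *v w)"
    using pos_def_matrix_inv_coercive[OF S] by (auto simp: I_def)
  have ln_p: "ln (p x) = - (1/2) * ((x - m) \<bullet> (I *v (x - m))) - ln N" for x
    using N by (simp add: p_def ln_div)
  \<comment> \<open>The gradient of the quadratic form in the symmetrised shape that is valid for
    every matrix.\<close>
  define d where "d x = - (1/2) *\<^sub>R ((x - m) v* I + I *v (x - m))" for x
  have der: "((\<lambda>x. ln (p x)) has_derivative (\<lambda>v. d x \<bullet> v)) (at x)" for x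
  proof -
    have 1: "((\<lambda>x. x - m) has_derivative (\<lambda>v. v)) (at x)" by (auto intro!: derivative_eq_intros)
    have 2: "((\<lambda>x. I *v (x - m)) has_derivative (\<lambda>v. I *v v)) (at x)"
      by (rule bounded_linear.has_derivative[OF bl 1])
    have "((\<lambda>x. (- (1/2)) * ((x - m) \<bullet> (I *v (x - m))) - ln N) has_derivative
        (\<lambda>v. (- (1/2)) * ((x - m) \<bullet> (I *v v) + v \<bullet> (I *v (x - m))) - 0)) (at x)"
      by (rule has_derivative_diff[OF bounded_linear.has_derivative[OF bounded_linear_mult_right has_derivative_inner[OF 1 2]] has_derivative_const])
    then show ?thesis
      unfolding ln_p
      by (rule has_derivative_eq_rhs)
         (rule ext, simp only: d_def inner_scaleR_left inner_add_left dot_lmul_matrix diff_zero inner_commute[of "I *v (x - m)"])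
  qed
  obtain K1 where K1: "\<And>w. norm (I *v w) \<le> norm w * K1" "0 < K1"
    using bounded_linear.pos_bounded[OF bl] by blast
  obtain K2 where K2: "\<And>w. norm (w v* I) \<le> norm w * K2" "0 < K2"
    using bounded_linear.pos_bounded[OF bl'] by blast
  have d_bound: "norm (d x) \<le> ((K1 + K2) * (1 + norm m)) * (1 + norm x)" for x
  proof -
    have "norm (d x) \<le> norm ((x - m) v* I + I *v (x - m))"
      unfolding d_def norm_scaleR by (rule mult_left_le_one_le) auto
    also have "\<dots> \<le> norm (x - m) * K2 + norm (x - m) * K1"
      by (intro norm_triangle_mono K1 K2)
    also have "\<dots> = (K1 + K2) * norm (x - m)" by (simp add: algebra_simps)
    also have "\<dots> \<le> (K1 + K2) * ((1 + norm m) * (1 + norm x))"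
    proof (rule mult_left_mono)
      have "norm (x - m) \<le> norm x + norm m" by (rule norm_triangle_ineq4)
      also have "\<dots> \<le> (1 + norm m) * (1 + norm x)" by (simp add: algebra_simps)
      finally show "norm (x - m) \<le> (1 + norm m) * (1 + norm x)" .
    qed (use K1 K2 in auto)
    finally show ?thesis by (simp add: mult.assoc)
  qed
  \<comment> \<open>Since \<open>|x|^2 \<le> 2 |x - m|^2 + 2 |m|^2\<close>, the rate
    \<open>c / 8\<close> spends \<open>c / 4\<close> of the decay rate \<open>c / 2\<close> of
    \<open>p\<close> around \<open>m\<close>, which leaves \<open>c / 4\<close>.\<close>
  have moment: "integrable lborel (\<lambda>x. p x * exp (c / 8 * (norm x)\<^sup>2))"
  proof -
    have "integrable lborel (\<lambda>x::real^'n. exp (- (c / 4) * (norm x)\<^sup>2))"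
      using c by (intro integrable_exp_neg_norm2) auto
    then have "integrable lborel (\<lambda>x::real^'n. exp (- (c / 4) * (norm (- m + 1 *\<^sub>R x))\<^sup>2))"
      by (subst integrable_lborel_affine[where f="\<lambda>x. exp (- (c / 4) * (norm x)\<^sup>2)"]) auto
    then have i: "integrable lborel (\<lambda>x::real^'n. exp (c / 4 * (norm m)\<^sup>2) / N * exp (- (c / 4) * (norm (x - m))\<^sup>2))"
      by (intro integrable_mult_right) simp
    show ?thesis
    proof (rule Bochner_Integration.integrable_bound[OF i])
      have "norm (p x * exp (c / 8 * (norm x)\<^sup>2)) \<le> norm (exp (c / 4 * (norm m)\<^sup>2) / N * exp (- (c / 4) * (norm (x - m))\<^sup>2))" for x
      proof -
        have "norm x \<le> norm (x - m) + norm m" using norm_triangle_ineq[of "x - m" m] by simp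
        then have "(norm x)\<^sup>2 \<le> (norm (x - m) + norm m)\<^sup>2" by (intro power_mono) auto
        also have "\<dots> \<le> 2 * (norm (x - m))\<^sup>2 + 2 * (norm m)\<^sup>2"
          using sum_squares_bound[of "norm (x - m)" "norm m"] by (simp add: power2_sum)
        finally have "c / 8 * (norm x)\<^sup>2 \<le> c / 8 * (2 * (norm (x - m))\<^sup>2 + 2 * (norm m)\<^sup>2)"
          using c(1) by (intro mult_left_mono) auto
        moreover have "- (1/2) * ((x - m) \<bullet> (I *v (x - m))) \<le> - (1/2) * (c * (norm (x - m))\<^sup>2)"
          using c(2)[of "x - m"] by simp
        ultimately have "- (1/2) * ((x - m) \<bullet> (I *v (x - m))) + c / 8 * (norm x)\<^sup>2 \<le> c / 4 * (norm m)\<^sup>2 + - (c / 4) * (norm (x - m))\<^sup>2"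
          by (simp add: algebra_simps)
        then have "exp (- (1/2) * ((x - m) \<bullet> (I *v (x - m)))) * exp (c / 8 * (norm x)\<^sup>2) / N
            \<le> exp (c / 4 * (norm m)\<^sup>2) * exp (- (c / 4) * (norm (x - m))\<^sup>2) / N"
          unfolding exp_add[symmetric] using N by (intro divide_right_mono) auto
        then show ?thesis using N by (simp add: p_def)
      qed
      then show "AE x in lborel. norm (p x * exp (c / 8 * (norm x)\<^sup>2)) \<le> norm (exp (c / 4 * (norm m)\<^sup>2) / N * exp (- (c / 4) * (norm (x - m))\<^sup>2))"
        by (intro AE_I2)
    qed measurable
  qed
  have "regular_density p"
    unfolding regular_density_def
  proof (intro conjI allI)
    show "0 < p x" for x using N by (simp add: p_def)
    show "prob_space (density lborel p)" using assms(2) by (simp add: \<rho>p)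
    show "\<exists>d C. \<forall>x. ((\<lambda>x. ln (p x)) has_derivative (\<lambda>v. d x \<bullet> v)) (at x) \<and> norm (d x) \<le> C * (1 + norm x)"
      using der d_bound by (intro exI[of _ d] exI[of _ "(K1 + K2) * (1 + norm m)"]) blast
    show "\<exists>c>0. integrable lborel (\<lambda>x. p x * exp (c * (norm x)\<^sup>2))"
      using moment c(1) by (intro exI[of _ "c / 8"]) auto
  qed
  then show ?thesis using \<rho>p by blast
qed

lemma gaussian_measure_scalar:
  assumes "0 < \<delta>"
  shows "gaussian_measure 0 (\<delta> *\<^sub>R mat 1 :: real^'n^'n) = distr std_gaussian borel (\<lambda>z. sqrt \<delta> *\<^sub>R z)"
proof -
  let ?S = "\<delta> *\<^sub>R mat 1 :: real^'n^'n"
  have "invertible ?S"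
    unfolding invertible_left_inverse
    using assms by (intro exI[of _ "(1 / \<delta>) *\<^sub>R mat 1"]) (simp add: scalar_matrix_assoc[symmetric] matrix_scalar_ac)
  then have "?S *v (matrix_inv ?S *v w) = w" for w
    using matrix_inv_right[of ?S] by (simp add: matrix_vector_mul_assoc)
  then have "\<delta> *\<^sub>R (matrix_inv ?S *v w) = w" for w
    by (simp add: scaleR_matrix_vector_assoc[symmetric])
  then have "w \<bullet> w = \<delta> * (w \<bullet> (matrix_inv ?S *v w))" for w
    by (metis inner_scaleR_right)
  then have inv: "w \<bullet> (matrix_inv ?S *v w) = (norm w)\<^sup>2 / \<delta>" for w
    using assms by (simp add: power2_norm_eq_inner field_simps)
  have det: "det ?S = \<delta> ^ CARD('n)"
    by (subst det_diagonal) (auto simp: mat_def)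
  \<comment> \<open>\<open>kern s\<close> has covariance \<open>2 s\<close> times the identity,
    hence the argument \<open>\<delta> / 2\<close>.\<close>
  have k: "exp (- (1/2) * ((x - 0) \<bullet> (matrix_inv ?S *v (x - 0)))) / sqrt ((2 * pi) ^ CARD('n) * det ?S) = kern (\<delta> / 2) (x - 0)" for x
  proof -
    have s: "sqrt ((2 * pi) ^ CARD('n) * \<delta> ^ CARD('n)) = sqrt ((2 * pi) ^ CARD('n)) * sqrt \<delta> ^ CARD('n)"
      by (simp only: real_sqrt_mult real_sqrt_power)
    have n: "(norm (x /\<^sub>R sqrt \<delta>))\<^sup>2 = (norm x)\<^sup>2 / \<delta>"
    proof -
      have nx: "norm (x /\<^sub>R sqrt \<delta>) = norm x / sqrt \<delta>"
        using assms by (simp add: divide_inverse mult.commute)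
      show ?thesis unfolding nx using assms by (simp add: power_divide)
    qed
    have sq: "sqrt (2 * (\<delta> / 2)) = sqrt \<delta>" by simp
    show ?thesis unfolding diff_zero inv det kern_def gauss_def sq s n by simp
  qed
  have "distr std_gaussian borel (\<lambda>z. sqrt \<delta> *\<^sub>R z) = density lborel (\<lambda>x::real^'n. kern (\<delta> / 2) (x - 0))"
  proof (rule measure_eqI)
    fix X assume "X \<in> sets (distr std_gaussian borel (\<lambda>z::real^'n. sqrt \<delta> *\<^sub>R z))"
    then have [measurable]: "X \<in> sets borel" by simp
    have "emeasure (distr std_gaussian borel (\<lambda>z::real^'n. sqrt \<delta> *\<^sub>R z)) X
        = (\<integral>\<^sup>+x. indicator X x \<partial>distr std_gaussian borel (\<lambda>z::real^'n. sqrt \<delta> *\<^sub>R z))" by simp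
    also have "\<dots> = (\<integral>\<^sup>+z. indicator X (0 + sqrt (2 * (\<delta> / 2)) *\<^sub>R z) \<partial>std_gaussian)"
      by (subst nn_integral_distr) auto
    also have "\<dots> = (\<integral>\<^sup>+x. ennreal (kern (\<delta> / 2) (x - 0)) * indicator X x \<partial>lborel)"
      using assms by (intro nn_integral_std_gaussian_affine) auto
    finally show "emeasure (distr std_gaussian borel (\<lambda>z::real^'n. sqrt \<delta> *\<^sub>R z)) X
       = emeasure (density lborel (\<lambda>x::real^'n. kern (\<delta> / 2) (x - 0))) X"
      by (subst emeasure_density) auto
  qed simp
  then show ?thesis unfolding gaussian_measure_def k by simp
qed

text \<open>The set where two continuous functions differ is open; if nonempty, it contains a ball,
  which has positive volume.\<close>

lemma AE_lborel_continuous_eq: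
  fixes f g :: "'a::euclidean_space \<Rightarrow> real"
  assumes f: "continuous_on UNIV f" and g: "continuous_on UNIV g" and ae: "AE x in lborel. f x = g x"
  shows "f = g"
proof (rule ext, rule ccontr)
  fix x assume x: "f x \<noteq> g x"
  have "open {x. f x \<noteq> g x}" using f g by (rule open_Collect_neq)
  moreover have "x \<in> {x. f x \<noteq> g x}" using x by simp
  ultimately obtain e where e: "0 < e" "ball x e \<subseteq> {x. f x \<noteq> g x}" by (rule openE)
  have "AE x' in lborel. x' \<notin> ball x e" using ae by eventually_elim (use e in auto)
  then have "emeasure lborel (ball x e) = 0"
    by (subst (asm) AE_iff_null_sets[symmetric]) auto
  moreover have "0 < unit_ball_vol (real DIM('a)) * e ^ DIM('a)" using e by simp
  ultimately show False using e by (simp add: emeasure_ball)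
qed

section \<open>Relative entropy and Fisher information with respect to the Gibbs measure\<close>

lemma partition_function_pos:
  fixes u :: "'a::euclidean_space \<Rightarrow> real"
  assumes "integrable lborel (\<lambda>x. exp (- u x))"
  shows "0 < (\<integral>x. exp (- u x) \<partial>lborel)"
proof (rule ccontr)
  assume "\<not> 0 < (\<integral>x. exp (- u x) \<partial>lborel)"
  moreover have "0 \<le> (\<integral>x. exp (- u x) \<partial>lborel)" by simp
  ultimately have "(\<integral>x. exp (- u x) \<partial>lborel) = 0" by simp
  then have "AE x in lborel. exp (- u x) = 0"
    using assms by (subst (asm) integral_nonneg_eq_0_iff_AE) auto
  then have "AE x::'a in lborel. x \<notin> UNIV" by eventually_elim simp
  then have "emeasure lborel (UNIV::'a set) = 0" by (subst (asm) AE_iff_null_sets[symmetric]) auto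
  then show False by simp
qed

text \<open>The base \<open>exp 1\<close> makes the logarithm natural, and \<open>u + ln Z\<close>
  is minus the log-density of the Gibbs measure; the two integrands agree pointwise.\<close>

lemma rel_entropy_gibbs:
  fixes u q :: "real^'n \<Rightarrow> real"
  assumes [measurable]: "u \<in> borel_measurable borel" "q \<in> borel_measurable borel"
    and int: "integrable lborel (\<lambda>x. exp (- u x))" and q: "\<And>x. 0 < q x"
  shows "rel_entropy (gibbs u) (density lborel q)
    = (\<integral>x. q x * (ln (q x) + (u x + ln (\<integral>y. exp (- u y) \<partial>lborel))) \<partial>lborel)"
proof -
  define Z where "Z = (\<integral>y. exp (- u y) \<partial>lborel)"
  have Z: "0 < Z" unfolding Z_def using int by (rule partition_function_pos)
  have "rel_entropy (gibbs u) (density lborel q) = (\<integral>x. q x * log (exp 1) (q x / (exp (- u x) / Z)) \<partial>lborel)"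
    unfolding rel_entropy_def gibbs_def Z_def[symmetric]
    using q Z by (intro lborel.KL_density_density) (auto simp: less_imp_le)
  also have "\<dots> = (\<integral>x. q x * (ln (q x) + (u x + ln Z)) \<partial>lborel)"
  proof (intro Bochner_Integration.integral_cong refl)
    fix x
    have "ln (q x / (exp (- u x) / Z)) = ln (q x) + (u x + ln Z)"
      using q[of x] Z by (simp add: ln_div ln_mult)
    then show "q x * log (exp 1) (q x / (exp (- u x) / Z)) = q x * (ln (q x) + (u x + ln Z))"
      by (simp add: log_def)
  qed
  finally show ?thesis by (simp add: Z_def)
qed

lemma grad_eqI:
  assumes "(f has_derivative (\<lambda>v. d \<bullet> v)) (at x)"
  shows "grad f x = d"
  unfolding grad_def
proof (rule some_equality[where P="\<lambda>v. (f has_derivative (\<lambda>y. v \<bullet> y)) (at x)"])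
  fix v assume "(f has_derivative (\<lambda>y. v \<bullet> y)) (at x)"
  then have "(\<lambda>y. v \<bullet> y) = (\<lambda>y. d \<bullet> y)" using assms by (rule has_derivative_unique)
  then show "v = d" by (metis inner_commute vector_eq_rdot)
qed fact

text \<open>Two continuous densities that agree almost everywhere coincide, so the \<open>SOME\<close> in the definition of
  \<open>fisher_info\<close> has a unique witness.\<close>

lemma fisher_info_gibbs:
  fixes u q :: "real^'n \<Rightarrow> real"
  assumes u: "\<And>x. (u has_derivative (\<lambda>v. h x \<bullet> v)) (at x)"
    and int: "integrable lborel (\<lambda>x. exp (- u x))" and q: "\<And>x. 0 < q x"
    and ln_q: "\<And>x. ((\<lambda>x. ln (q x)) has_derivative (\<lambda>v. d x \<bullet> v)) (at x)"
  shows "fisher_info (gibbs u) (density lborel q)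
    = enn2ereal (\<integral>\<^sup>+x. ennreal ((norm (d x + h x))\<^sup>2) \<partial>density lborel q)"
proof -
  define Z where "Z = (\<integral>y. exp (- u y) \<partial>lborel)"
  have Z: "0 < Z" unfolding Z_def using int by (rule partition_function_pos)
  have cont: "continuous_on UNIV f" if "\<And>x. (f has_derivative f' x) (at x)" for f :: "real^'n \<Rightarrow> real" and f'
    using that by (meson has_derivative_continuous continuous_at_imp_continuous_on)
  have u_cont: "continuous_on UNIV u" using u by (rule cont)
  then have [measurable]: "u \<in> borel_measurable borel" by (rule borel_measurable_continuous_onI)
  \<comment> \<open>The candidate density is \<open>q Z exp u\<close>; \<open>q\<close> is written
    through its logarithm because it is \<open>ln q\<close> whose derivative is given.\<close>
  define g0 where "g0 x = exp (ln (q x)) * (Z * exp (u x))" for x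
  have g0_der: "(g0 has_derivative (\<lambda>v. (g0 x *\<^sub>R (d x + h x)) \<bullet> v)) (at x)" for x
  proof -
    have "((\<lambda>x. Z * exp (ln (q x) + u x)) has_derivative
        (\<lambda>v. Z * ((d x \<bullet> v + h x \<bullet> v) * exp (ln (q x) + u x)))) (at x)"
      by (rule bounded_linear.has_derivative[OF bounded_linear_mult_right has_derivative_exp[OF has_derivative_add[OF ln_q u]]])
    moreover have "g0 = (\<lambda>x. Z * exp (ln (q x) + u x))" by (rule ext) (simp add: g0_def exp_add)
    ultimately show ?thesis by (simp add: inner_add_left algebra_simps)
  qed
  have g0_cont: "continuous_on UNIV g0" using g0_der by (rule cont)
  have [measurable]: "g0 \<in> borel_measurable borel" using g0_cont by (rule borel_measurable_continuous_onI)
  have g0_pos: "0 < g0 x" for x using Z by (simp add: g0_def)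
  have dens: "density lborel q = density (gibbs u) g0"
  proof -
    have "density (gibbs u) g0 = density lborel (\<lambda>x. ennreal (exp (- u x) / Z) * ennreal (g0 x))"
      unfolding gibbs_def Z_def[symmetric] by (rule density_density_eq) auto
    also have "(\<lambda>x. ennreal (exp (- u x) / Z) * ennreal (g0 x)) = (\<lambda>x. ennreal (q x))"
    proof (rule ext)
      fix x
      have "exp (- u x) / Z * g0 x = q x" using Z q[of x] by (simp add: g0_def exp_minus field_simps)
      then show "ennreal (exp (- u x) / Z) * ennreal (g0 x) = ennreal (q x)"
        using Z by (simp add: ennreal_mult'[symmetric])
    qed
    finally show ?thesis by simp
  qed
  have ex: "smooth_density (gibbs u) (density lborel q) g0"
    unfolding smooth_density_def using g0_pos g0_der dens by (auto simp: differentiable_def)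
  have unique: "g = g0" if g: "smooth_density (gibbs u) (density lborel q) g" for g
  proof -
    have g_cont: "continuous_on UNIV g"
      using g unfolding smooth_density_def
      by (meson differentiable_imp_continuous_within continuous_at_imp_continuous_on)
    then have [measurable]: "g \<in> borel_measurable borel" by (rule borel_measurable_continuous_onI)
    have "density lborel (\<lambda>x. ennreal (exp (- u x) / Z) * ennreal (g x)) = density (gibbs u) g"
      unfolding gibbs_def Z_def[symmetric] by (rule density_density_eq[symmetric]) auto
    also have "\<dots> = density lborel q" using g by (simp add: smooth_density_def)
    also have "\<dots> = density (gibbs u) g0" by (rule dens)
    also have "\<dots> = density lborel (\<lambda>x. ennreal (exp (- u x) / Z) * ennreal (g0 x))"
      unfolding gibbs_def Z_def[symmetric] by (rule density_density_eq) auto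
    finally have "AE x in lborel. ennreal (exp (- u x) / Z) * ennreal (g x) = ennreal (exp (- u x) / Z) * ennreal (g0 x)"
      by (intro sigma_finite_measure.density_unique[OF lborel.sigma_finite_measure_axioms]) auto
    then have "AE x in lborel. g x = g0 x"
    proof eventually_elim
      case (elim x)
      have g_pos: "0 < g x" using g by (simp add: smooth_density_def)
      have "exp (- u x) / Z * g x = exp (- u x) / Z * g0 x"
        using elim Z g_pos g0_pos[of x]
        by (simp add: ennreal_mult'[symmetric] del: times_divide_eq_left)
      then show ?case using Z by simp
    qed
    then show ?thesis by (rule AE_lborel_continuous_eq[OF g_cont g0_cont])
  qed
  have some: "(SOME g. smooth_density (gibbs u) (density lborel q) g) = g0"
    using ex unique by (rule some_equality)
  have "grad (\<lambda>y. ln (g0 y)) x = d x + h x" for x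
  proof (rule grad_eqI)
    have "((\<lambda>y. (ln (q y) + u y) + ln Z) has_derivative (\<lambda>v. (d x \<bullet> v + h x \<bullet> v) + 0)) (at x)"
      by (rule has_derivative_add[OF has_derivative_add[OF ln_q u] has_derivative_const])
    moreover have "(\<lambda>y. (ln (q y) + u y) + ln Z) = (\<lambda>y. ln (g0 y))"
      using Z by (intro ext) (simp add: g0_def ln_mult)
    ultimately show "((\<lambda>y. ln (g0 y)) has_derivative (\<lambda>v. (d x + h x) \<bullet> v)) (at x)"
      by (simp add: inner_add_left)
  qed
  then show ?thesis
    unfolding fisher_info_def using ex by (auto simp: some Let_def)
qed

section \<open>The law of the chain\<close>

text \<open>The chain as a deterministic function of its start \<open>f 0\<close> and the increments
  \<open>f 1\<close>, \<open>f 2\<close>, and so on, so that independence of these inputs passes to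
  the chain.\<close>

primrec chain_map :: "('a \<Rightarrow> 'a) \<Rightarrow> real \<Rightarrow> nat \<Rightarrow> (nat \<Rightarrow> 'a) \<Rightarrow> 'a::real_normed_vector" where
  "chain_map H lam 0 f = f 0"
| "chain_map H lam (Suc n) f = chain_map H lam n f - lam *\<^sub>R H (chain_map H lam n f) + sqrt 2 *\<^sub>R f (Suc n)"

text \<open>The index set \<open>I\<close> stays fixed while \<open>j\<close> grows, so that the
  induction hypothesis lives on the same product space.\<close>

lemma chain_map_measurable:
  fixes H :: "'a::euclidean_space \<Rightarrow> 'a"
  assumes [measurable]: "H \<in> borel_measurable borel"
  shows "{0..j} \<subseteq> I \<Longrightarrow> chain_map H lam j \<in> borel_measurable (PiM I (\<lambda>_. borel))"
proof (induction j)
  case 0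
  then have "(\<lambda>f. f 0) \<in> borel_measurable (PiM I (\<lambda>_. borel))"
    by (intro measurable_component_singleton) auto
  then show ?case by (simp add: chain_map.simps(1)[abs_def])
next
  case (Suc j)
  then have "{0..j} \<subseteq> I" by (auto simp: subset_eq)
  then have [measurable]: "chain_map H lam j \<in> borel_measurable (PiM I (\<lambda>_. borel))" by (rule Suc.IH)
  have [measurable]: "(\<lambda>f. f (Suc j)) \<in> borel_measurable (PiM I (\<lambda>_. borel))"
    using Suc.prems by (intro measurable_component_singleton) auto
  have "(\<lambda>f. chain_map H lam j f - lam *\<^sub>R H (chain_map H lam j f) + sqrt 2 *\<^sub>R f (Suc j)) \<in> borel_measurable (PiM I (\<lambda>_. borel))"
    by measurable
  then show ?case by (simp add: chain_map.simps(2)[abs_def])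
qed

lemma chain_map_eq_theta_disc:
  "(\<And>i. i \<le> j \<Longrightarrow> f i = (if i = 0 then X0 \<omega> else B (real i * lam) \<omega> - B (real (i - 1) * lam) \<omega>))
    \<Longrightarrow> chain_map H lam j f = theta_disc H lam X0 B j \<omega>"
  by (induction j) simp_all

context prob_space
begin

text \<open>The start and the increments up to time \<open>k lam\<close> form one block of
  independent variables, the increment from \<open>k lam\<close> to \<open>t\<close> another;
  functions of disjoint blocks are independent.\<close>

lemma theta_disc_indep_increment:
  fixes X0 :: "'a \<Rightarrow> real^'n"
  assumes BM: "brownian_indep M X0 B" and H: "H \<in> borel_measurable borel"
    and lam: "0 < lam" and t: "real k * lam < t"
  shows "indep_var borel (theta_disc H lam X0 B k) borel (\<lambda>\<omega>. B t \<omega> - B (real k * lam) \<omega>)"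
proof -
  \<comment> \<open>Grid times up to index \<open>k\<close>, then \<open>t\<close>. Strict increase
    is required only below index \<open>Suc k\<close>, so the sequence may be constant
    afterwards.\<close>
  define ts where "ts i = (if i \<le> k then real i * lam else t)" for i
  define V where "V i \<omega> = (if i = 0 then X0 \<omega> else B (ts i) \<omega> - B (ts (i - 1)) \<omega>)" for i \<omega>
  have "0 \<le> ts 0 \<and> (\<forall>i<Suc k. ts i < ts (Suc i))"
    using lam t by (auto simp: ts_def less_Suc_eq)
  then have V: "indep_vars (\<lambda>_. borel) V {0..Suc k}"
    using BM unfolding brownian_indep_def V_def[abs_def] by blast
  have blocks: "indep_var (PiM {0..k} (\<lambda>_. borel)) (\<lambda>\<omega>. restrict (\<lambda>i. V i \<omega>) {0..k})
      (PiM {Suc k} (\<lambda>_. borel)) (\<lambda>\<omega>. restrict (\<lambda>i. V i \<omega>) {Suc k})"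
    using V by (rule indep_var_restrict) auto
  have ind: "indep_var borel (chain_map H lam k \<circ> (\<lambda>\<omega>. restrict (\<lambda>i. V i \<omega>) {0..k}))
      borel ((\<lambda>f. f (Suc k)) \<circ> (\<lambda>\<omega>. restrict (\<lambda>i. V i \<omega>) {Suc k}))"
  proof (rule indep_var_compose[OF blocks])
    show "chain_map H lam k \<in> borel_measurable (PiM {0..k} (\<lambda>_. borel))"
      by (rule chain_map_measurable[OF H order_refl])
    show "(\<lambda>f. f (Suc k)) \<in> borel_measurable (PiM {Suc k} (\<lambda>_. borel))"
      by (rule measurable_component_singleton) simp
  qed
  have "chain_map H lam k \<circ> (\<lambda>\<omega>. restrict (\<lambda>i. V i \<omega>) {0..k}) = theta_disc H lam X0 B k"
    by (rule ext) (auto intro!: chain_map_eq_theta_disc simp: V_def ts_def)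
  moreover have "(\<lambda>f. f (Suc k)) \<circ> (\<lambda>\<omega>. restrict (\<lambda>i. V i \<omega>) {Suc k}) = (\<lambda>\<omega>. B t \<omega> - B (real k * lam) \<omega>)"
    by (rule ext) (simp add: V_def ts_def)
  ultimately show ?thesis using ind by simp
qed

text \<open>Rescaling the increment to unit variance turns the pair of chain position and noise into
  the product law \<open>Q\<close> of the one-step analysis.\<close>

lemma theta_disc_joint_law:
  fixes X0 :: "'a \<Rightarrow> real^'n"
  assumes BM: "brownian_indep M X0 B" and H: "H \<in> borel_measurable borel"
    and lam: "0 < lam" and t: "real k * lam < t"
  shows "theta_disc H lam X0 B k \<in> borel_measurable M"
    and "(\<lambda>\<omega>. (1 / sqrt (t - real k * lam)) *\<^sub>R (B t \<omega> - B (real k * lam) \<omega>)) \<in> borel_measurable M"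
    and "distr M (borel \<Otimes>\<^sub>M borel) (\<lambda>\<omega>. (theta_disc H lam X0 B k \<omega>, (1 / sqrt (t - real k * lam)) *\<^sub>R (B t \<omega> - B (real k * lam) \<omega>)))
      = distr M borel (theta_disc H lam X0 B k) \<Otimes>\<^sub>M std_gaussian"
proof -
  define c where "c = 1 / sqrt (t - real k * lam)"
  define \<Delta> where "\<Delta> \<omega> = B t \<omega> - B (real k * lam) \<omega>" for \<omega>
  note ind = theta_disc_indep_increment[OF BM H lam t]
  show m1: "theta_disc H lam X0 B k \<in> borel_measurable M" using ind by (rule indep_var_rv1)
  have m2 [measurable]: "\<Delta> \<in> borel_measurable M"
    using indep_var_rv2[OF ind] by (simp add: \<Delta>_def[abs_def])
  then show "(\<lambda>\<omega>. (1 / sqrt (t - real k * lam)) *\<^sub>R (B t \<omega> - B (real k * lam) \<omega>)) \<in> borel_measurable M"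
    unfolding \<Delta>_def[abs_def] by measurable
  have k0: "0 \<le> real k * lam" using lam by simp
  have "distr M borel \<Delta> = gaussian_measure 0 ((t - real k * lam) *\<^sub>R mat 1)"
    using BM t k0 unfolding brownian_indep_def \<Delta>_def[abs_def] by blast
  also have "\<dots> = distr std_gaussian borel (\<lambda>z. sqrt (t - real k * lam) *\<^sub>R z)"
    using t by (intro gaussian_measure_scalar) simp
  finally have \<Delta>: "distr M borel \<Delta> = distr std_gaussian borel (\<lambda>z. sqrt (t - real k * lam) *\<^sub>R z)" .
  have "distr M borel (\<lambda>\<omega>. c *\<^sub>R \<Delta> \<omega>) = distr (distr M borel \<Delta>) borel (\<lambda>x. c *\<^sub>R x)"
    by (subst distr_distr) (auto simp: comp_def)
  also have "\<dots> = distr std_gaussian borel (\<lambda>z. c *\<^sub>R (sqrt (t - real k * lam) *\<^sub>R z))"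
    unfolding \<Delta> by (subst distr_distr) (auto simp: comp_def)
  also have "\<dots> = distr std_gaussian std_gaussian (\<lambda>z. z)"
    using t by (intro distr_cong) (auto simp: c_def)
  also have "\<dots> = std_gaussian" by (rule distr_id)
  finally have law: "distr M borel (\<lambda>\<omega>. c *\<^sub>R \<Delta> \<omega>) = std_gaussian" .
  have "indep_var borel ((\<lambda>x. x) \<circ> theta_disc H lam X0 B k) borel ((\<lambda>x. c *\<^sub>R x) \<circ> \<Delta>)"
    using ind unfolding \<Delta>_def[abs_def] by (rule indep_var_compose) auto
  then have "indep_var borel (theta_disc H lam X0 B k) borel (\<lambda>\<omega>. c *\<^sub>R \<Delta> \<omega>)"
    by (simp add: comp_def)
  then have "distr M borel (theta_disc H lam X0 B k) \<Otimes>\<^sub>M distr M borel (\<lambda>\<omega>. c *\<^sub>R \<Delta> \<omega>)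
      = distr M (borel \<Otimes>\<^sub>M borel) (\<lambda>\<omega>. (theta_disc H lam X0 B k \<omega>, c *\<^sub>R \<Delta> \<omega>))"
    by (simp add: indep_var_distribution_eq)
  then show "distr M (borel \<Otimes>\<^sub>M borel) (\<lambda>\<omega>. (theta_disc H lam X0 B k \<omega>, (1 / sqrt (t - real k * lam)) *\<^sub>R (B t \<omega> - B (real k * lam) \<omega>)))
      = distr M borel (theta_disc H lam X0 B k) \<Otimes>\<^sub>M std_gaussian"
    unfolding law by (simp add: c_def \<Delta>_def)
qed

end

text \<open>The closed interval includes \<open>(k + 1) lam\<close>, where the floor already selects
  the next grid point; there the recursion of \<open>theta_disc\<close> shows that both formulas
  agree.\<close>

lemma theta_interp_eq:
  assumes lam: "0 < lam" and s: "s \<in> {real k * lam .. real (Suc k) * lam}"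
  shows "theta_interp H lam X0 B s \<omega> = theta_disc H lam X0 B k \<omega> - (s - real k * lam) *\<^sub>R H (theta_disc H lam X0 B k \<omega>)
    + sqrt 2 *\<^sub>R (B s \<omega> - B (real k * lam) \<omega>)"
proof (cases "s = real (Suc k) * lam")
  case True
  have "s / lam = real (Suc k)" using True lam by simp
  then have "nat \<lfloor>s / lam\<rfloor> = Suc k" by (simp only: floor_of_nat nat_int)
  moreover have "s - real k * lam = lam" using True by (simp add: algebra_simps)
  ultimately show ?thesis using True by (simp add: theta_interp_def Let_def)
next
  case False
  then have "real k \<le> s / lam" "s / lam < real k + 1"
    using s lam by (auto simp: pos_le_divide_eq pos_divide_less_eq algebra_simps)
  then have "\<lfloor>s / lam\<rfloor> = int k" by (intro floor_unique) auto
  then show ?thesis by (simp add: theta_interp_def Let_def)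
qed

lemma (in prob_space) theta_interp_as_euler:
  fixes X0 :: "'a \<Rightarrow> real^'n"
  assumes BM: "brownian_indep M X0 B" and H: "H \<in> borel_measurable borel"
    and lam: "0 < lam" and s: "s \<in> {real k * lam .. real (Suc k) * lam}"
  obtains \<xi> where "\<xi> \<in> borel_measurable M"
    "distr M (borel \<Otimes>\<^sub>M borel) (\<lambda>\<omega>. (theta_disc H lam X0 B k \<omega>, \<xi> \<omega>)) = distr M borel (theta_disc H lam X0 B k) \<Otimes>\<^sub>M std_gaussian"
    "\<And>\<omega>. theta_interp H lam X0 B s \<omega> = theta_disc H lam X0 B k \<omega> - (s - real k * lam) *\<^sub>R H (theta_disc H lam X0 B k \<omega>)
      + sqrt (2 * (s - real k * lam)) *\<^sub>R \<xi> \<omega>"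
proof -
  \<comment> \<open>At the left endpoint the increment is zero and cannot be normalised. Its
    coefficient vanishes as well, so the normalised increment over the whole step serves as the
    noise.\<close>
  define r where "r = (if s = real k * lam then real (Suc k) * lam else s)"
  have r: "real k * lam < r" using s lam by (auto simp: r_def)
  note joint = theta_disc_joint_law[OF BM H lam r]
  show ?thesis
  proof (rule that[OF joint(2,3)])
    fix \<omega>
    show "theta_interp H lam X0 B s \<omega> = theta_disc H lam X0 B k \<omega> - (s - real k * lam) *\<^sub>R H (theta_disc H lam X0 B k \<omega>)
      + sqrt (2 * (s - real k * lam)) *\<^sub>R ((1 / sqrt (r - real k * lam)) *\<^sub>R (B r \<omega> - B (real k * lam) \<omega>))"
    proof (cases "s = real k * lam")
      case True
      then show ?thesis unfolding theta_interp_eq[OF lam s] by simp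
    next
      case False
      then have rs: "r = s" and pos: "0 < s - real k * lam" using r by (auto simp: r_def)
      have "sqrt (2 * (s - real k * lam)) * (1 / sqrt (s - real k * lam)) = sqrt 2"
        unfolding real_sqrt_mult using pos by simp
      then show ?thesis unfolding theta_interp_eq[OF lam s] rs scaleR_scaleR by simp
    qed
  qed
qed

lemma regular_density_euler_density:
  fixes p :: "'a::euclidean_space \<Rightarrow> real"
  assumes p: "regular_density p" and H: "continuous_on UNIV H" "\<And>y. norm (H y) \<le> K * (1 + norm y)"
  obtains c dp L0 where "euler_density p H K c dp L0"
proof -
  have pos: "\<And>x. 0 < p x" and prob: "prob_space (density lborel p)" using p by (auto simp: regular_density_def)
  obtain dp L0 where d: "\<And>x. ((\<lambda>x. ln (p x)) has_derivative (\<lambda>v. dp x \<bullet> v)) (at x)" "\<And>x. norm (dp x) \<le> L0 * (1 + norm x)"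
    using regular_densityE[OF p] by metis
  obtain c where c: "0 < c" "integrable lborel (\<lambda>x. p x * exp (c * (norm x)\<^sup>2))"
    using p by (auto simp: regular_density_def)
  have "continuous_on UNIV (\<lambda>x. ln (p x))"
    using d(1) by (meson has_derivative_continuous continuous_at_imp_continuous_on)
  then have "(\<lambda>x. exp (ln (p x))) \<in> borel_measurable borel"
    by (intro borel_measurable_continuous_onI continuous_on_exp)
  then have [measurable]: "p \<in> borel_measurable borel" using pos by simp
  have "integrable (density lborel p) (\<lambda>y. exp (c * (norm y)\<^sup>2))"
    using c(2) pos by (subst integrable_density) (auto simp: less_imp_le)
  then have "euler_step (density lborel p) H K c"
    by (intro euler_step.intro prob H c(1)) simp_all
  then have "euler_density p H K c dp L0"
    by (rule euler_density.intro[OF _ euler_density_axioms.intro[OF pos d]])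
  then show thesis by (rule that)
qed

lemma (in prob_space) theta_interp_law:
  fixes X0 :: "'a \<Rightarrow> real^'n"
  assumes BM: "brownian_indep M X0 B" and H: "H \<in> borel_measurable borel"
    and lam: "0 < lam" and s: "s \<in> {real k * lam .. real (Suc k) * lam}"
    and E: "euler_density p H K c dp L0"
    and p: "distr M borel (theta_disc H lam X0 B k) = density lborel p"
  shows "distr M borel (theta_interp H lam X0 B s) = density lborel (euler_density.law p H (s - real k * lam))"
proof -
  interpret E: euler_density p H K c dp L0 by (rule E)
  obtain \<xi> where \<xi> [measurable]: "\<xi> \<in> borel_measurable M" and
    joint: "distr M (borel \<Otimes>\<^sub>M borel) (\<lambda>\<omega>. (theta_disc H lam X0 B k \<omega>, \<xi> \<omega>)) = distr M borel (theta_disc H lam X0 B k) \<Otimes>\<^sub>M std_gaussian" and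
    eq: "\<And>\<omega>. theta_interp H lam X0 B s \<omega> = theta_disc H lam X0 B k \<omega> - (s - real k * lam) *\<^sub>R H (theta_disc H lam X0 B k \<omega>)
      + sqrt (2 * (s - real k * lam)) *\<^sub>R \<xi> \<omega>"
    using theta_interp_as_euler[OF BM H lam s] by blast
  have [measurable]: "theta_disc H lam X0 B k \<in> borel_measurable M"
    using lam by (intro theta_disc_joint_law(1)[OF BM H lam, of k "real (Suc k) * lam"]) simp
  have [measurable]: "E.euler \<tau> \<in> borel_measurable (borel \<Otimes>\<^sub>M borel)" for \<tau>
    using E.euler_measurable E.sets_Q by (simp cong: measurable_cong_sets)
  have "distr M borel (theta_interp H lam X0 B s)
      = distr M borel (E.euler (s - real k * lam) \<circ> (\<lambda>\<omega>. (theta_disc H lam X0 B k \<omega>, \<xi> \<omega>)))"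
    by (intro distr_cong) (auto simp: eq E.euler_def)
  also have "\<dots> = distr (distr M (borel \<Otimes>\<^sub>M borel) (\<lambda>\<omega>. (theta_disc H lam X0 B k \<omega>, \<xi> \<omega>))) borel (E.euler (s - real k * lam))"
    by (rule distr_distr[symmetric]) measurable
  also have "\<dots> = density lborel (E.law (s - real k * lam))"
    unfolding joint p using s by (intro E.distr_law) simp
  finally show ?thesis .
qed

lemma (in prob_space) theta_disc_regular:
  fixes X0 :: "'a \<Rightarrow> real^'n"
  assumes BM: "brownian_indep M X0 B" and X0: "X0 \<in> borel_measurable M" "nondeg_gaussian (distr M borel X0)"
    and lam: "0 < lam"
    and H: "continuous_on UNIV H" "\<And>y. norm (H y) \<le> K * (1 + norm y)"
  shows "\<exists>p. regular_density p \<and> distr M borel (theta_disc H lam X0 B k) = density lborel p"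
proof (induction k)
  case 0
  have "theta_disc H lam X0 B 0 = X0" by (rule ext) simp
  then show ?case using nondeg_gaussian_regular[OF X0(2) prob_space_distr[OF X0(1)]] by simp
next
  case (Suc k)
  then obtain p where p: "regular_density p" "distr M borel (theta_disc H lam X0 B k) = density lborel p" by blast
  obtain c dp L0 where E: "euler_density p H K c dp L0"
    using regular_density_euler_density[OF p(1) H] by blast
  interpret E: euler_density p H K c dp L0 by (rule E)
  have s: "real (Suc k) * lam \<in> {real k * lam .. real (Suc k) * lam}" using lam by simp
  have "real (Suc k) * lam - real k * lam = lam" by (simp add: algebra_simps)
  then have "theta_disc H lam X0 B (Suc k) = theta_interp H lam X0 B (real (Suc k) * lam)"
    by (intro ext) (simp only: theta_interp_eq[OF lam s] theta_disc.simps)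
  then have "distr M borel (theta_disc H lam X0 B (Suc k)) = density lborel (E.law lam)"
    using theta_interp_law[OF BM E.H_measurable lam s E p(2)] \<open>real (Suc k) * lam - real k * lam = lam\<close> by simp
  moreover have "regular_density (E.law lam)"
    using E.regular_density_dens[OF lam] lam by (simp add: E.law_def)
  ultimately show ?case by blast
qed

theorem mainTheorem9:
  fixes u :: "real^'n \<Rightarrow> real"
    and h :: "real^'n \<Rightarrow> real^'n"
    and Dh1 :: "real^'n \<Rightarrow> ((real^'n) \<Rightarrow>\<^sub>L (real^'n))"
    and Dh2 :: "real^'n \<Rightarrow> ((real^'n) \<Rightarrow>\<^sub>L ((real^'n) \<Rightarrow>\<^sub>L (real^'n)))"
    and Dh3 :: "real^'n \<Rightarrow> ((real^'n) \<Rightarrow>\<^sub>L ((real^'n) \<Rightarrow>\<^sub>L ((real^'n) \<Rightarrow>\<^sub>L (real^'n))))"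
    and L' l' A a b L l lam :: real
    and M :: "'w measure"
    and X0 :: "'w \<Rightarrow> real^'n"
    and B :: "real \<Rightarrow> 'w \<Rightarrow> real^'n"
    and k :: nat and t :: real
  assumes grad_u: "\<And>x. (u has_derivative (\<lambda>v. h x \<bullet> v)) (at x)"
    and D1: "\<And>x. (h has_derivative blinfun_apply (Dh1 x)) (at x)"
    and D2: "\<And>x. (Dh1 has_derivative blinfun_apply (Dh2 x)) (at x)"
    and D3: "\<And>x. (Dh2 has_derivative blinfun_apply (Dh3 x)) (at x)"
    and D3_cont: "continuous_on UNIV Dh3"
    and integrable: "integrable lborel (\<lambda>x. exp (- u x))"
    and A1: "\<And>x y. norm (h x - h y) \<le> L' * (1 + norm x + norm y) powr l' * norm (x - y)"
    and A2_par: "0 < A" "0 < b" "1 \<le> a" "a \<le> 2"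
    and A2: "\<And>x. h x \<bullet> x \<ge> A * norm x powr a - b"
    and A3_par: "0 < L" "0 \<le> l"
    and A3_h: "\<And>x. norm (h x) \<le> L * (1 + rpow (norm x) (2 * l))"
    and A3_1: "\<And>x. norm (Dh1 x) \<le> L * (1 + rpow (norm x) (2 * l))"
    and A3_2: "\<And>x. norm (Dh2 x) \<le> L * (1 + rpow (norm x) (2 * l))"
    and A3_3: "\<And>x. norm (Dh3 x) \<le> L * (1 + rpow (norm x) (2 * l))"
    and step: "0 < lam" "lam < lambda0 TYPE('n) A L a"
    and prob: "prob_space M"
    and X0_meas: "X0 \<in> borel_measurable M"
    and X0_law: "nondeg_gaussian (distr M borel X0)"
    and BM: "brownian_indep M X0 B"
    and t_in: "t \<in> {real k * lam .. real (Suc k) * lam}"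
  shows "\<exists>D. ((\<lambda>s. rel_entropy (gibbs u)
                 (distr M borel (theta_interp (h_tamed A a l lam h) lam X0 B s)))
              has_real_derivative D) (at t within {real k * lam .. real (Suc k) * lam})
          \<and> ereal D \<le> - (3/4) * fisher_info (gibbs u)
                 (distr M borel (theta_interp (h_tamed A a l lam h) lam X0 B t))
             + enn2ereal (\<integral>\<^sup>+\<omega>. ennreal ((norm (h (theta_interp (h_tamed A a l lam h) lam X0 B t \<omega>)
                   - h_tamed A a l lam h (theta_disc (h_tamed A a l lam h) lam X0 B k \<omega>)))\<^sup>2) \<partial>M)"
proof -
  interpret M: prob_space M by (rule prob)
  define H where "H = h_tamed A a l lam h"
  define K where "K = 2 * A + L * (1 + 1 / sqrt lam)"
  have h_cont: "continuous_on UNIV h"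
    using D1 by (meson has_derivative_continuous continuous_at_imp_continuous_on)
  have H: "continuous_on UNIV H" "\<And>y. norm (H y) \<le> K * (1 + norm y)"
    unfolding H_def K_def using step(1) A3_par A2_par A3_h h_cont
    by (auto intro: continuous_on_h_tamed h_tamed_growth)
  obtain p where p: "regular_density p" "distr M borel (theta_disc H lam X0 B k) = density lborel p"
    using M.theta_disc_regular[OF BM X0_meas X0_law step(1) H] by blast
  obtain c dp L0 where E: "euler_density p H K c dp L0"
    using regular_density_euler_density[OF p(1) H] by blast
  interpret E: euler_density p H K c dp L0 by (rule E)
  \<comment> \<open>A natural exponent at least \<open>2 l\<close>, as the growth estimates are
    stated for natural powers.\<close>
  define m where "m = nat \<lceil>2 * l\<rceil>"
  have h_bound: "norm (h x) \<le> (2 * L) * (1 + norm x) ^ m" for x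
  proof -
    have "1 + rpow (norm x) (2 * l) \<le> (1 + norm x) ^ m + (1 + norm x) ^ m"
      using A3_par rpow_le_power[of "2 * l" "norm x"] unfolding m_def by (intro add_mono one_le_power) auto
    then have "L * (1 + rpow (norm x) (2 * l)) \<le> L * ((1 + norm x) ^ m + (1 + norm x) ^ m)"
      using A3_par by (intro mult_left_mono) auto
    then show ?thesis using A3_h[of x] by simp
  qed
  define Z where "Z = (\<integral>y. exp (- u y) \<partial>lborel)"
  \<comment> \<open>Adding the constant \<open>ln Z\<close> keeps the gradient and accounts for the
    normalisation of the Gibbs measure.\<close>
  have U_der: "((\<lambda>x. u x + ln Z) has_derivative (\<lambda>v. h x \<bullet> v)) (at x)" for x
    using has_derivative_add[OF grad_u has_derivative_const[of "ln Z"]] by simp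
  have [measurable]: "u \<in> borel_measurable borel" using grad_u by (rule borel_measurable_of_has_derivative)
  have [measurable]: "h \<in> borel_measurable borel" using h_cont by (rule borel_measurable_continuous_onI)
  define \<tau> where "\<tau> = t - real k * lam"
  have \<tau>: "0 \<le> \<tau>" using t_in by (simp add: \<tau>_def)
  let ?F = "\<lambda>\<sigma>. \<integral>x. E.law \<sigma> x * (ln (E.law \<sigma> x) + (u x + ln Z)) \<partial>lborel"
  obtain D where D: "(?F has_real_derivative D) (at \<tau> within {0..})"
    "integrable E.Q (\<lambda>q. (norm (E.grad_ln_law \<tau> (E.euler \<tau> q) + h (E.euler \<tau> q)))\<^sup>2)"
    "integrable E.Q (\<lambda>q. (norm (h (E.euler \<tau> q) - H (fst q)))\<^sup>2)"
    "D \<le> - (3/4) * (\<integral>q. (norm (E.grad_ln_law \<tau> (E.euler \<tau> q) + h (E.euler \<tau> q)))\<^sup>2 \<partial>E.Q)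
       + (\<integral>q. (norm (h (E.euler \<tau> q) - H (fst q)))\<^sup>2 \<partial>E.Q)"
    using E.entropy_dissipation[OF U_der h_bound \<tau>] by blast
  define I where "I = (\<integral>q. (norm (E.grad_ln_law \<tau> (E.euler \<tau> q) + h (E.euler \<tau> q)))\<^sup>2 \<partial>E.Q)"
  define J where "J = (\<integral>q. (norm (h (E.euler \<tau> q) - H (fst q)))\<^sup>2 \<partial>E.Q)"
  let ?T = "{real k * lam .. real (Suc k) * lam}"
  have law: "distr M borel (theta_interp H lam X0 B s) = density lborel (E.law (s - real k * lam))" if "s \<in> ?T" for s
    by (rule M.theta_interp_law[OF BM E.H_measurable step(1) that E p(2)])
  have ent: "?F (s - real k * lam) = rel_entropy (gibbs u) (distr M borel (theta_interp H lam X0 B s))" if "s \<in> ?T" for s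
    unfolding law[OF that] Z_def using that
    by (intro rel_entropy_gibbs[symmetric] integrable E.law_pos) auto
  have "((\<lambda>s. s - real k * lam) has_real_derivative 1) (at t within ?T)"
    by (auto intro!: derivative_eq_intros)
  \<comment> \<open>The derivative along all nonnegative local times restricts to the current step;
    at \<open>t = k lam\<close> it is the right derivative, at \<open>t = (k + 1) lam\<close> the
    left one.\<close>
  moreover have "(?F has_real_derivative D) (at (t - real k * lam) within (\<lambda>s. s - real k * lam) ` ?T)"
    by (rule has_field_derivative_subset[OF D(1)[unfolded \<tau>_def]]) auto
  ultimately have F_der: "((?F \<circ> (\<lambda>s. s - real k * lam)) has_real_derivative D * 1) (at t within ?T)"
    by (rule DERIV_image_chain[rotated])
  have der: "((\<lambda>s. rel_entropy (gibbs u) (distr M borel (theta_interp H lam X0 B s))) has_real_derivative D) (at t within ?T)"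
  proof (rule has_field_derivative_transform_within[OF F_der[unfolded mult_1_right] zero_less_one t_in])
    show "(?F \<circ> (\<lambda>s. s - real k * lam)) s = rel_entropy (gibbs u) (distr M borel (theta_interp H lam X0 B s))"
      if "s \<in> ?T" for s
      unfolding comp_def by (rule ent[OF that])
  qed
  have [measurable]: "E.grad_ln_law \<tau> \<in> borel_measurable borel"
    by (rule borel_measurable_gradient[OF E.ln_law_has_derivative[OF \<tau>]])
  have fisher: "fisher_info (gibbs u) (distr M borel (theta_interp H lam X0 B t)) = ereal I"
  proof -
    have "fisher_info (gibbs u) (distr M borel (theta_interp H lam X0 B t))
        = enn2ereal (\<integral>\<^sup>+x. ennreal ((norm (E.grad_ln_law \<tau> x + h x))\<^sup>2) \<partial>density lborel (E.law \<tau>))"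
      unfolding law[OF t_in] \<tau>_def[symmetric]
      by (rule fisher_info_gibbs[OF grad_u integrable E.law_pos[OF \<tau>] E.ln_law_has_derivative[OF \<tau>]])
    also have "(\<integral>\<^sup>+x. ennreal ((norm (E.grad_ln_law \<tau> x + h x))\<^sup>2) \<partial>density lborel (E.law \<tau>))
        = (\<integral>\<^sup>+q. ennreal ((norm (E.grad_ln_law \<tau> (E.euler \<tau> q) + h (E.euler \<tau> q)))\<^sup>2) \<partial>E.Q)"
      unfolding E.distr_law[OF \<tau>, symmetric] by (rule nn_integral_distr) measurable
    also have "\<dots> = ennreal I"
      unfolding I_def using D(2) by (rule nn_integral_eq_integral) simp
    finally show ?thesis by (simp add: I_def)
  qed
  obtain \<xi> where \<xi> [measurable]: "\<xi> \<in> borel_measurable M" and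
    joint: "distr M (borel \<Otimes>\<^sub>M borel) (\<lambda>\<omega>. (theta_disc H lam X0 B k \<omega>, \<xi> \<omega>)) = distr M borel (theta_disc H lam X0 B k) \<Otimes>\<^sub>M std_gaussian" and
    eq: "\<And>\<omega>. theta_interp H lam X0 B t \<omega> = theta_disc H lam X0 B k \<omega> - (t - real k * lam) *\<^sub>R H (theta_disc H lam X0 B k \<omega>)
      + sqrt (2 * (t - real k * lam)) *\<^sub>R \<xi> \<omega>"
    using M.theta_interp_as_euler[OF BM E.H_measurable step(1) t_in] by blast
  have [measurable]: "theta_disc H lam X0 B k \<in> borel_measurable M"
    using step(1) by (intro M.theta_disc_joint_law(1)[OF BM E.H_measurable step(1), of k "real (Suc k) * lam"]) simp
  have gap: "(\<integral>\<^sup>+\<omega>. ennreal ((norm (h (theta_interp H lam X0 B t \<omega>) - H (theta_disc H lam X0 B k \<omega>)))\<^sup>2) \<partial>M) = ennreal J"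
  proof -
    let ?G = "\<lambda>q. ennreal ((norm (h (E.euler \<tau> q) - H (fst q)))\<^sup>2)"
    have "?G \<in> borel_measurable E.Q" by measurable
    then have G [measurable]: "?G \<in> borel_measurable (borel \<Otimes>\<^sub>M borel)"
      using E.sets_Q by (simp cong: measurable_cong_sets)
    have "(\<integral>\<^sup>+\<omega>. ennreal ((norm (h (theta_interp H lam X0 B t \<omega>) - H (theta_disc H lam X0 B k \<omega>)))\<^sup>2) \<partial>M)
        = (\<integral>\<^sup>+\<omega>. ?G (theta_disc H lam X0 B k \<omega>, \<xi> \<omega>) \<partial>M)"
      by (simp add: eq E.euler_def \<tau>_def)
    also have "\<dots> = (\<integral>\<^sup>+q. ?G q \<partial>distr M (borel \<Otimes>\<^sub>M borel) (\<lambda>\<omega>. (theta_disc H lam X0 B k \<omega>, \<xi> \<omega>)))"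
      by (rule nn_integral_distr[symmetric]) measurable
    also have "\<dots> = (\<integral>\<^sup>+q. ?G q \<partial>E.Q)" unfolding joint p(2) ..
    also have "\<dots> = ennreal J" unfolding J_def using D(3) by (rule nn_integral_eq_integral) simp
    finally show ?thesis .
  qed
  have J0: "0 \<le> J" by (simp add: J_def)
  \<comment> \<open>Fisher information and error have been identified with finite reals, so the
    extended-real inequality is the real one.\<close>
  have "- (3/4) * ereal I + ereal J = ereal (- (3/4) * I + J)"
    by simp
  then have "ereal D \<le> - (3/4) * ereal I + ereal J"
    using D(4) by (simp add: I_def J_def)
  then show ?thesis
    using der J0 unfolding H_def[symmetric] fisher gap by (auto simp: enn2ereal_ennreal)
qed

end
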